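(* Let $\{\mathscr P_n:n\ge1\}$ be a sequence of random minimization problems (as in the context) with inputs in $\mathcal X=\mathbb R^d$, satisfying the uniqueness assumption and the regularity assumption, and satisfying the Taylor-type assumption of the context, with functions $H_{n,i}$ ($i\in I_n$), $R_{n,j},\widetilde R_{n,j}$ and exponents $\upsilon_j$ ($j\in[L]$), with either (B2) or (B2$'$). Suppose the input distribution $\mathcal P$ satisfies the rejection assumption of the context. Let $\{\theta_n\}_{n\ge1}$ be a sequence of positive reals such that the following hold. (C1) For some $\lambda\in[0,\infty)$ there are positive reals $\{\varsigma_{n,\lambda}\}$ with $$\Bigl(\mathbb E\sup_{\omega\in\mathcal N_{n,\theta_n}}\sum_{i\in I_n}\|H_{n,i}(\mathbf X^n;\omega)\|_2^{(1+\lambda)/\lambda}\Bigr)^{\lambda/(1+\lambda)}=O(\varsigma_{n,\lambda}),\quad n\to\infty,$$ where for $\lambda=0$ this is understood as $\bigl\|\sup_{\omega\in\mathcal N_{n,\theta_n}}\sup_{i\in I_n}\|H_{n,i}(\mathbf X^n;\omega)\|_2\bigr\|_{L^\infty}=O(\varsigma_{n,0})$. (C2) For every $j\in[L]$ there are $\gamma_j\in[0,\infty]$ and sequences of positive reals $\{\nu_{n,j}\},\{\widetilde\nu_{n,j}\}$ such that, as $n\to\infty$, $$\Bigl[\mathbb E\Bigl(\sup_{\omega\in\mathcal N_{n,\theta_n}}R_{n,j}(\mathbf X^n,\widetilde{\mathbf W}^n;\omega)^{(1+\gamma_j)/\gamma_j}\Bigr)\Bigr]^{\gamma_j/(1+\gamma_j)}=O(\nu_{n,j}),\qquad\bigl[\mathbb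 E(\widetilde R_{n,j}(\mathbf X^n)^{1+\gamma_j})\bigr]^{1/(1+\gamma_j)}=O(\widetilde\nu_{n,j}),$$ where $\widetilde{\mathbf W}^n=(\widetilde W_{n,i})_{i\in I_n}$ is any collection of mean-zero sub-Gaussian vectors in $\mathbb R^d$ with variance proxy $1$ (i.e. $\widetilde W_{n,i}\in\mathscr G(1,0;d)$ for all $i$) such that $\{(X_{n,i},\widetilde W_{n,i})\}_{i\in I_n}$ is i.i.d. If (B2$'$) holds, it is enough that this holds when $\widetilde{\mathbf W}^n$ is a collection of independent standard Gaussian vectors in $\mathbb R^d$, independent of $\mathbf X^n$. (C3) Let $d_{2,n}$ be the (random) pseudo-metric on $\mathcal S_n$ $$d_{2,n}(\omega_1,\omega_2)=\Bigl(\sum_{i\in I_n}\|H_{n,i}(\mathbf X^n;\omega_1)-H_{n,i}(\mathbf X^n;\omega_2)\|_2^2\Bigr)^{1/2}.$$ There exist $\varepsilon_0>0$ and positive reals $\{\tau_n\}$ such that for any $\varepsilon\in(0,\varepsilon_0)$ and $\delta>0$ there exist $\kappa_{\varepsilon,\delta}>0$ and $K_{\varepsilon,\delta}\in\mathbb N$ with $$\limsup_{n\to\infty}\mathbb P\bigl[P(\mathcal N_{n,\theta_n},d_n,\varepsilon)>K_{\varepsilon,\delta}\,P(\mathcal N_{n,\theta_n},d_{2,n},\tau_n\kappa_{\varepsilon,\delta})\bigr]\le\delta.$$ Then $\{P(\mathcal N_{n,\theta_n},d_n,\varepsilon):n\ge1\}$ is a tight family of random variables for every $\varepsilon>0$,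 provided that $$\theta_n=O\Bigl(\tau_n\min\Bigl\{\frac{\tau_n^{1+\lambda}}{k_n\varsigma_{n,\lambda}^{1+\lambda}},\ \min_{1\le j\le L}\Bigl(\frac{\tau_n}{\nu_{n,j}\widetilde\nu_{n,j}}\Bigr)^{1/\upsilon_j}\Bigr\}\Bigr).$$
   Context: Random minimization problems. $\mathcal X=\mathbb R^d$ with Borel $\sigma$-algebra $\mathcal A$, and $\mathcal P$ is a probability measure on it. For each $n\ge1$, $\mathscr P_n$ has: a finite index set $I_n$ with $k_n=|I_n|\in\mathbb N$; a non-empty compact metric space $(\mathcal S_n,d_n)$ with $\sup_n\operatorname{diam}(\mathcal S_n)<\infty$; and an objective function $\psi_n:\mathcal X^{I_n}\times\mathcal S_n\to\mathbb R$, measurable with respect to $\overline{\mathcal A^{\otimes I_n}}\otimes\mathcal B_n$, where the bar denotes completion under $\mathcal P^{\otimes I_n}$ and $\mathcal B_n$ is the Borel $\sigma$-algebra of $\mathcal S_n$. The inputs $\mathbf X^n=(X_{n,i})_{i\in I_n}$ are i.i.d. with law $\mathcal P$; $\mathscr P_n$ is: minimize $\psi_n(\mathbf X^n;\omega)$ over $\omega\in\mathcal S_n$. $\psi_{n,\mathrm{opt}}(\mathbf x)=\inf_{\omega}\psi_n(\mathbf x;\omega)$. Uniqueness assumption: for each $n$, the complement of the set $\mathscr X_n$ of $\mathbf x\in\mathcal X^{I_n}$ for which $\psi_n(\mathbf x;\cdot)$ attains its infimum at a unique point $\widehat\omega_n(\mathbf x)\in\mathcal S_n$ is a $\mathcal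 P^{\otimes I_n}$-null set. Regularity assumption: $\psi_{n,\mathrm{opt}}$ is $\overline{\mathcal A^{\otimes I_n}}$-measurable, $\widehat\omega_n:\mathscr X_n\to\mathcal S_n$ is measurable (for the trace of $\overline{\mathcal A^{\otimes I_n}}$ and $\mathcal B_n$), and $\mathbb E[\psi_{n,\mathrm{opt}}(\mathbf X^n)]\in\mathbb R$ for all $n$. Near-optimal set: $\mathcal N_{n,\theta}=\{\omega\in\mathcal S_n:\psi_n(\mathbf X^n;\omega)\le\psi_{n,\mathrm{opt}}(\mathbf X^n)+\theta\}$. Packing number: $P(T,\mathsf d,\varepsilon)$ is the largest cardinality of a subset of $T$ whose distinct points have pairwise $\mathsf d$-distance $>\varepsilon$. Taylor-type assumption: there exist $L\in\mathbb N$ and measurable functions $H_{n,i}:\mathcal X^{I_n}\times\mathcal S_n\to\mathbb R^d$ ($i\in I_n$), $R_{n,1},\dots,R_{n,L}:\mathcal X^{I_n}\times\mathcal X^{I_n}\times\mathcal S_n\to\mathbb R_{\ge0}$, $\widetilde R_{n,1},\dots,\widetilde R_{n,L}:\mathcal X^{I_n}\to\mathbb R_{\ge0}$ such that, for $\mathbf x^n=(x_i)_{i\in I_n}$, $\mathbf c^n=(c_i)_{i\in I_n}\in\mathcal X^{I_n}$: (B1) for any $\omega\in\mathcal S_n$ and Lebesgue-almost every $\mathbf x^n,\mathbf c^n$, $$\psi_n(\mathbf x^n+\mathbf c^n;\omega)-\psi_n(\mathbf x^n;\omega)\le\sum_{i\in I_n}c_i\cdot H_{n,i}(\mathbf x^n;\omega)+\sum_{l=1}^LR_{n,l}(\mathbf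 x^n,\mathbf c^n;\omega)\,\widetilde R_{n,l}(\mathbf x^n+\mathbf c^n);$$ (B2) for each $j\in[L]$ there is a constant $\upsilon_j\in(0,\infty)$ such that for all $s>0$ and $\omega\in\mathcal S_n$, $R_{n,j}(\mathbf x^n,s\mathbf c^n;\omega)=s^{1+\upsilon_j}R_{n,j}(\mathbf x^n,\mathbf c^n;\omega)$. (B2$'$) (a stronger version sometimes used in place of (B2)): for all $s>0$ and $\widetilde{\mathbf c}^n=(\widetilde c_i)_{i\in I_n}$ with $\|\widetilde c_i\|_2\le\|c_i\|_2$ for all $i$, $R_{n,j}(\mathbf x^n,s\widetilde{\mathbf c}^n;\omega)\le s^{1+\upsilon_j}R_{n,j}(\mathbf x^n,\mathbf c^n;\omega)$ for all $\omega\in\mathcal S_n$. Rejection assumption: $\mathcal P$ has a density $f$ with respect to Lebesgue measure on $\mathbb R^d$ such that, for $X\sim\mathcal P$ and $W\sim N_d(\mathbf 0,I_d)$ independent and any $p,s\ge0$, $$\mathbb E\Bigl[\|W\|_2^p\Bigl(1-\frac{f(X+sW)}{f(X)}\Bigr)_+\Bigr]\le C(f,p)\,s,$$ with $C(f,p)$ a finite positive constant depending only on $f$ and $p$. Sub-Gamma: an integrable real $X$ is in $\mathscr G(\sigma^2,c)$ if $\log\mathbb E\exp[\lambda(X-\mathbb EX)]\le\lambda^2\sigma^2/(2(1-c|\lambda|))$ for all $|\lambda|<1/c$ (all $\lambda$ if $c=0$, the sub-Gaussian case); $\mathscr G(\sigma^2,c;d)$ is the class of $d$-dimensional random vectors all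 of whose coordinates are in $\mathscr G(\sigma^2,c)$. Conventions: $[L]=\{1,\dots,L\}$. The dual exponents $((1+\gamma)/\gamma,1+\gamma)$ may be $(\infty,1)$ (for $\gamma=0$) or $(1,\infty)$ (for $\gamma=\infty$), the corresponding expression with exponent $\infty$ being an $L^\infty$-norm.
   Formalization: In (B1) the exceptional Lebesgue-null set of pairs (x,c) is required not to depend on ω (for almost every x,c the bound holds for all ω); with an ω-dependent null set the theorem is false. *)

theory Defs
  imports "HOL-Probability.Probability" "HOL-Library.Landau_Symbols"
begin

subsection \<open>Expectations, norms and orders of magnitude of \<open>[0, \<infinity>]\<close>-valued quantities\<close>

text \<open>
  Suprema over random near-optimal sets and packing numbers of such sets are measurable only for
  the completed product \<open>\<sigma>\<close>-algebra. The completed measure is the restriction of the outer measure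
  and the integral of a nonnegative function with respect to it is the upper integral, as the lemmas
  below confirm. We therefore use \<^const>\<open>outer_measure_of\<close> and the upper integral: unlike
  \<^const>\<open>emeasure\<close> and \<^const>\<open>nn_integral\<close>, these have no arbitrary values off the measurable
  sets and functions.
\<close>

definition outer_nn_integral :: "'a measure \<Rightarrow> ('a \<Rightarrow> ennreal) \<Rightarrow> ennreal" where
  "outer_nn_integral M f =
     (INF g\<in>{g \<in> borel_measurable M. \<forall>x\<in>space M. f x \<le> g x}. \<integral>\<^sup>+ x. g x \<partial>M)"

definition outer_esssup :: "'a measure \<Rightarrow> ('a \<Rightarrow> ennreal) \<Rightarrow> ennreal" where
  "outer_esssup M f = Inf {c. AE x in M. f x \<le> c}"

lemma outer_nn_integral_completion:
  assumes f: "f \<in> borel_measurable (completion M)"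
  shows "outer_nn_integral M f = (\<integral>\<^sup>+ x. f x \<partial>completion M)"
proof (rule antisym)
  obtain f' where f': "f' \<in> borel_measurable M" "AE x in M. f x = f' x"
    using completion_ex_borel_measurable[OF f] by blast
  obtain N where N: "N \<in> null_sets M" "{x \<in> space M. f x \<noteq> f' x} \<subseteq> N"
    using f'(2) unfolding eventually_ae_filter by blast
  define g where "g = (\<lambda>x. if x \<in> N then \<top> else f' x)"
  have g: "g \<in> borel_measurable M"
    unfolding g_def using N(1) f'(1) by (intro measurable_If_set) auto
  have "f x \<le> g x" if "x \<in> space M" for x
    using N(2) that unfolding g_def by auto
  hence "outer_nn_integral M f \<le> (\<integral>\<^sup>+ x. g x \<partial>M)"
    unfolding outer_nn_integral_def using g by (intro INF_lower) auto
  also have "(\<integral>\<^sup>+ x. g x \<partial>M) = (\<integral>\<^sup>+ x. g x \<partial>completion M)"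
    by (simp add: nn_integral_completion)
  also have "\<dots> = (\<integral>\<^sup>+ x. f x \<partial>completion M)"
  proof (rule nn_integral_cong_AE)
    have "AE x in M. x \<notin> N" using N(1) by (rule AE_not_in)
    with f'(2) have "AE x in M. g x = f x"
      by eventually_elim (auto simp: g_def)
    thus "AE x in completion M. g x = f x" by (rule AE_completion)
  qed
  finally show "outer_nn_integral M f \<le> (\<integral>\<^sup>+ x. f x \<partial>completion M)" .
next
  show "(\<integral>\<^sup>+ x. f x \<partial>completion M) \<le> outer_nn_integral M f"
    unfolding outer_nn_integral_def
  proof (rule INF_greatest)
    fix g assume g: "g \<in> {g \<in> borel_measurable M. \<forall>x\<in>space M. f x \<le> g x}"
    have "(\<integral>\<^sup>+ x. f x \<partial>completion M) \<le> (\<integral>\<^sup>+ x. g x \<partial>completion M)"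
      using g by (intro nn_integral_mono) auto
    also have "\<dots> = (\<integral>\<^sup>+ x. g x \<partial>M)"
      by (simp add: nn_integral_completion)
    finally show "(\<integral>\<^sup>+ x. f x \<partial>completion M) \<le> (\<integral>\<^sup>+ x. g x \<partial>M)" .
  qed
qed

lemma outer_measure_of_completion:
  assumes "A \<in> sets (completion M)"
  shows "outer_measure_of M A = emeasure (completion M) A"
proof (rule antisym)
  obtain S N N' where A: "A = S \<union> N" "S \<in> sets M" "N' \<in> null_sets M" "N \<subseteq> N'"
    using assms by (rule sets_completionE)
  have "outer_measure_of M A \<le> outer_measure_of M (S \<union> N')"
    using A by (intro outer_measure_of_mono) auto
  also have "\<dots> = emeasure M (S \<union> N')"
    using A by (intro outer_measure_of_eq) auto
  also have "\<dots> = emeasure M S"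
    using A by (intro emeasure_Un_null_set) auto
  also have "\<dots> = emeasure (completion M) S"
    using A by simp
  also have "\<dots> \<le> emeasure (completion M) A"
    using A assms by (intro emeasure_mono) auto
  finally show "outer_measure_of M A \<le> emeasure (completion M) A" .
next
  show "emeasure (completion M) A \<le> outer_measure_of M A"
    unfolding outer_measure_of_def
  proof (rule INF_greatest)
    fix B assume B: "B \<in> {B \<in> sets M. A \<subseteq> B}"
    have "emeasure (completion M) A \<le> emeasure (completion M) B"
      using B by (intro emeasure_mono) auto
    thus "emeasure (completion M) A \<le> emeasure M B"
      using B by simp
  qed
qed

lemma outer_esssup_completion:
  assumes "f \<in> borel_measurable (completion M)"
  shows "outer_esssup M f = esssup (completion M) f"
  by (simp add: outer_esssup_def esssup_eq_AE[OF assms] AE_completion_iff)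

text \<open>The power \<open>a ^ r\<close> for real \<open>r > 0\<close>.\<close>

definition ennpowr :: "ennreal \<Rightarrow> real \<Rightarrow> ennreal" where
  "ennpowr a r = (if a = \<top> then \<top> else ennreal (enn2real a powr r))"

definition Lp_norm :: "'a measure \<Rightarrow> ennreal \<Rightarrow> ('a \<Rightarrow> ennreal) \<Rightarrow> ennreal" where
  "Lp_norm M p f =
     (if p = \<top> then outer_esssup M f
      else ennpowr (outer_nn_integral M (\<lambda>x. ennpowr (f x) (enn2real p))) (1 / enn2real p))"

definition ennreal_bigo :: "(nat \<Rightarrow> ennreal) \<Rightarrow> (nat \<Rightarrow> real) \<Rightarrow> bool" where
  "ennreal_bigo a b \<longleftrightarrow> (\<exists>C::real. \<forall>\<^sub>F n in sequentially. a n \<le> ennreal (C * b n))"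

text \<open>The variables are \<open>[0, \<infinity>]\<close>-valued and may live on different spaces.\<close>

definition tight_family :: "'k set \<Rightarrow> ('k \<Rightarrow> 'a measure) \<Rightarrow> ('k \<Rightarrow> 'a \<Rightarrow> enat) \<Rightarrow> bool" where
  "tight_family J M Y \<longleftrightarrow>
     (\<forall>\<delta>>0. \<exists>K::nat. \<forall>k\<in>J.
        outer_measure_of (M k) {x \<in> space (M k). Y k x > enat K} \<le> ennreal \<delta>)"


subsection \<open>Sub-Gamma and Gaussian laws, rejection condition\<close>

text \<open>Finiteness of the exponential moments is made explicit, as the Bochner integral of a
  non-integrable function is \<open>0\<close>.\<close>

definition sub_gamma :: "'a measure \<Rightarrow> real \<Rightarrow> real \<Rightarrow> ('a \<Rightarrow> real) \<Rightarrow> bool" where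
  "sub_gamma M \<sigma>2 c X \<longleftrightarrow>
     integrable M X \<and>
     (\<forall>t::real. (c = 0 \<or> \<bar>t\<bar> < 1 / c) \<longrightarrow>
        integrable M (\<lambda>w. exp (t * (X w - (\<integral>v. X v \<partial>M)))) \<and>
        ln (\<integral>w. exp (t * (X w - (\<integral>v. X v \<partial>M))) \<partial>M) \<le> t\<^sup>2 * \<sigma>2 / (2 * (1 - c * \<bar>t\<bar>)))"

definition sub_gamma_vec :: "'a measure \<Rightarrow> real \<Rightarrow> real \<Rightarrow> ('a \<Rightarrow> real ^ 'd) \<Rightarrow> bool" where
  "sub_gamma_vec M \<sigma>2 c X \<longleftrightarrow> (\<forall>k. sub_gamma M \<sigma>2 c (\<lambda>w. X w $ k))"

definition std_gaussian :: "(real ^ 'd) measure" where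
  "std_gaussian = density lborel (\<lambda>w. ennreal (\<Prod>k\<in>UNIV. std_normal_density (w $ k)))"

definition rejection_condition :: "(real ^ 'd) measure \<Rightarrow> bool" where
  "rejection_condition P \<longleftrightarrow>
     (\<exists>f::real ^ 'd \<Rightarrow> real.
        f \<in> borel_measurable borel \<and> (\<forall>x. 0 \<le> f x) \<and>
        P = density lborel (\<lambda>x. ennreal (f x)) \<and>
        (\<forall>p\<ge>0. \<exists>C>0. \<forall>s\<ge>0.
           (\<integral>\<^sup>+ (x, w). ennreal (norm w powr p * max 0 (1 - f (x + s *\<^sub>R w) / f x))
              \<partial>(P \<Otimes>\<^sub>M std_gaussian)) \<le> ennreal (C * s)))"


subsection \<open>Random minimization problems\<close>

text \<open>
  The input \<open>(X_i)\<^bsub>i \<in> I\<^esub>\<close> with i.i.d. entries of law \<open>P\<close> is realised as the identity on the product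
  space \<open>PiM I (\<lambda>_. P)\<close>. Elements of \<open>(\<real>\<^sup>d)\<^sup>I\<close> are functions with value \<^term>\<open>undefined\<close> off \<open>I\<close>,
  whence the restrictions below.
\<close>

definition packing_number :: "'s set \<Rightarrow> ('s \<Rightarrow> 's \<Rightarrow> real) \<Rightarrow> real \<Rightarrow> enat" where
  "packing_number T \<rho> \<epsilon> =
     (SUP A\<in>{A. A \<subseteq> T \<and> (\<forall>x\<in>A. \<forall>y\<in>A. x \<noteq> y \<longrightarrow> \<rho> x y > \<epsilon>)}.
        if finite A then enat (card A) else \<infinity>)"

definition metric_borel :: "'s metric \<Rightarrow> 's measure" where
  "metric_borel S = sigma (mspace S) {U. openin (mtopology_of S) U}"

locale random_min_problem =
  fixes P :: "(real ^ 'd) measure" and I :: "'i set" and S :: "'s metric"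
    and \<psi> :: "('i \<Rightarrow> real ^ 'd) \<Rightarrow> 's \<Rightarrow> real"
  assumes prob_space_P: "prob_space P"
    and sets_P: "sets P = sets borel"
    and finite_I: "finite I" and I_nonempty: "I \<noteq> {}"
    and S_nonempty: "mspace S \<noteq> {}"
    and compact_S: "compact_space (mtopology_of S)"
    and measurable_objective: "(\<lambda>(x, \<omega>). \<psi> x \<omega>) \<in>
      borel_measurable (completion (PiM I (\<lambda>_. P)) \<Otimes>\<^sub>M metric_borel S)"

text \<open>Where \<open>\<psi> x\<close> is unbounded below (a null set under the uniqueness assumption), the real-valued
  infimum carries no information.\<close>

definition opt_value :: "'s metric \<Rightarrow> ('x \<Rightarrow> 's \<Rightarrow> real) \<Rightarrow> 'x \<Rightarrow> real" where
  "opt_value S \<psi> x = (INF \<omega>\<in>mspace S. \<psi> x \<omega>)"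

definition near_opt :: "'s metric \<Rightarrow> ('x \<Rightarrow> 's \<Rightarrow> real) \<Rightarrow> real \<Rightarrow> 'x \<Rightarrow> 's set" where
  "near_opt S \<psi> \<theta> x = {\<omega> \<in> mspace S. \<psi> x \<omega> \<le> opt_value S \<psi> x + \<theta>}"

definition is_minimizer :: "'s metric \<Rightarrow> ('x \<Rightarrow> 's \<Rightarrow> real) \<Rightarrow> 'x \<Rightarrow> 's \<Rightarrow> bool" where
  "is_minimizer S \<psi> x \<omega> \<longleftrightarrow> \<omega> \<in> mspace S \<and> (\<forall>\<omega>'\<in>mspace S. \<psi> x \<omega> \<le> \<psi> x \<omega>')"

definition unique_min_inputs ::
    "(real ^ 'd) measure \<Rightarrow> 'i set \<Rightarrow> 's metric \<Rightarrow> (('i \<Rightarrow> real ^ 'd) \<Rightarrow> 's \<Rightarrow> real) \<Rightarrow> ('i \<Rightarrow> real ^ 'd) set" where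
  "unique_min_inputs P I S \<psi> = {x \<in> space (PiM I (\<lambda>_. P)). \<exists>!\<omega>. is_minimizer S \<psi> x \<omega>}"

definition uniqueness_condition ::
    "(real ^ 'd) measure \<Rightarrow> 'i set \<Rightarrow> 's metric \<Rightarrow> (('i \<Rightarrow> real ^ 'd) \<Rightarrow> 's \<Rightarrow> real) \<Rightarrow> bool" where
  "uniqueness_condition P I S \<psi> \<longleftrightarrow>
     space (PiM I (\<lambda>_. P)) - unique_min_inputs P I S \<psi> \<in> null_sets (completion (PiM I (\<lambda>_. P)))"

definition regularity_condition ::
    "(real ^ 'd) measure \<Rightarrow> 'i set \<Rightarrow> 's metric \<Rightarrow> (('i \<Rightarrow> real ^ 'd) \<Rightarrow> 's \<Rightarrow> real) \<Rightarrow> bool" where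
  "regularity_condition P I S \<psi> \<longleftrightarrow>
     opt_value S \<psi> \<in> borel_measurable (completion (PiM I (\<lambda>_. P))) \<and>
     (\<lambda>x. THE \<omega>. is_minimizer S \<psi> x \<omega>) \<in>
       restrict_space (completion (PiM I (\<lambda>_. P))) (unique_min_inputs P I S \<psi>)
         \<rightarrow>\<^sub>M metric_borel S \<and>
     integrable (completion (PiM I (\<lambda>_. P))) (opt_value S \<psi>)"


subsection \<open>Taylor-type conditions\<close>

definition taylor_measurable ::
    "(real ^ 'd) measure \<Rightarrow> 'i set \<Rightarrow> 's metric \<Rightarrow> nat
      \<Rightarrow> ('i \<Rightarrow> ('i \<Rightarrow> real ^ 'd) \<Rightarrow> 's \<Rightarrow> real ^ 'd)
      \<Rightarrow> (nat \<Rightarrow> ('i \<Rightarrow> real ^ 'd) \<Rightarrow> ('i \<Rightarrow> real ^ 'd) \<Rightarrow> 's \<Rightarrow> real)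
      \<Rightarrow> (nat \<Rightarrow> ('i \<Rightarrow> real ^ 'd) \<Rightarrow> real) \<Rightarrow> bool" where
  "taylor_measurable P I S L H R R' \<longleftrightarrow>
     (\<forall>i\<in>I. (\<lambda>(x, \<omega>). H i x \<omega>) \<in>
        borel_measurable (completion (PiM I (\<lambda>_. P)) \<Otimes>\<^sub>M metric_borel S)) \<and>
     (\<forall>j\<in>{1..L}.
        (\<lambda>(x, c, \<omega>). R j x c \<omega>) \<in>
          borel_measurable (completion (PiM I (\<lambda>_. P)) \<Otimes>\<^sub>M (PiM I (\<lambda>_. borel) \<Otimes>\<^sub>M metric_borel S)) \<and>
        R' j \<in> borel_measurable (completion (PiM I (\<lambda>_. P))) \<and>
        (\<forall>x\<in>I \<rightarrow>\<^sub>E UNIV. \<forall>c\<in>I \<rightarrow>\<^sub>E UNIV. \<forall>\<omega>\<in>mspace S. 0 \<le> R j x c \<omega>) \<and>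
        (\<forall>x\<in>I \<rightarrow>\<^sub>E UNIV. 0 \<le> R' j x))"

text \<open>The exceptional Lebesgue null set of pairs \<open>(x, c)\<close> does not depend on \<open>\<omega>\<close>: the bound is to be
  applied at points \<open>\<omega>\<close> of the random set of near-optimal solutions for the input \<open>x\<close>.\<close>

definition taylor_bound ::
    "'i set \<Rightarrow> 's metric \<Rightarrow> (('i \<Rightarrow> real ^ 'd) \<Rightarrow> 's \<Rightarrow> real) \<Rightarrow> nat
      \<Rightarrow> ('i \<Rightarrow> ('i \<Rightarrow> real ^ 'd) \<Rightarrow> 's \<Rightarrow> real ^ 'd)
      \<Rightarrow> (nat \<Rightarrow> ('i \<Rightarrow> real ^ 'd) \<Rightarrow> ('i \<Rightarrow> real ^ 'd) \<Rightarrow> 's \<Rightarrow> real)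
      \<Rightarrow> (nat \<Rightarrow> ('i \<Rightarrow> real ^ 'd) \<Rightarrow> real) \<Rightarrow> bool" where
  "taylor_bound I S \<psi> L H R R' \<longleftrightarrow>
     (AE (x, c) in PiM I (\<lambda>_. lborel) \<Otimes>\<^sub>M PiM I (\<lambda>_. lborel). \<forall>\<omega>\<in>mspace S.
        \<psi> (\<lambda>i\<in>I. x i + c i) \<omega> - \<psi> x \<omega>
          \<le> (\<Sum>i\<in>I. c i \<bullet> H i x \<omega>) + (\<Sum>l=1..L. R l x c \<omega> * R' l (\<lambda>i\<in>I. x i + c i)))"

definition remainder_homogeneous ::
    "'i set \<Rightarrow> 's metric \<Rightarrow> real \<Rightarrow> (('i \<Rightarrow> real ^ 'd) \<Rightarrow> ('i \<Rightarrow> real ^ 'd) \<Rightarrow> 's \<Rightarrow> real) \<Rightarrow> bool" where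
  "remainder_homogeneous I S \<upsilon> R \<longleftrightarrow>
     (\<forall>x\<in>I \<rightarrow>\<^sub>E UNIV. \<forall>c\<in>I \<rightarrow>\<^sub>E UNIV. \<forall>s>0. \<forall>\<omega>\<in>mspace S.
        R x (\<lambda>i\<in>I. s *\<^sub>R c i) \<omega> = s powr (1 + \<upsilon>) * R x c \<omega>)"

definition remainder_monotone ::
    "'i set \<Rightarrow> 's metric \<Rightarrow> real \<Rightarrow> (('i \<Rightarrow> real ^ 'd) \<Rightarrow> ('i \<Rightarrow> real ^ 'd) \<Rightarrow> 's \<Rightarrow> real) \<Rightarrow> bool" where
  "remainder_monotone I S \<upsilon> R \<longleftrightarrow>
     (\<forall>x\<in>I \<rightarrow>\<^sub>E UNIV. \<forall>c\<in>I \<rightarrow>\<^sub>E UNIV. \<forall>c'\<in>I \<rightarrow>\<^sub>E UNIV.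
        (\<forall>i\<in>I. norm (c' i) \<le> norm (c i)) \<longrightarrow>
        (\<forall>s>0. \<forall>\<omega>\<in>mspace S. R x (\<lambda>i\<in>I. s *\<^sub>R c' i) \<omega> \<le> s powr (1 + \<upsilon>) * R x c \<omega>))"


subsection \<open>Moment quantities over near-optimal sets\<close>

text \<open>Here \<open>N x\<close> stands for the random near-optimal set.\<close>

definition gradient_moment ::
    "(real ^ 'd) measure \<Rightarrow> 'i set \<Rightarrow> (('i \<Rightarrow> real ^ 'd) \<Rightarrow> 's set)
      \<Rightarrow> ('i \<Rightarrow> ('i \<Rightarrow> real ^ 'd) \<Rightarrow> 's \<Rightarrow> real ^ 'd) \<Rightarrow> real \<Rightarrow> ennreal" where
  "gradient_moment P I N H l =
     (if l = 0
      then Lp_norm (PiM I (\<lambda>_. P)) \<top> (\<lambda>x. SUP \<omega>\<in>N x. SUP i\<in>I. ennreal (norm (H i x \<omega>)))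
      else ennpowr
        (outer_nn_integral (PiM I (\<lambda>_. P))
           (\<lambda>x. SUP \<omega>\<in>N x. ennreal (\<Sum>i\<in>I. norm (H i x \<omega>) powr ((1 + l) / l))))
        (l / (1 + l)))"

text \<open>
  \<open>Q\<close> is the common joint law of the i.i.d. pairs \<open>(X_i, W_i)\<close>, realised as coordinates on the
  product space. The exponent \<open>1 + 1 / \<gamma>\<close> is \<open>(1 + \<gamma>) / \<gamma>\<close>, with the values \<open>\<infinity>\<close> and \<open>1\<close>
  for \<open>\<gamma> = 0\<close> and \<open>\<gamma> = \<infinity>\<close>.
\<close>

definition remainder_moment ::
    "((real ^ 'd) \<times> (real ^ 'd)) measure \<Rightarrow> 'i set \<Rightarrow> (('i \<Rightarrow> real ^ 'd) \<Rightarrow> 's set)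
      \<Rightarrow> (('i \<Rightarrow> real ^ 'd) \<Rightarrow> ('i \<Rightarrow> real ^ 'd) \<Rightarrow> 's \<Rightarrow> real) \<Rightarrow> ennreal \<Rightarrow> ennreal" where
  "remainder_moment Q I N R \<gamma> =
     Lp_norm (PiM I (\<lambda>_. Q)) (1 + 1 / \<gamma>)
       (\<lambda>z. let x = (\<lambda>i\<in>I. fst (z i)); w = (\<lambda>i\<in>I. snd (z i))
            in SUP \<omega>\<in>N x. ennreal (R x w \<omega>))"

definition sub_gaussian_coupling ::
    "(real ^ 'd) measure \<Rightarrow> ((real ^ 'd) \<times> (real ^ 'd)) measure \<Rightarrow> bool" where
  "sub_gaussian_coupling P Q \<longleftrightarrow>
     prob_space Q \<and> sets Q = sets (borel \<Otimes>\<^sub>M borel) \<and>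
     distr Q borel fst = P \<and>
     sub_gamma_vec Q 1 0 snd \<and> (\<forall>k. (\<integral>z. snd z $ k \<partial>Q) = 0)"

definition gradient_dist ::
    "'i set \<Rightarrow> ('i \<Rightarrow> ('i \<Rightarrow> real ^ 'd) \<Rightarrow> 's \<Rightarrow> real ^ 'd) \<Rightarrow> ('i \<Rightarrow> real ^ 'd) \<Rightarrow> 's \<Rightarrow> 's \<Rightarrow> real" where
  "gradient_dist I H x \<omega>1 \<omega>2 = sqrt (\<Sum>i\<in>I. (norm (H i x \<omega>1 - H i x \<omega>2))\<^sup>2)"

end

theory Submission
  imports Defs
begin

text \<open>
  Move every input \<open>X\<^sub>i\<close> to \<open>X\<^sub>i + s V\<^sub>i\<close>, where \<open>V\<^sub>i\<close> is a nearly Gaussian vector \<open>W\<^sub>i\<close> corrected so that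
  the moved input again has law \<open>P\<close>. The optimal value then keeps its law, while the Taylor bound at the
  near-optimal points \<open>\<omega>\<close> shows that it decreases by at least
  \<open>s sup\<^bsub>\<omega>\<^esub> (- \<Sum>\<^bsub>i\<^esub> W\<^sub>i \<bullet> H\<^sub>i(X; \<omega>))\<close> up to \<open>\<theta>\<close>, the remainders and the error from
  \<open>V\<^sub>i \<noteq> W\<^sub>i\<close>. For \<open>s\<close> equal to the minimum in the bound on \<open>\<theta>\<close>, all of these are \<open>O(s \<tau>)\<close> in mean, so
  the conditional mean of the supremum given \<open>X\<close> is \<open>O(\<tau>)\<close> in probability. By a weak form of
  Sudakov's minoration this bounds the packing numbers for the gradient pseudo-metric at scale \<open>\<tau> \<kappa>\<close>.

  Since the suprema over near-optimal points are not known to be measurable, they are replaced by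
  measurable majorants before Fubini's theorem is applied.
\<close>

subsection \<open>The standard Gaussian measure\<close>

text \<open>The number k of inputs may grow with n, so no constant may depend on it. One proposal is
  rejected with probability O(s), even when weighted by powers of its norm; hence the moments of
  order 1 + \<lambda> of \<open>V - W\<close>, summed over the inputs, are O(k s). Young's
  inequality against the gradient norms makes this an error O(s \<tau>) if
  \<open>k * s * \<sigma> powr (1 + \<lambda>)\<close> is at most
  \<open>\<tau> powr (1 + \<lambda>)\<close>. A remainder of degree 1 + \<upsilon> costs
  \<open>s powr (1 + \<upsilon>) * \<nu> * \<nu>'\<close>, which the second part of the minimum
  keeps below s \<tau>.

  Only the corrected vectors V depend on the inputs: W stays exactly standard Gaussian given X, so
  that the minoration applies conditionally on X. It need not have the sharp logarithmic rate. It
  suffices that for every B some M, depending on B alone, makes the mean maximum over M points at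
  mutual distances above a at least B a. As the conditional mean is O(\<tau>), Markov's inequality
  bounds the probability of M points at distances above \<tau> \<kappa> by a multiple of 1 / (B
  \<kappa>), and B can be taken as large as needed.\<close>

lemma space_std_gaussian [simp]: "space std_gaussian = UNIV"
  by (simp add: std_gaussian_def)

lemma sets_std_gaussian [measurable_cong, simp]: "sets std_gaussian = sets borel"
  by (simp add: std_gaussian_def)

lemma measurable_vec_nth_borel [measurable (raw)]:
  "f \<in> borel_measurable M \<Longrightarrow> (\<lambda>x. (f x :: real ^ 'd) $ k) \<in> borel_measurable M"
  by (rule measurable_compose[OF _ borel_measurable_continuous_onI])
     (auto intro!: continuous_intros)

lemma Basis_vec_real_eq: "(Basis :: (real ^ 'd) set) = range (\<lambda>k. axis k 1)"
  by (auto simp: Basis_vec_def)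

lemma prod_vec_nth_eq_prod_Basis:
  fixes w :: "real ^ 'd"
  shows "(\<Prod>k\<in>UNIV. g (w $ k)) = (\<Prod>b\<in>Basis. g (w \<bullet> b))"
  unfolding Basis_vec_real_eq
  by (subst prod.reindex) (auto simp: inj_on_def axis_eq_axis inner_axis)

lemma prod_std_normal_density:
  "(\<Prod>k\<in>UNIV. std_normal_density ((w :: real ^ 'd) $ k)) =
     (1 / sqrt (2 * pi)) ^ CARD('d) * exp (- (w \<bullet> w) / 2)"
  by (simp add: std_normal_density_def prod_dividef exp_sum[symmetric] inner_vec_def
      sum_divide_distrib sum_negf power2_eq_square power_divide)

lemma prob_space_std_gaussian: "prob_space (std_gaussian :: (real ^ 'd) measure)"
proof
  have "emeasure (std_gaussian :: (real ^ 'd) measure) (space std_gaussian) =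
      (\<integral>\<^sup>+ w. (\<Prod>b\<in>Basis. ennreal (std_normal_density (w \<bullet> b))) \<partial>(lborel :: (real ^ 'd) measure))"
    unfolding std_gaussian_def
    by (simp add: emeasure_density prod_vec_nth_eq_prod_Basis prod_ennreal)
  also have "\<dots> = (\<Prod>b\<in>(Basis :: (real ^ 'd) set). \<integral>\<^sup>+ x. ennreal (std_normal_density x) \<partial>lborel)"
    by (rule nn_integral_lborel_prod) auto
  also have "(\<integral>\<^sup>+ x. ennreal (std_normal_density x) \<partial>lborel) = 1"
    using prob_space.emeasure_space_1[OF prob_space_normal_density[of 1 0]]
    by (simp add: emeasure_density)
  finally show "emeasure (std_gaussian :: (real ^ 'd) measure) (space std_gaussian) = 1"
    by simp
qed

lemma nn_integral_std_gaussian: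
  assumes [measurable]: "h \<in> borel_measurable borel"
  shows "(\<integral>\<^sup>+ w. h w \<partial>std_gaussian) =
    (\<integral>\<^sup>+ w. ennreal ((1 / sqrt (2 * pi)) ^ CARD('d) * exp (- (w \<bullet> w) / 2)) * h (w :: real ^ 'd) \<partial>lborel)"
  unfolding std_gaussian_def prod_std_normal_density by (subst nn_integral_density) auto

lemma nn_integral_lborel_shift:
  fixes t :: "'a :: euclidean_space"
  assumes [measurable]: "h \<in> borel_measurable borel"
  shows "(\<integral>\<^sup>+ x. h (x + t) \<partial>lborel) = (\<integral>\<^sup>+ x. h x \<partial>lborel)"
proof -
  have "(\<integral>\<^sup>+ x. h x \<partial>lborel) = (\<integral>\<^sup>+ x. h x \<partial>distr lborel borel ((+) t))"
    by (simp add: lborel_distr_plus)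
  also have "\<dots> = (\<integral>\<^sup>+ x. h (x + t) \<partial>lborel)"
    by (subst nn_integral_distr) (auto simp: add.commute)
  finally show ?thesis by simp
qed

lemma nn_integral_lborel_uminus:
  assumes [measurable]: "h \<in> borel_measurable borel"
  shows "(\<integral>\<^sup>+ x. h (- x) \<partial>lborel) = (\<integral>\<^sup>+ x. h (x :: 'a :: euclidean_space) \<partial>lborel)"
proof -
  have "(\<integral>\<^sup>+ x. h x \<partial>lborel) = (\<integral>\<^sup>+ x. h x \<partial>distr lborel borel (\<lambda>x. - x :: 'a))"
    using lborel_affine[of "-1 :: real" "0 :: 'a"] by (simp add: density_1)
  also have "\<dots> = (\<integral>\<^sup>+ x. h (- x) \<partial>lborel)"
    by (subst nn_integral_distr) auto
  finally show ?thesis by simp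
qed

lemma nn_integral_std_gaussian_uminus:
  assumes [measurable]: "h \<in> borel_measurable borel"
  shows "(\<integral>\<^sup>+ w. h (- w) \<partial>std_gaussian) = (\<integral>\<^sup>+ w. h (w :: real ^ 'd) \<partial>std_gaussian)"
  unfolding nn_integral_std_gaussian[OF assms]
  by (subst nn_integral_std_gaussian, simp, subst nn_integral_lborel_uminus[symmetric]) simp_all

text \<open>Completing the square: translating the Gaussian law is the same as tilting it
  exponentially (Cameron-Martin). The exponential moments and the likelihoods below come from this
  identity.\<close>

lemma nn_integral_std_gaussian_shift:
  fixes t :: "real ^ 'd"
  assumes [measurable]: "h \<in> borel_measurable borel"
  shows "(\<integral>\<^sup>+ w. h (w + t) \<partial>std_gaussian) =
    (\<integral>\<^sup>+ w. ennreal (exp (t \<bullet> w - (t \<bullet> t) / 2)) * h w \<partial>std_gaussian)"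
proof -
  let ?c = "(1 / sqrt (2 * pi)) ^ CARD('d)"
  have *: "exp (- (w \<bullet> w) / 2) * exp (t \<bullet> w - (t \<bullet> t) / 2) = exp (- ((w - t) \<bullet> (w - t)) / 2)"
    for w :: "real ^ 'd"
    by (simp add: exp_add[symmetric] inner_diff inner_commute field_simps)
  have "(\<integral>\<^sup>+ w. ennreal (exp (t \<bullet> w - (t \<bullet> t) / 2)) * h w \<partial>std_gaussian) =
     (\<integral>\<^sup>+ w. ennreal (?c * exp (- (w \<bullet> w) / 2) * exp (t \<bullet> w - (t \<bullet> t) / 2)) * h w \<partial>lborel)"
    by (subst nn_integral_std_gaussian) (auto simp: ennreal_mult mult.assoc intro!: nn_integral_cong)
  also have "\<dots> = (\<integral>\<^sup>+ w. ennreal (?c * exp (- ((w - t) \<bullet> (w - t)) / 2)) * h w \<partial>lborel)"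
    unfolding mult.assoc * ..
  also have "\<dots> = (\<integral>\<^sup>+ w. ennreal (?c * exp (- (w \<bullet> w) / 2)) * h (w + t) \<partial>lborel)"
    by (subst nn_integral_lborel_shift[symmetric, where t = t]) simp_all
  also have "\<dots> = (\<integral>\<^sup>+ w. h (w + t) \<partial>std_gaussian)"
    by (subst nn_integral_std_gaussian) auto
  finally show ?thesis ..
qed

lemma nn_integral_exp_std_gaussian:
  "(\<integral>\<^sup>+ w. ennreal (exp (t * (w $ k))) \<partial>(std_gaussian :: (real ^ 'd) measure)) = ennreal (exp (t\<^sup>2 / 2))"
proof -
  interpret prob_space "std_gaussian :: (real ^ 'd) measure" by (rule prob_space_std_gaussian)
  let ?t = "axis k t :: real ^ 'd"
  have t: "?t \<bullet> w = t * (w $ k)" "?t \<bullet> ?t = t\<^sup>2" for w :: "real ^ 'd"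
    by (simp_all add: inner_axis' power2_eq_square)
  have "(\<integral>\<^sup>+ w. ennreal (exp (t * (w $ k))) \<partial>(std_gaussian :: (real ^ 'd) measure)) =
     (\<integral>\<^sup>+ w. ennreal (exp (?t \<bullet> w - (?t \<bullet> ?t) / 2)) * ennreal (exp (t\<^sup>2 / 2)) \<partial>std_gaussian)"
    unfolding t by (intro nn_integral_cong) (simp add: ennreal_mult[symmetric] exp_add[symmetric] power2_eq_square)
  also have "\<dots> = (\<integral>\<^sup>+ w. ennreal (exp (t\<^sup>2 / 2)) \<partial>(std_gaussian :: (real ^ 'd) measure))"
    by (subst nn_integral_std_gaussian_shift[symmetric]) auto
  also have "\<dots> = ennreal (exp (t\<^sup>2 / 2))"
    using emeasure_space_1 by simp
  finally show ?thesis .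
qed

lemma AE_lborel_vec_nth_neq_0: "AE w in (lborel :: (real ^ 'd) measure). w $ k \<noteq> 0"
proof -
  have "negligible {w :: real ^ 'd. axis k 1 \<bullet> w = 0}"
    by (rule negligible_hyperplane) (simp add: axis_eq_0_iff)
  hence "{w :: real ^ 'd. w $ k = 0} \<in> null_sets lebesgue"
    by (simp add: negligible_iff_null_sets inner_axis')
  hence "AE w in (lebesgue :: (real ^ 'd) measure). w $ k \<noteq> 0"
    by (rule AE_I') auto
  thus ?thesis by (simp add: AE_completion_iff)
qed

lemma AE_std_gaussian_vec_nth_neq_0: "AE w in (std_gaussian :: (real ^ 'd) measure). w $ k \<noteq> 0"
  unfolding std_gaussian_def using AE_lborel_vec_nth_neq_0[of k]
  by (subst AE_density) auto

subsection \<open>Finite products of measures\<close>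

text \<open>The indicator of a box factors over the coordinates, so Fubini gives the same value for
  both measures on boxes. It is used for Gaussian likelihoods, Radon-Nikodym derivatives and the
  densities of the moves alike.\<close>

lemma PiM_density:
  assumes "finite I" "product_sigma_finite M" "product_sigma_finite (\<lambda>i. density (M i) (f i))"
    and f [measurable]: "\<And>i. i \<in> I \<Longrightarrow> f i \<in> borel_measurable (M i)"
  shows "density (PiM I M) (\<lambda>x. \<Prod>i\<in>I. f i (x i)) = PiM I (\<lambda>i. density (M i) (f i))"
proof -
  interpret M: product_sigma_finite M by fact
  interpret D: product_sigma_finite "\<lambda>i. density (M i) (f i)" by fact
  show ?thesis
  proof (rule D.PiM_eqI)
    show "sets (density (PiM I M) (\<lambda>x. \<Prod>i\<in>I. f i (x i))) = sets (PiM I (\<lambda>i. density (M i) (f i)))"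
      by (auto intro!: sets_PiM_cong)
    fix A assume "\<And>i. i \<in> I \<Longrightarrow> A i \<in> sets (density (M i) (f i))"
    hence A [measurable]: "A i \<in> sets (M i)" if "i \<in> I" for i using that by simp
    have "emeasure (density (PiM I M) (\<lambda>x. \<Prod>i\<in>I. f i (x i))) (Pi\<^sub>E I A) =
       (\<integral>\<^sup>+ x. (\<Prod>i\<in>I. f i (x i)) * indicator (Pi\<^sub>E I A) x \<partial>PiM I M)"
      using assms(1) by (subst emeasure_density) (auto intro!: sets_PiM_I_finite)
    also have "\<dots> = (\<integral>\<^sup>+ x. (\<Prod>i\<in>I. f i (x i) * indicator (A i) (x i)) \<partial>PiM I M)"
    proof (rule nn_integral_cong)
      fix x assume "x \<in> space (PiM I M)"
      hence "x \<in> extensional I" by (auto simp: space_PiM PiE_def)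
      thus "(\<Prod>i\<in>I. f i (x i)) * indicator (Pi\<^sub>E I A) x = (\<Prod>i\<in>I. f i (x i) * indicator (A i) (x i))"
        using assms(1)
        by (cases "x \<in> Pi\<^sub>E I A") (auto simp: prod.distrib PiE_iff indicator_def prod_zero_iff)
    qed
    also have "\<dots> = (\<Prod>i\<in>I. \<integral>\<^sup>+ x. f i x * indicator (A i) x \<partial>M i)"
      by (rule M.product_nn_integral_prod) (use assms(1) in auto)
    also have "\<dots> = (\<Prod>i\<in>I. emeasure (density (M i) (f i)) (A i))"
      by (intro prod.cong) (auto simp: emeasure_density)
    finally show "emeasure (density (PiM I M) (\<lambda>x. \<Prod>i\<in>I. f i (x i))) (Pi\<^sub>E I A) =
       (\<Prod>i\<in>I. emeasure (density (M i) (f i)) (A i))" .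
  qed fact
qed

text \<open>The sets \<open>A i\<close> are not rectangles. Fixing \<open>x\<close> turns a box of
  such sets into a box of sections, after which Fubini can be applied coordinate by
  coordinate.\<close>

lemma distr_pair_PiM:
  assumes "finite I" "product_sigma_finite M" "product_sigma_finite N"
  shows "distr (PiM I M \<Otimes>\<^sub>M PiM I N) (PiM I (\<lambda>i. M i \<Otimes>\<^sub>M N i)) (\<lambda>(x, y). \<lambda>i\<in>I. (x i, y i)) =
    PiM I (\<lambda>i. M i \<Otimes>\<^sub>M N i)"
proof -
  interpret M: product_sigma_finite M by fact
  interpret N: product_sigma_finite N by fact
  interpret PM: finite_product_sigma_finite M I by standard fact
  interpret PN: finite_product_sigma_finite N I by standard fact
  interpret MN: product_sigma_finite "\<lambda>i. M i \<Otimes>\<^sub>M N i"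
    by (intro product_sigma_finite.intro sigma_finite_pair_measure M.sigma_finite_measures
        N.sigma_finite_measures)
  have pn: "pair_sigma_finite (M i) (N i)" for i
    by (simp add: pair_sigma_finite_def M.sigma_finite_measures N.sigma_finite_measures)
  show ?thesis
  proof (rule MN.PiM_eqI)
    fix A assume A [measurable]: "\<And>i. i \<in> I \<Longrightarrow> A i \<in> sets (M i \<Otimes>\<^sub>M N i)"
    have [measurable]: "(\<lambda>(x, y). \<lambda>i\<in>I. (x i, y i)) \<in> PiM I M \<Otimes>\<^sub>M PiM I N \<rightarrow>\<^sub>M PiM I (\<lambda>i. M i \<Otimes>\<^sub>M N i)"
      by measurable
    have [measurable]: "Pi\<^sub>E I A \<in> sets (PiM I (\<lambda>i. M i \<Otimes>\<^sub>M N i))"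
      using assms(1) by (auto intro!: sets_PiM_I_finite)
    have "emeasure (distr (PiM I M \<Otimes>\<^sub>M PiM I N) (PiM I (\<lambda>i. M i \<Otimes>\<^sub>M N i))
         (\<lambda>(x, y). \<lambda>i\<in>I. (x i, y i))) (Pi\<^sub>E I A) =
       (\<integral>\<^sup>+ z. indicator (Pi\<^sub>E I A) ((\<lambda>(x, y). \<lambda>i\<in>I. (x i, y i)) z) \<partial>(PiM I M \<Otimes>\<^sub>M PiM I N))"
      by (simp add: nn_integral_distr flip: nn_integral_indicator)
    also have "\<dots> = (\<integral>\<^sup>+ x. \<integral>\<^sup>+ y. indicator (Pi\<^sub>E I A) (\<lambda>i\<in>I. (x i, y i)) \<partial>PiM I N \<partial>PiM I M)"
      by (subst PN.nn_integral_fst[symmetric]) auto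
    also have "\<dots> = (\<integral>\<^sup>+ x. \<integral>\<^sup>+ y. (\<Prod>i\<in>I. indicator (A i) (x i, y i)) \<partial>PiM I N \<partial>PiM I M)"
      using assms(1)
      by (intro nn_integral_cong) (auto simp: indicator_def PiE_iff prod_zero_iff)
    also have "\<dots> = (\<integral>\<^sup>+ x. (\<Prod>i\<in>I. \<integral>\<^sup>+ y. indicator (A i) (x i, y) \<partial>N i) \<partial>PiM I M)"
    proof (rule nn_integral_cong)
      fix x assume x: "x \<in> space (PiM I M)"
      show "(\<integral>\<^sup>+ y. (\<Prod>i\<in>I. indicator (A i) (x i, y i)) \<partial>PiM I N) =
        (\<Prod>i\<in>I. \<integral>\<^sup>+ y. indicator (A i) (x i, y) \<partial>N i)"
      proof (rule N.product_nn_integral_prod)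
        fix i assume [simp]: "i \<in> I"
        have "x i \<in> space (M i)" using x by (auto simp: space_PiM)
        thus "(\<lambda>y. indicator (A i) (x i, y)) \<in> borel_measurable (N i)" by measurable
      qed fact
    qed
    also have "\<dots> = (\<Prod>i\<in>I. \<integral>\<^sup>+ x. \<integral>\<^sup>+ y. indicator (A i) (x, y) \<partial>N i \<partial>M i)"
    proof (rule M.product_nn_integral_prod)
      fix i assume [simp]: "i \<in> I"
      interpret pair_sigma_finite "M i" "N i" by (rule pn)
      show "(\<lambda>x. \<integral>\<^sup>+ y. indicator (A i) (x, y) \<partial>N i) \<in> borel_measurable (M i)" by measurable
    qed fact
    also have "\<dots> = (\<Prod>i\<in>I. emeasure (M i \<Otimes>\<^sub>M N i) (A i))"
    proof (rule prod.cong)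
      fix i assume [simp]: "i \<in> I"
      interpret pair_sigma_finite "M i" "N i" by (rule pn)
      show "(\<integral>\<^sup>+ x. \<integral>\<^sup>+ y. indicator (A i) (x, y) \<partial>N i \<partial>M i) = emeasure (M i \<Otimes>\<^sub>M N i) (A i)"
        by (subst sigma_finite_measure.nn_integral_fst[OF N.sigma_finite_measures]) auto
    qed simp
    finally show "emeasure (distr (PiM I M \<Otimes>\<^sub>M PiM I N) (PiM I (\<lambda>i. M i \<Otimes>\<^sub>M N i))
         (\<lambda>(x, y). \<lambda>i\<in>I. (x i, y i))) (Pi\<^sub>E I A) = (\<Prod>i\<in>I. emeasure (M i \<Otimes>\<^sub>M N i) (A i))" .
  qed (use assms in auto)
qed

text \<open>The product of the Radon-Nikodym derivatives is a density between the finite products.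
  It carries the Taylor bound, known only Lebesgue-almost everywhere, to the law of all the
  moves.\<close>

lemma AE_PiM_absolutely_continuous:
  assumes "finite I" "sigma_finite_measure M" "sigma_finite_measure N"
    and "absolutely_continuous M N" "sets N = sets M"
    and "AE x in PiM I (\<lambda>_. M). Q x"
  shows "AE x in PiM I (\<lambda>_. N). Q x"
proof -
  interpret M: sigma_finite_measure M by fact
  have N: "density M (RN_deriv M N) = N"
    using assms by (intro M.density_RN_deriv) auto
  have "PiM I (\<lambda>_. N) = density (PiM I (\<lambda>_. M)) (\<lambda>x. \<Prod>i\<in>I. RN_deriv M N (x i))"
    by (subst PiM_density) (use assms N in \<open>auto simp: product_sigma_finite_def\<close>)
  moreover have "(\<lambda>x. \<Prod>i\<in>I. RN_deriv M N (x i)) \<in> borel_measurable (PiM I (\<lambda>_. M))"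
    by measurable
  ultimately show ?thesis
    using assms(6) by (elim ssubst[of "PiM I (\<lambda>_. N)"], subst AE_density) auto
qed

subsection \<open>Gaussian product measures\<close>

lemma abs_le_exp_add_exp: "\<bar>x\<bar> \<le> exp x + exp (- x)" for x :: real
  using exp_ge_add_one_self[of x] exp_ge_add_one_self[of "- x"] exp_gt_zero[of x] exp_gt_zero[of "-x"]
  by linarith

text \<open>The inner product of families of vectors. For Gaussian \<open>w\<close> it is a centred
  Gaussian variable with variance \<open>pairing I t t\<close>, and the gradient pseudo-metric is
  the distance belonging to it.\<close>

definition pairing :: "'i set \<Rightarrow> ('i \<Rightarrow> real ^ 'd) \<Rightarrow> ('i \<Rightarrow> real ^ 'd) \<Rightarrow> real" where
  "pairing I t w = (\<Sum>i\<in>I. t i \<bullet> w i)"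

lemma product_sigma_finite_const: "sigma_finite_measure M \<Longrightarrow> product_sigma_finite (\<lambda>_. M)"
  by (simp add: product_sigma_finite_def)

lemma sigma_finite_std_gaussian: "sigma_finite_measure (std_gaussian :: (real ^ 'd) measure)"
  by (rule prob_space_imp_sigma_finite[OF prob_space_std_gaussian])

context
  fixes I :: "'i set" and \<G> :: "('i \<Rightarrow> real ^ 'd) measure"
  assumes finite_I: "finite I"
  defines "\<G> \<equiv> PiM I (\<lambda>_. std_gaussian)"
begin

lemma prob_space_gauss_product: "prob_space \<G>"
  unfolding \<G>_def by (intro prob_space_PiM prob_space_std_gaussian)

lemma measurable_pairing [measurable]: "pairing I t \<in> borel_measurable \<G>"
  unfolding pairing_def[abs_def] \<G>_def by measurable

text \<open>On boxes the shifted law is the product of the shifted coordinates, each of which is an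
  exponential tilt; the likelihoods multiply to the exponential of a \<open>pairing\<close>.\<close>

lemma distr_gauss_product_shift:
  "distr \<G> \<G> (\<lambda>w. \<lambda>i\<in>I. w i + t i) =
    density \<G> (\<lambda>w. ennreal (exp (pairing I t w - pairing I t t / 2)))"
proof -
  let ?N = "\<lambda>u. distr std_gaussian std_gaussian (\<lambda>w :: real ^ 'd. w + u)"
  have m [measurable]: "(\<lambda>w :: real ^ 'd. w + u) \<in> std_gaussian \<rightarrow>\<^sub>M std_gaussian" for u
    by (subst measurable_cong_sets[OF sets_std_gaussian sets_std_gaussian]) measurable
  have N: "?N u = density std_gaussian (\<lambda>w. ennreal (exp (u \<bullet> w - (u \<bullet> u) / 2)))" for u
  proof (rule measure_eqI)
    fix A assume "A \<in> sets (?N u)"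
    hence [measurable]: "A \<in> sets borel" by simp
    have "emeasure (?N u) A = (\<integral>\<^sup>+ w. indicator A (w + u) \<partial>std_gaussian)"
      by (simp add: nn_integral_distr flip: nn_integral_indicator)
    thus "emeasure (?N u) A = emeasure (density std_gaussian (\<lambda>w. ennreal (exp (u \<bullet> w - (u \<bullet> u) / 2)))) A"
      by (simp add: emeasure_density nn_integral_std_gaussian_shift)
  qed simp
  have psN: "prob_space (?N u)" for u
    by (rule prob_space.prob_space_distr[OF prob_space_std_gaussian]) measurable
  interpret G: product_sigma_finite "\<lambda>_. std_gaussian :: (real ^ 'd) measure"
    by (rule product_sigma_finite_const[OF sigma_finite_std_gaussian])
  interpret N: product_sigma_finite "\<lambda>i. ?N (t i)"
    using psN by (simp add: product_sigma_finite_def prob_space_imp_sigma_finite)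
  have "distr \<G> \<G> (\<lambda>w. \<lambda>i\<in>I. w i + t i) = PiM I (\<lambda>i. ?N (t i))"
  proof (rule N.PiM_eqI)
    show "sets (distr \<G> \<G> (\<lambda>w. \<lambda>i\<in>I. w i + t i)) = sets (PiM I (\<lambda>i. ?N (t i)))"
      unfolding \<G>_def by (simp cong: sets_PiM_cong)
    fix A assume "\<And>i. i \<in> I \<Longrightarrow> A i \<in> sets (?N (t i))"
    hence A [measurable]: "A i \<in> sets borel" if "i \<in> I" for i using that by simp
    have [measurable]: "(\<lambda>w. \<lambda>i\<in>I. w i + t i) \<in> \<G> \<rightarrow>\<^sub>M \<G>"
      unfolding \<G>_def by measurable
    have "emeasure (distr \<G> \<G> (\<lambda>w. \<lambda>i\<in>I. w i + t i)) (Pi\<^sub>E I A) =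
        emeasure \<G> ((\<lambda>w. \<lambda>i\<in>I. w i + t i) -` Pi\<^sub>E I A \<inter> space \<G>)"
      by (rule emeasure_distr) (use finite_I in \<open>auto simp: \<G>_def intro!: sets_PiM_I_finite\<close>)
    also have "(\<lambda>w. \<lambda>i\<in>I. w i + t i) -` Pi\<^sub>E I A \<inter> space \<G> = (\<Pi>\<^sub>E i\<in>I. (\<lambda>w. w + t i) -` A i)"
      by (auto simp: \<G>_def space_PiM PiE_iff)
    also have "emeasure \<G> \<dots> = (\<Prod>i\<in>I. emeasure std_gaussian ((\<lambda>w. w + t i) -` A i))"
    proof -
      have "(\<lambda>w. w + t i) -` A i \<in> sets borel" if "i \<in> I" for i
        using measurable_sets[OF m, of "A i" "t i"] A[OF that] by simp
      thus ?thesis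
        unfolding \<G>_def using finite_I by (subst G.emeasure_PiM) auto
    qed
    also have "\<dots> = (\<Prod>i\<in>I. emeasure (?N (t i)) (A i))"
      by (intro prod.cong refl) (simp add: emeasure_distr)
    finally show "emeasure (distr \<G> \<G> (\<lambda>w. \<lambda>i\<in>I. w i + t i)) (Pi\<^sub>E I A) = \<dots>" .
  qed (fact finite_I)
  also have "\<dots> = density \<G> (\<lambda>w. \<Prod>i\<in>I. ennreal (exp (t i \<bullet> w i - (t i \<bullet> t i) / 2)))"
    unfolding \<G>_def N
    by (subst PiM_density)
      (use finite_I G.product_sigma_finite_axioms N.product_sigma_finite_axioms in \<open>simp_all add: N\<close>)
  also have "(\<lambda>w. \<Prod>i\<in>I. ennreal (exp (t i \<bullet> w i - (t i \<bullet> t i) / 2))) =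
      (\<lambda>w. ennreal (exp (pairing I t w - pairing I t t / 2)))"
    using finite_I
    by (simp add: prod_ennreal exp_sum[symmetric] pairing_def sum_subtractf sum_divide_distrib)
  finally show ?thesis .
qed

lemma
  fixes F :: "('i \<Rightarrow> real ^ 'd) \<Rightarrow> real"
  assumes [measurable]: "F \<in> borel_measurable \<G>" and F: "integrable \<G> (\<lambda>w. F (\<lambda>i\<in>I. w i + t i))"
  shows integrable_gauss_product_shift:
      "integrable \<G> (\<lambda>w. exp (pairing I t w - pairing I t t / 2) * F w)"
    and integral_gauss_product_shift:
      "(\<integral>w. exp (pairing I t w - pairing I t t / 2) * F w \<partial>\<G>) =
        (\<integral>w. F (\<lambda>i\<in>I. w i + t i) \<partial>\<G>)"
proof -
  have [measurable]: "(\<lambda>w. \<lambda>i\<in>I. w i + t i) \<in> \<G> \<rightarrow>\<^sub>M \<G>"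
    unfolding \<G>_def by measurable
  have "integrable (distr \<G> \<G> (\<lambda>w. \<lambda>i\<in>I. w i + t i)) F"
    using F by (subst integrable_distr_eq) auto
  thus "integrable \<G> (\<lambda>w. exp (pairing I t w - pairing I t t / 2) * F w)"
    unfolding distr_gauss_product_shift by (subst (asm) integrable_density) auto
  have "(\<integral>w. F (\<lambda>i\<in>I. w i + t i) \<partial>\<G>) = integral\<^sup>L (distr \<G> \<G> (\<lambda>w. \<lambda>i\<in>I. w i + t i)) F"
    by (subst integral_distr) auto
  also have "\<dots> = (\<integral>w. exp (pairing I t w - pairing I t t / 2) * F w \<partial>\<G>)"
    unfolding distr_gauss_product_shift by (subst integral_density) auto
  finally show "(\<integral>w. exp (pairing I t w - pairing I t t / 2) * F w \<partial>\<G>) =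
        (\<integral>w. F (\<lambda>i\<in>I. w i + t i) \<partial>\<G>)" ..
qed

lemma integrable_exp_pairing: "integrable \<G> (\<lambda>w. exp (pairing I t w))"
  and integral_exp_pairing:
    "(\<integral>w. exp (pairing I t w - pairing I t t / 2) \<partial>\<G>) = 1"
proof -
  interpret prob_space \<G> by (rule prob_space_gauss_product)
  show "(\<integral>w. exp (pairing I t w - pairing I t t / 2) \<partial>\<G>) = 1"
    using integral_gauss_product_shift[of "\<lambda>_. 1" t] by (simp add: prob_space)
  have "integrable \<G> (\<lambda>w. exp (pairing I t t / 2) *
      (exp (pairing I t w - pairing I t t / 2) * 1))"
    by (intro integrable_mult_right integrable_gauss_product_shift) auto
  thus "integrable \<G> (\<lambda>w. exp (pairing I t w))"
    by (simp add: exp_add[symmetric] algebra_simps)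
qed

lemma pairing_uminus: "pairing I (\<lambda>i. - t i) w = - pairing I t w"
  by (simp add: pairing_def sum_negf)

lemma integrable_pairing [simp]: "integrable \<G> (pairing I t)"
proof (rule Bochner_Integration.integrable_bound)
  show "integrable \<G> (\<lambda>w. exp (pairing I t w) + exp (pairing I (\<lambda>i. - t i) w))"
    by (intro Bochner_Integration.integrable_add integrable_exp_pairing)
  show "AE w in \<G>. norm (pairing I t w) \<le>
      norm (exp (pairing I t w) + exp (pairing I (\<lambda>i. - t i) w))"
    unfolding pairing_uminus using abs_le_exp_add_exp by (intro AE_I2) (simp add: abs_of_pos add_pos_pos)
qed simp

lemma integral_pairing [simp]: "(\<integral>w. pairing I t w \<partial>\<G>) = 0"
proof -
  define m where "m = (\<lambda>u :: real ^ 'd. \<integral>w. u \<bullet> w \<partial>std_gaussian)"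
  \<comment> \<open>Invariance under negation makes the mean of every linear functional equal to its
    own negative.\<close>
  have "distr std_gaussian std_gaussian uminus = (std_gaussian :: (real ^ 'd) measure)"
  proof (rule measure_eqI)
    fix A :: "(real ^ 'd) set" assume "A \<in> sets (distr std_gaussian std_gaussian uminus)"
    hence [measurable]: "A \<in> sets borel" by simp
    show "emeasure (distr std_gaussian std_gaussian uminus) A = emeasure std_gaussian A"
      using nn_integral_std_gaussian_uminus[of "indicator A"]
      by (simp add: emeasure_density nn_integral_distr flip: nn_integral_indicator)
  qed simp
  hence "m u = (\<integral>w. u \<bullet> w \<partial>distr std_gaussian std_gaussian uminus)" for u
    by (simp add: m_def)
  hence "m u = (\<integral>w. u \<bullet> (- w) \<partial>std_gaussian)" for u
    by (subst (asm) integral_distr) auto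
  hence m: "m u = 0" for u by (simp add: m_def)
  have c: "distr \<G> std_gaussian (\<lambda>w. w i) = std_gaussian" if "i \<in> I" for i
    unfolding \<G>_def using that by (intro distr_PiM_component prob_space_std_gaussian) auto
  have i: "integrable \<G> (\<lambda>w. t i \<bullet> w i)" if "i \<in> I" for i
  proof -
    \<comment> \<open>A single coordinate is the pairing with a family supported at
      \<open>i\<close>, whose integrability is already known.\<close>
    have "pairing I (\<lambda>j. if j = i then t i else 0) = (\<lambda>w. t i \<bullet> w i)"
      using that finite_I by (simp add: pairing_def[abs_def] if_distrib[where f = "\<lambda>u. u \<bullet> _"] cong: if_cong)
    thus ?thesis using integrable_pairing[of "\<lambda>j. if j = i then t i else 0"] by simp
  qed
  have "(\<integral>w. pairing I t w \<partial>\<G>) = (\<Sum>i\<in>I. \<integral>w. t i \<bullet> w i \<partial>\<G>)"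
    unfolding pairing_def by (intro Bochner_Integration.integral_sum i)
  also have "\<dots> = (\<Sum>i\<in>I. m (t i))"
  proof (rule sum.cong)
    fix i assume "i \<in> I"
    have [measurable]: "(\<lambda>w. w i) \<in> \<G> \<rightarrow>\<^sub>M std_gaussian"
      unfolding \<G>_def using \<open>i \<in> I\<close> by measurable
    have "m (t i) = (\<integral>w. t i \<bullet> w \<partial>distr \<G> std_gaussian (\<lambda>w. w i))"
      using c[OF \<open>i \<in> I\<close>] by (simp add: m_def)
    thus "(\<integral>w. t i \<bullet> w i \<partial>\<G>) = m (t i)"
      by (subst (asm) integral_distr) auto
  qed simp
  finally show ?thesis by (simp add: m)
qed

end

section \<open>A dimension-free weak form of Sudakov's minoration\<close>

lemma pairing_commute: "pairing I s t = pairing I t s"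
  by (simp add: pairing_def inner_commute)

lemma pairing_add: "pairing I (\<lambda>i. s i + t i) w = pairing I s w + pairing I t w"
  by (simp add: pairing_def inner_add_left sum.distrib)

lemma pairing_diff: "pairing I (\<lambda>i. s i - t i) w = pairing I s w - pairing I t w"
  by (simp add: pairing_def inner_diff_left sum_subtractf)

lemma pairing_scale: "pairing I (\<lambda>i. c *\<^sub>R t i) w = c * pairing I t w"
  by (simp add: pairing_def sum_distrib_left)

lemma pairing_sum: "pairing I (\<lambda>i. \<Sum>s\<in>A. h s i) w = (\<Sum>s\<in>A. pairing I (h s) w)"
  unfolding pairing_def inner_sum_left by (rule sum.swap)

lemma pairing_restrict [simp]: "pairing I t (\<lambda>i\<in>I. w i) = pairing I t w"
  by (simp add: pairing_def)

lemma pairing_self_nonneg: "0 \<le> pairing I t t"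
  unfolding pairing_def by (intro sum_nonneg) auto

text \<open>The parallelogram law around \<open>m\<close>: two points close to \<open>m\<close> are
  close to each other, so separated points cannot both be near the posterior mean.\<close>

lemma pairing_diff_self_le:
  "pairing I (\<lambda>i. s i - t i) (\<lambda>i. s i - t i) \<le>
    2 * pairing I (\<lambda>i. s i - m i) (\<lambda>i. s i - m i) +
    2 * pairing I (\<lambda>i. t i - m i) (\<lambda>i. t i - m i)"
proof -
  have "(x - y) \<bullet> (x - y) \<le> 2 * ((x - z) \<bullet> (x - z)) + 2 * ((y - z) \<bullet> (y - z))" for x y z :: "real ^ 'd"
  proof -
    have "(u - v) \<bullet> (u - v) \<le> 2 * (u \<bullet> u) + 2 * (v \<bullet> v)" for u v :: "real ^ 'd"
      using inner_ge_zero[of "u + v"] by (simp add: inner_simps inner_commute)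
    from this[of "x - z" "y - z"] show ?thesis by simp
  qed
  thus ?thesis
    unfolding pairing_def sum_distrib_left sum.distrib[symmetric] by (intro sum_mono)
qed

text \<open>
  The weights \<open>p\<close> are the likelihoods of the points \<open>\<lambda> h s\<close> given an observation \<open>w\<close>, and \<open>m\<close> is
  \<open>1 / \<lambda>\<close> times the posterior mean. At most one point is within distance \<open>a / 2\<close> of \<open>m\<close>, so the
  posterior variance is large unless a single likelihood dominates.
\<close>

lemma posterior_variance_ge:
  fixes h :: "'a \<Rightarrow> 'i \<Rightarrow> real ^ 'd" and p g :: "'a \<Rightarrow> real"
  assumes "finite A" "A \<noteq> {}" and p: "\<And>s. s \<in> A \<Longrightarrow> 0 < p s"
    and "0 < l" "0 < \<alpha>"
    and sep: "\<And>s t. s \<in> A \<Longrightarrow> t \<in> A \<Longrightarrow> s \<noteq> t \<Longrightarrow>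
      a\<^sup>2 \<le> pairing I (\<lambda>i. h s i - h t i) (\<lambda>i. h s i - h t i)"
    and g: "\<And>s t. s \<in> A \<Longrightarrow> t \<in> A \<Longrightarrow> pairing I (h s) w - l * pairing I (h s) (h t) \<le> g t"
  shows "l * (a\<^sup>2 / 4) * ((\<Sum>s\<in>A. p s) - \<alpha> / 2 - (\<Sum>s\<in>A. (p s)\<^sup>2) / (2 * \<alpha>)) \<le>
    (\<Sum>t\<in>A. p t * g t - p t * (pairing I (h t) w - l * pairing I (h t) (h t)))"
proof -
  define Z where "Z = (\<Sum>s\<in>A. p s)"
  have Z: "0 < Z" unfolding Z_def using assms by (intro sum_pos) auto
  define m where "m = (\<lambda>i. \<Sum>s\<in>A. (p s / Z) *\<^sub>R h s i)"
  define d where "d = (\<lambda>t. pairing I (\<lambda>i. h t i - m i) (\<lambda>i. h t i - m i))"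
  have m: "pairing I m v = (\<Sum>s\<in>A. p s / Z * pairing I (h s) v)" for v
    unfolding m_def pairing_sum pairing_scale ..
  have Zm: "Z * pairing I m v = (\<Sum>s\<in>A. p s * pairing I (h s) v)" for v
    unfolding m sum_distrib_left using Z by (intro sum.cong) auto
  \<comment> \<open>The hypothesis on \<open>g\<close> is affine in \<open>h s\<close>, so averaging
    it over \<open>s\<close> with the posterior weights puts the mean \<open>m\<close> in place of
    \<open>h s\<close>.\<close>
  have gm: "pairing I m w - l * pairing I m (h t) \<le> g t" if "t \<in> A" for t
  proof -
    have "pairing I m w - l * pairing I m (h t) =
       (\<Sum>s\<in>A. p s / Z * (pairing I (h s) w - l * pairing I (h s) (h t)))"
      unfolding m by (simp add: algebra_simps sum_subtractf sum_distrib_left)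
    also have "\<dots> \<le> (\<Sum>s\<in>A. p s / Z * g t)"
      using p Z that g by (intro sum_mono mult_left_mono) (auto intro: less_imp_le)
    also have "\<dots> = g t"
      using Z by (simp add: sum_distrib_right[symmetric] sum_divide_distrib[symmetric] Z_def[symmetric])
    finally show ?thesis .
  qed
  have mh: "pairing I m (h t) = pairing I (h t) m" for t
    by (rule pairing_commute)
  have d_eq: "d t = pairing I (h t) (h t) - 2 * pairing I m (h t) + pairing I m m" for t
    unfolding d_def pairing_diff pairing_commute[of I _ "\<lambda>i. h t i - m i"]
    using pairing_commute[of I "h t" m] by simp
  have "(\<Sum>t\<in>A. p t * d t) =
     (\<Sum>t\<in>A. p t * pairing I (h t) (h t)) - 2 * (\<Sum>t\<in>A. p t * pairing I (h t) m)
       + (\<Sum>t\<in>A. p t) * pairing I m m"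
    unfolding d_eq
    by (simp add: algebra_simps sum_subtractf sum.distrib sum_distrib_left sum_distrib_right mh)
  also have "\<dots> = (\<Sum>t\<in>A. p t * pairing I (h t) (h t)) - Z * pairing I m m"
    by (simp add: Zm[symmetric] Z_def[symmetric])
  finally have pd: "(\<Sum>t\<in>A. p t * d t) = (\<Sum>t\<in>A. p t * pairing I (h t) (h t)) - Z * pairing I m m" .

  \<comment> \<open>The terms in \<open>w\<close> cancel because \<open>m\<close> is the weighted
    mean. What remains of the advantage of \<open>m\<close> over \<open>h t\<close>, summed over
    \<open>t\<close>, is \<open>l\<close> times the posterior variance.\<close>
  have "l * (\<Sum>t\<in>A. p t * d t) =
     (\<Sum>t\<in>A. p t * (pairing I m w - l * pairing I m (h t)) -
        p t * (pairing I (h t) w - l * pairing I (h t) (h t)))"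
  proof -
    have "(\<Sum>t\<in>A. p t * (pairing I m w - l * pairing I m (h t)) -
        p t * (pairing I (h t) w - l * pairing I (h t) (h t))) =
      (\<Sum>t\<in>A. p t) * pairing I m w - l * (\<Sum>t\<in>A. p t * pairing I (h t) m)
      - (\<Sum>t\<in>A. p t * pairing I (h t) w) + l * (\<Sum>t\<in>A. p t * pairing I (h t) (h t))"
      by (simp add: algebra_simps sum_subtractf sum.distrib sum_distrib_left sum_distrib_right mh)
    thus ?thesis
      unfolding pd by (simp add: Zm[symmetric] Z_def[symmetric] algebra_simps)
  qed
  also have "\<dots> \<le> (\<Sum>t\<in>A. p t * g t - p t * (pairing I (h t) w - l * pairing I (h t) (h t)))"
    by (intro sum_mono diff_mono mult_left_mono[OF gm]) (auto intro: less_imp_le p)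
  finally have main: "l * (\<Sum>t\<in>A. p t * d t) \<le> \<dots>" .

  define T where "T = {t \<in> A. d t < a\<^sup>2 / 4}"
  have "finite T" "T \<subseteq> A" using assms by (auto simp: T_def)
  have "s = t" if "s \<in> T" "t \<in> T" for s t
  proof (rule ccontr)
    assume "s \<noteq> t"
    hence "a\<^sup>2 \<le> 2 * d s + 2 * d t"
      using sep[of s t] pairing_diff_self_le[of I "h s" "h t" m] that
      by (auto simp: T_def d_def)
    thus False using that by (auto simp: T_def)
  qed
  hence cardT: "card T \<le> 1"
    using \<open>finite T\<close> by (simp add: card_le_Suc0_iff_eq)
  \<comment> \<open>The index of the point near \<open>m\<close> depends on \<open>w\<close>. The
    inequality between means replaces its likelihood by a square, and the sum of all squares has a
    computable Gaussian mean; \<open>\<alpha>\<close> is tuned later.\<close>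
  have "(\<Sum>t\<in>T. p t) \<le> (\<Sum>t\<in>T. \<alpha> / 2 + (p t)\<^sup>2 / (2 * \<alpha>))"
  proof (rule sum_mono)
    fix t
    have "0 \<le> (\<alpha> - p t)\<^sup>2 / (2 * \<alpha>)" using \<open>0 < \<alpha>\<close> by simp
    also have "\<dots> = \<alpha> / 2 + (p t)\<^sup>2 / (2 * \<alpha>) - p t"
      using \<open>0 < \<alpha>\<close> by (simp add: power2_eq_square field_simps)
    finally show "p t \<le> \<alpha> / 2 + (p t)\<^sup>2 / (2 * \<alpha>)" by simp
  qed
  also have "\<dots> = real (card T) * (\<alpha> / 2) + (\<Sum>t\<in>T. (p t)\<^sup>2) / (2 * \<alpha>)"
    by (simp add: sum.distrib sum_divide_distrib)
  also have "\<dots> \<le> 1 * (\<alpha> / 2) + (\<Sum>t\<in>A. (p t)\<^sup>2) / (2 * \<alpha>)"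
    using cardT \<open>0 < \<alpha>\<close> assms(1) \<open>T \<subseteq> A\<close>
    by (intro add_mono mult_right_mono divide_right_mono sum_mono2) auto
  finally have T: "(\<Sum>t\<in>T. p t) \<le> \<alpha> / 2 + (\<Sum>t\<in>A. (p t)\<^sup>2) / (2 * \<alpha>)" by simp

  have "(a\<^sup>2 / 4) * ((\<Sum>s\<in>A. p s) - \<alpha> / 2 - (\<Sum>s\<in>A. (p s)\<^sup>2) / (2 * \<alpha>)) \<le>
      (a\<^sup>2 / 4) * ((\<Sum>s\<in>A. p s) - (\<Sum>s\<in>T. p s))"
    using T by (intro mult_left_mono) auto
  also have "(\<Sum>s\<in>A. p s) - (\<Sum>s\<in>T. p s) = (\<Sum>s\<in>A - T. p s)"
    using \<open>T \<subseteq> A\<close> assms(1) by (simp add: sum_diff)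
  also have "(a\<^sup>2 / 4) * \<dots> = (\<Sum>s\<in>A - T. p s * (a\<^sup>2 / 4))"
    by (subst sum_distrib_right[symmetric]) (rule mult.commute)
  also have "\<dots> \<le> (\<Sum>s\<in>A - T. p s * d s)"
    using p by (intro sum_mono mult_left_mono) (auto simp: T_def intro: less_imp_le)
  also have "\<dots> \<le> (\<Sum>s\<in>A. p s * d s)"
    using assms(1) p
    by (intro sum_mono2 mult_nonneg_nonneg)
      (auto simp: d_def pairing_self_nonneg intro: less_imp_le)
  finally have "l * ((a\<^sup>2 / 4) * ((\<Sum>s\<in>A. p s) - \<alpha> / 2 - (\<Sum>s\<in>A. (p s)\<^sup>2) / (2 * \<alpha>))) \<le>
      l * (\<Sum>s\<in>A. p s * d s)"
    using \<open>0 < l\<close> by (intro mult_left_mono) auto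
  with main show ?thesis by (simp add: mult.assoc)
qed

abbreviation gauss_product :: "'i set \<Rightarrow> ('i \<Rightarrow> real ^ 'd) measure" where
  "gauss_product I \<equiv> PiM I (\<lambda>_. std_gaussian)"

context
  fixes I :: "'i set"
  assumes finite_I: "finite I"
begin

lemma measurable_gauss_product_diff [measurable]: "(\<lambda>w. \<lambda>i\<in>I. w i - t i) \<in> gauss_product I \<rightarrow>\<^sub>M gauss_product I"
  by measurable

text \<open>Under the tilted law with density \<open>p t\<close>, the observation \<open>w\<close>
  is the signal \<open>l *\<^sub>R h t\<close> plus Gaussian noise. Integrating
  \<open>posterior_variance_ge\<close> over the untilted law, every \<open>t\<close> contributes one
  mean of \<open>g\<close>, the centred terms vanish, the likelihoods have mean 1, and their second
  moments are at most \<open>exp (l\<^sup>2 * r)\<close>.\<close>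

lemma gauss_product_max_ge:
  fixes h :: "'a \<Rightarrow> 'i \<Rightarrow> real ^ 'd" and g :: "('i \<Rightarrow> real ^ 'd) \<Rightarrow> real"
  assumes A: "finite A" "A \<noteq> {}" and l: "0 < l" and \<alpha>: "0 < \<alpha>"
    and R: "\<And>s. s \<in> A \<Longrightarrow> pairing I (h s) (h s) \<le> r"
    and sep: "\<And>s t. s \<in> A \<Longrightarrow> t \<in> A \<Longrightarrow> s \<noteq> t \<Longrightarrow>
      a\<^sup>2 \<le> pairing I (\<lambda>i. h s i - h t i) (\<lambda>i. h s i - h t i)"
    and g: "integrable (gauss_product I) g"
    and max: "\<And>s w. s \<in> A \<Longrightarrow> w \<in> space (gauss_product I) \<Longrightarrow> pairing I (h s) w \<le> g w"
  shows "l * (a\<^sup>2 / 4) * (card A - \<alpha> / 2 - card A * exp (l\<^sup>2 * r) / (2 * \<alpha>)) \<le> card A * (\<integral>w. g w \<partial>gauss_product I)"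
proof -
  note [measurable] = measurable_pairing[OF finite_I]
  note int = integrable_gauss_product_shift[OF finite_I]
    integral_gauss_product_shift[OF finite_I]
  have [measurable]: "g \<in> borel_measurable (gauss_product I)" using g by auto
  let ?lh = "\<lambda>s i. l *\<^sub>R h s i"
  define p where "p = (\<lambda>s w. exp (pairing I (?lh s) w - pairing I (?lh s) (?lh s) / 2))"
  have sc: "pairing I (?lh s) w = l * pairing I (h s) w"
    "pairing I w (?lh s) = l * pairing I w (h s)" for s w
    using pairing_scale[of I l "h s" w] by (simp_all add: pairing_commute[of I w])
  define V where "V = (\<lambda>s. pairing I (h s) (h s))"
  \<comment> \<open>Removing the signal evaluates \<open>g\<close> at the noise alone, so the shift
    formula returns the plain mean of \<open>g\<close>.\<close>
  define G where "G = (\<lambda>s w. g (\<lambda>i\<in>I. w i - ?lh s i))"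
  have [measurable]: "G s \<in> borel_measurable (gauss_product I)" for s
    unfolding G_def by measurable
  have Gs: "G s (\<lambda>i\<in>I. w i + ?lh s i) = g w" if "w \<in> space (gauss_product I)" for s w
  proof -
    have "(\<lambda>i\<in>I. (\<lambda>i\<in>I. w i + ?lh s i) i - ?lh s i) = w"
      using that by (auto simp: space_PiM PiE_def extensional_def fun_eq_iff)
    thus ?thesis by (simp add: G_def)
  qed
  have 1: "integrable (gauss_product I) (\<lambda>w. p s w * G s w)" "(\<integral>w. p s w * G s w \<partial>gauss_product I) = (\<integral>w. g w \<partial>gauss_product I)" for s
  proof -
    have i: "integrable (gauss_product I) (\<lambda>w. G s (\<lambda>i\<in>I. w i + ?lh s i))"
      using g by (subst Bochner_Integration.integrable_cong[OF refl Gs]) auto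
    show "integrable (gauss_product I) (\<lambda>w. p s w * G s w)"
      using int(1)[OF _ i] by (simp add: p_def)
    show "(\<integral>w. p s w * G s w \<partial>gauss_product I) = (\<integral>w. g w \<partial>gauss_product I)"
      unfolding p_def
      by (rule trans[OF int(2)[OF _ i] Bochner_Integration.integral_cong[OF refl Gs]]) auto
  qed
  have 2: "integrable (gauss_product I) (\<lambda>w. p s w * (pairing I (h s) w - l * V s))"
    "(\<integral>w. p s w * (pairing I (h s) w - l * V s) \<partial>gauss_product I) = 0" for s
  proof -
    have eq: "pairing I (h s) (\<lambda>i\<in>I. w i + ?lh s i) - l * V s = pairing I (h s) w" for w
      unfolding pairing_restrict pairing_commute[of I "h s" "\<lambda>i. w i + ?lh s i"]
        pairing_add sc V_def using pairing_commute[of I w "h s"] by simp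
    have i: "integrable (gauss_product I) (\<lambda>w. pairing I (h s) (\<lambda>i\<in>I. w i + ?lh s i) - l * V s)"
      unfolding eq by (rule integrable_pairing[OF finite_I])
    show "integrable (gauss_product I) (\<lambda>w. p s w * (pairing I (h s) w - l * V s))"
      using int(1)[OF _ i] by (simp add: p_def)
    show "(\<integral>w. p s w * (pairing I (h s) w - l * V s) \<partial>gauss_product I) = 0"
      unfolding p_def
      by (rule trans[OF int(2)[OF _ i]], simp, unfold eq, rule integral_pairing[OF finite_I])
  qed
  have pint: "integrable (gauss_product I) (\<lambda>w. exp (pairing I t w - c))" for t c
    using integrable_exp_pairing[OF finite_I, of t] by (simp add: exp_diff)
  have 3: "integrable (gauss_product I) (p s)" "(\<integral>w. p s w \<partial>gauss_product I) = 1" for s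
    using pint integral_exp_pairing[OF finite_I] by (simp_all add: p_def)
  have 4: "integrable (gauss_product I) (\<lambda>w. (p s w)\<^sup>2)" "(\<integral>w. (p s w)\<^sup>2 \<partial>gauss_product I) = exp (l\<^sup>2 * V s)" for s
  proof -
    let ?u = "\<lambda>i. (2 * l) *\<^sub>R h s i"
    have su: "pairing I ?u w = 2 * l * pairing I (h s) w"
      "pairing I w ?u = 2 * l * pairing I w (h s)" for w
      using pairing_scale[of I "2 * l" "h s" w] by (simp_all add: pairing_commute[of I w])
    \<comment> \<open>Up to a constant, the square of a likelihood is the likelihood for the doubled
      signal, which has mean 1.\<close>
    have eq: "(p s w)\<^sup>2 = exp (l\<^sup>2 * V s) * exp (pairing I ?u w - pairing I ?u ?u / 2)" for w
      unfolding p_def sc su V_def exp_double[symmetric] exp_add[symmetric]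
      by (simp add: power2_eq_square algebra_simps)
    show "integrable (gauss_product I) (\<lambda>w. (p s w)\<^sup>2)" unfolding eq by (intro integrable_mult_right pint)
    show "(\<integral>w. (p s w)\<^sup>2 \<partial>gauss_product I) = exp (l\<^sup>2 * V s)"
      unfolding eq using integral_exp_pairing[OF finite_I, of ?u] by simp
  qed
  interpret prob_space "gauss_product I :: ('i \<Rightarrow> real ^ 'd) measure"
    by (rule prob_space_gauss_product[OF finite_I])
  have "(\<integral>w. l * (a\<^sup>2 / 4) * ((\<Sum>s\<in>A. p s w) - \<alpha> / 2 - (\<Sum>s\<in>A. (p s w)\<^sup>2) / (2 * \<alpha>)) \<partial>gauss_product I) \<le>
     (\<integral>w. (\<Sum>t\<in>A. p t w * G t w - p t w * (pairing I (h t) w - l * V t)) \<partial>gauss_product I)"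
  proof (rule integral_mono)
    fix w :: "'i \<Rightarrow> real ^ 'd" assume w: "w \<in> space (gauss_product I)"
    show "l * (a\<^sup>2 / 4) * ((\<Sum>s\<in>A. p s w) - \<alpha> / 2 - (\<Sum>s\<in>A. (p s w)\<^sup>2) / (2 * \<alpha>)) \<le>
     (\<Sum>t\<in>A. p t w * G t w - p t w * (pairing I (h t) w - l * V t))"
      unfolding V_def
    proof (rule posterior_variance_ge[OF A _ l \<alpha> sep])
      fix s t assume st: "s \<in> A" "t \<in> A"
      have "pairing I (h s) w - l * pairing I (h s) (h t) =
          pairing I (h s) (\<lambda>i\<in>I. w i - ?lh t i)"
        unfolding pairing_restrict
          pairing_commute[of I "h s" "\<lambda>i. w i - ?lh t i"] pairing_diff sc
        using pairing_commute[of I w "h s"] pairing_commute[of I "h s" "h t"] by simp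
      also have "\<dots> \<le> G t w"
        unfolding G_def using st w by (intro max) (auto simp: space_PiM)
      finally show "pairing I (h s) w - l * pairing I (h s) (h t) \<le> G t w" .
    qed (auto simp: p_def)
  qed (use 1 2 3 4 in \<open>auto intro!: integrable_mult_right Bochner_Integration.integrable_diff
      Bochner_Integration.integrable_sum integrable_divide\<close>)
  also have "(\<integral>w. (\<Sum>t\<in>A. p t w * G t w - p t w * (pairing I (h t) w - l * V t)) \<partial>gauss_product I) =
      card A * (\<integral>w. g w \<partial>gauss_product I)"
    using 1 2 by (subst Bochner_Integration.integral_sum) simp_all
  also have "(\<integral>w. l * (a\<^sup>2 / 4) * ((\<Sum>s\<in>A. p s w) - \<alpha> / 2 - (\<Sum>s\<in>A. (p s w)\<^sup>2) / (2 * \<alpha>)) \<partial>gauss_product I) =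
      l * (a\<^sup>2 / 4) * (card A - \<alpha> / 2 - (\<Sum>s\<in>A. exp (l\<^sup>2 * V s)) / (2 * \<alpha>))"
    using 3 4 by (simp add: prob_space Bochner_Integration.integral_sum)
  finally have "l * (a\<^sup>2 / 4) * (card A - \<alpha> / 2 - (\<Sum>s\<in>A. exp (l\<^sup>2 * V s)) / (2 * \<alpha>)) \<le> card A * (\<integral>w. g w \<partial>gauss_product I)" .
  moreover have "(\<Sum>s\<in>A. exp (l\<^sup>2 * V s)) \<le> (\<Sum>s\<in>A. exp (l\<^sup>2 * r))"
    using R by (intro sum_mono) (auto simp: V_def mult_left_mono)
  hence "(\<Sum>s\<in>A. exp (l\<^sup>2 * V s)) / (2 * \<alpha>) \<le> card A * exp (l\<^sup>2 * r) / (2 * \<alpha>)"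
    using \<alpha> by (intro divide_right_mono) auto
  hence "l * (a\<^sup>2 / 4) * (card A - \<alpha> / 2 - card A * exp (l\<^sup>2 * r) / (2 * \<alpha>)) \<le>
     l * (a\<^sup>2 / 4) * (card A - \<alpha> / 2 - (\<Sum>s\<in>A. exp (l\<^sup>2 * V s)) / (2 * \<alpha>))"
    using l by (intro mult_left_mono) auto
  ultimately show ?thesis by linarith
qed

text \<open>
  The bound is applied to two points at maximal distance \<open>D\<close> and to all points, which gives \<open>D / 64\<close> and
  \<open>L a\<^sup>2 / (8 D)\<close>; for \<open>L = 512 B\<^sup>2\<close> the product of the two is \<open>(B a)\<^sup>2\<close>.
\<close>

lemma gauss_product_max_ge_separation:
  fixes h :: "'a \<Rightarrow> 'i \<Rightarrow> real ^ 'd" and g :: "('i \<Rightarrow> real ^ 'd) \<Rightarrow> real"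
  assumes A: "finite A" and card: "real (card A) \<ge> 4 * exp ((512 * B\<^sup>2)\<^sup>2)" and B: "0 < B" and a: "0 < a"
    and sep: "\<And>s t. s \<in> A \<Longrightarrow> t \<in> A \<Longrightarrow> s \<noteq> t \<Longrightarrow>
      a\<^sup>2 \<le> pairing I (\<lambda>i. h s i - h t i) (\<lambda>i. h s i - h t i)"
    and g: "integrable (gauss_product I) g"
    and max: "\<And>s w. s \<in> A \<Longrightarrow> w \<in> space (gauss_product I) \<Longrightarrow> pairing I (h s) w \<le> g w"
  shows "B * a \<le> (\<integral>w. g w \<partial>gauss_product I)"
proof -
  have card1: "real (card A) \<ge> 4"
    using card by (rule order.trans[rotated]) simp
  then obtain s0 where s0: "s0 \<in> A" by (metis card.empty ex_in_conv not_numeral_le_zero of_nat_0)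
  \<comment> \<open>Subtracting one point leaves all differences unchanged and makes all norms at
    most the radius \<open>D\<close>. The mean of \<open>g\<close> is unaffected, since the
    subtracted pairing has mean 0.\<close>
  define k where "k = (\<lambda>s i. h s i - h s0 i)"
  define g' where "g' = (\<lambda>w. g w - pairing I (h s0) w)"
  have g': "integrable (gauss_product I) g'" "(\<integral>w. g' w \<partial>gauss_product I) = (\<integral>w. g w \<partial>gauss_product I)"
    using g integrable_pairing[OF finite_I, of "h s0"] integral_pairing[OF finite_I, of "h s0"]
    unfolding g'_def by (simp_all only: Bochner_Integration.integrable_diff Bochner_Integration.integral_diff diff_zero)
  have kd: "(\<lambda>i. k s i - k t i) = (\<lambda>i. h s i - h t i)" for s t by (simp add: k_def)
  have max': "pairing I (k s) w \<le> g' w" if "s \<in> A" "w \<in> space (gauss_product I)" for s w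
    using max[OF that] by (simp add: k_def g'_def pairing_diff)
  define N where "N = (\<lambda>s. pairing I (k s) (k s))"
  define D where "D = sqrt (Max (N ` A))"
  have N0: "0 \<le> N s" for s by (simp add: N_def pairing_self_nonneg)
  have "Max (N ` A) \<in> N ` A" using A s0 by (intro Max_in) auto
  then obtain s1 where s1: "s1 \<in> A" "N s1 = Max (N ` A)" by auto
  have DN: "D\<^sup>2 = N s1" using N0[of s1] by (simp add: D_def s1)
  have ND: "N s \<le> D\<^sup>2" if "s \<in> A" for s using that A by (simp add: DN s1(2))
  have "\<not> A \<subseteq> {s0}"
    using card1 card_mono[of "{s0}" A] by auto
  then obtain s2 where s2: "s2 \<in> A" "s2 \<noteq> s0" by blast
  have "0 < a\<^sup>2" using a by simp
  also have "a\<^sup>2 \<le> N s2" using sep[of s2 s0] s0 s2 by (simp add: N_def k_def)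
  also have "\<dots> \<le> D\<^sup>2" using s2 ND by simp
  finally have "0 < D\<^sup>2" .
  hence D: "0 < D" using N0[of s1] by (simp add: D_def DN s1(2)[symmetric])
  have ks0: "k s0 = (\<lambda>_. 0)" by (simp add: k_def fun_eq_iff)
  have s10: "s1 \<noteq> s0" using DN \<open>0 < D\<^sup>2\<close> by (auto simp: N_def ks0 pairing_def)

  have two: "D / 64 \<le> (\<integral>w. g w \<partial>gauss_product I)"
  proof -
    \<comment> \<open>The signal strength \<open>1 / (2 * D)\<close> gives the second moment exp
      (1/4), which is at most 3/2. With \<open>\<alpha> = 3 / 2\<close> the bracket is then at least
      2 - 3/4 - 1 = 1/4.\<close>
    have 1: "1 / (2 * D) * (D\<^sup>2 / 4) * (real (card {s0, s1}) - (3 / 2) / 2 -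
        card {s0, s1} * exp ((1 / (2 * D))\<^sup>2 * D\<^sup>2) / (2 * (3 / 2))) \<le> card {s0, s1} * (\<integral>w. g' w \<partial>gauss_product I)"
    proof (rule gauss_product_max_ge[where h = k])
      fix s t assume st: "s \<in> {s0, s1}" "t \<in> {s0, s1}" "s \<noteq> t"
      have "pairing I (\<lambda>i. k s0 i - k s1 i) (\<lambda>i. k s0 i - k s1 i) =
          pairing I (\<lambda>i. k s1 i - k s0 i) (\<lambda>i. k s1 i - k s0 i)"
        unfolding pairing_def by (intro sum.cong) (simp_all add: inner_simps inner_commute)
      also have "\<dots> = N s1" by (simp add: ks0 N_def)
      finally show "D\<^sup>2 \<le> pairing I (\<lambda>i. k s i - k t i) (\<lambda>i. k s i - k t i)"
        using st DN by (auto simp: ks0 N_def)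
    qed (use D s0 s1 g' max' ND[unfolded N_def] in auto)
    have 2: "exp ((1 / (2 * D))\<^sup>2 * D\<^sup>2) \<le> 3 / 2"
    proof -
      have "(exp (1 / 4) :: real) ^ 4 = exp 1" by (simp add: exp_of_nat_mult[symmetric])
      also have "\<dots> \<le> (3 / 2) ^ 4" using exp_le by (simp add: power_numeral_reduce)
      finally have "exp (1 / 4) \<le> (3 / 2 :: real)" by (subst (asm) power_mono_iff) auto
      thus ?thesis using D by (simp add: power_divide power_mult_distrib)
    qed
    have 3: "1 / (2 * D) * (D\<^sup>2 / 4) * (1 / 4) \<le> 1 / (2 * D) * (D\<^sup>2 / 4) *
        (real 2 - (3 / 2) / 2 - real 2 * e / (2 * (3 / 2)))" if "e \<le> 3 / 2" for e
      using D that by (intro mult_left_mono) auto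
    have 4: "card {s0, s1} = 2" using s10 by simp
    have "1 / (2 * D) * (D\<^sup>2 / 4) * (1 / 4) \<le> real 2 * (\<integral>w. g' w \<partial>gauss_product I)"
      by (rule order.trans[OF 3[OF 2] 1[unfolded 4]])
    thus ?thesis using D by (simp add: g' power2_eq_square)
  qed
  define L where "L = 512 * B\<^sup>2"
  have L: "0 < L" using B by (simp add: L_def)
  have all: "L * a\<^sup>2 / (8 * D) \<le> (\<integral>w. g w \<partial>gauss_product I)"
  proof -
    define M where "M = real (card A)"
    have M: "4 * exp (L\<^sup>2) \<le> M" "4 \<le> M" using card card1 by (simp_all add: M_def L_def)
    \<comment> \<open>Signal strength \<open>L / D\<close> and \<open>\<alpha> = M / 2\<close>: the
      subtracted terms are \<open>M / 4\<close> and \<open>exp (L\<^sup>2)\<close>, and the latter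
      is also at most \<open>M / 4\<close> by the assumption on the number of points. Half of
      \<open>M\<close> survives.\<close>
    have "L / D * (a\<^sup>2 / 4) * (M - (M / 2) / 2 - M * exp ((L / D)\<^sup>2 * D\<^sup>2) / (2 * (M / 2))) \<le>
        M * (\<integral>w. g' w \<partial>gauss_product I)"
      unfolding M_def using A s0 D L card1 g' max' ND[unfolded N_def] sep
      by (intro gauss_product_max_ge[where h = k]) (auto simp: kd)
    also have "M * exp ((L / D)\<^sup>2 * D\<^sup>2) / (2 * (M / 2)) = exp (L\<^sup>2)"
      using M D by (simp add: power_divide)
    finally have 1: "L / D * (a\<^sup>2 / 4) * (M - (M / 2) / 2 - exp (L\<^sup>2)) \<le> M * (\<integral>w. g' w \<partial>gauss_product I)" .
    have "L / D * (a\<^sup>2 / 4) * (M / 2) \<le> L / D * (a\<^sup>2 / 4) * (M - (M / 2) / 2 - exp (L\<^sup>2))"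
      using L D M by (intro mult_left_mono) auto
    with 1 have "M * (L * a\<^sup>2 / (8 * D)) \<le> M * (\<integral>w. g' w \<partial>gauss_product I)" by (simp add: field_simps)
    thus ?thesis using M(2) unfolding g' by (subst (asm) mult_le_cancel_left_pos) auto
  qed
  have "(B * a)\<^sup>2 = (D / 64) * (L * a\<^sup>2 / (8 * D))"
    using D by (simp add: L_def power_mult_distrib)
  also have "\<dots> \<le> (\<integral>w. g w \<partial>gauss_product I) * (\<integral>w. g w \<partial>gauss_product I)"
    using D L two by (intro mult_mono two all) (auto intro: order.trans[rotated])
  finally have "(B * a)\<^sup>2 \<le> (\<integral>w. g w \<partial>gauss_product I)\<^sup>2" by (simp add: power2_eq_square)
  moreover have "0 \<le> (\<integral>w. g w \<partial>gauss_product I)" using two D by (auto intro: order.trans[rotated])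
  ultimately show ?thesis by (rule power2_le_imp_le)
qed

end

subsection \<open>A reversible coupling without atoms\<close>

text \<open>The Metropolis acceptance probability for a symmetric proposal. Where
  \<open>f x = 0\<close> the quotient is 0 and everything is rejected; the balance identity
  \<open>f_mult_acc\<close> holds there too.\<close>

definition accept_prob :: "(real ^ 'd \<Rightarrow> real) \<Rightarrow> real \<Rightarrow> real ^ 'd \<Rightarrow> real ^ 'd \<Rightarrow> real" where
  "accept_prob f s x w = min 1 (f (x + s *\<^sub>R w) / f x)"

text \<open>The integer index of a grid cell. There are only countably many cells, which
  \<open>AE_cell_mass\<close> uses. If \<open>w $ k = 0\<close>, division by zero puts all values of
  that coordinate into one cell.\<close>

definition cell :: "real \<Rightarrow> real ^ 'd \<Rightarrow> real ^ 'd \<Rightarrow> 'd \<Rightarrow> int" where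
  "cell s w x = (\<lambda>k. \<lfloor>x $ k / (s * w $ k)\<rfloor>)"

text \<open>The flag tells whether the proposal \<open>w\<close> was accepted; otherwise the move
  goes to the resampled point \<open>y\<close>. Dividing by \<open>s\<close> makes the two cases
  comparable with \<open>w\<close>.\<close>

definition displacement :: "real \<Rightarrow> real ^ 'd \<Rightarrow> (real ^ 'd) \<times> (real ^ 'd) \<times> bool \<Rightarrow> real ^ 'd" where
  "displacement s x = (\<lambda>(w, y, b). if b then w else (1 / s) *\<^sub>R (y - x))"

lemma floor_divide_eq_imp_abs_diff_le:
  fixes a b c :: real
  assumes "\<lfloor>a / c\<rfloor> = \<lfloor>b / c\<rfloor>" "c \<noteq> 0"
  shows "\<bar>a - b\<bar> \<le> \<bar>c\<bar>"
proof -
  have "\<bar>a / c - b / c\<bar> \<le> 1" using assms(1) by linarith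
  hence "\<bar>a - b\<bar> / \<bar>c\<bar> \<le> 1" by (simp add: diff_divide_distrib[symmetric] abs_divide)
  thus ?thesis using assms(2) by (simp add: divide_le_eq)
qed

locale proposal =
  fixes P :: "(real ^ 'd) measure" and f :: "real ^ 'd \<Rightarrow> real" and s :: real
  assumes f_measurable [measurable]: "f \<in> borel_measurable borel"
    and f_nonneg: "0 \<le> f x"
    and P_eq: "P = density lborel (\<lambda>x. ennreal (f x))"
    and prob_P: "prob_space P"
    and s_pos: "0 < s"
begin

lemma sets_P [measurable_cong, simp]: "sets P = sets borel"
  by (simp add: P_eq)

lemma space_P [simp]: "space P = UNIV"
  by (simp add: P_eq)

sublocale P: prob_space P by (rule prob_P)
sublocale G: prob_space "std_gaussian :: (real ^ 'd) measure" by (rule prob_space_std_gaussian)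

abbreviation acc where "acc \<equiv> accept_prob f s"
abbreviation same_cell where "same_cell w x y \<equiv> cell s w x = cell s w y"

lemma acc_bounds: "0 \<le> acc x w" "acc x w \<le> 1"
  by (auto simp: accept_prob_def f_nonneg)

lemma f_mult_acc: "f x * acc x w = min (f x) (f (x + s *\<^sub>R w))"
  using f_nonneg[of x] f_nonneg[of "x + s *\<^sub>R w"]
  by (cases "f x = 0") (auto simp: accept_prob_def min_def field_simps)

lemma measurable_acc [measurable (raw)]:
  assumes [measurable]: "g \<in> borel_measurable M" "h \<in> borel_measurable M"
  shows "(\<lambda>z. acc (g z) (h z)) \<in> borel_measurable M"
  unfolding accept_prob_def by measurable

lemma measurable_same_cell [measurable (raw)]:
  assumes [measurable]: "u \<in> borel_measurable M" "g \<in> borel_measurable M" "h \<in> borel_measurable M"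
  shows "Measurable.pred M (\<lambda>z. same_cell (u z) (g z) (h z))"
proof -
  have "same_cell (u z) (g z) (h z) \<longleftrightarrow>
      (\<forall>k. real_of_int \<lfloor>g z $ k / (s * u z $ k)\<rfloor> = real_of_int \<lfloor>h z $ k / (s * u z $ k)\<rfloor>)" for z
    by (auto simp: cell_def fun_eq_iff)
  thus ?thesis by simp
qed

text \<open>The normalising constant of the resampling. It depends on \<open>x\<close> only through
  its cell, which makes the resampling symmetric in its two end points.\<close>

definition cell_mass :: "real ^ 'd \<Rightarrow> real ^ 'd \<Rightarrow> ennreal" where
  "cell_mass x w = (\<integral>\<^sup>+ y. ennreal ((1 - acc y w) * of_bool (same_cell w x y)) \<partial>P)"

text \<open>
  A Metropolis step with Gaussian proposal \<open>w\<close>, except that after a rejection the point does not stay at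
  \<open>x\<close>: it is resampled as \<open>y\<close> from the rejected mass in the cell of \<open>x\<close>. An atom at displacement \<open>0\<close>
  has to be avoided because the Taylor bound holds only for Lebesgue-almost all pairs. The sides of
  the cells are \<open>s \<bar>w\<^sub>k\<bar>\<close>, which keeps the displacement coordinatewise below \<open>w\<close>, and hence
  sub-Gaussian. Where \<open>cell_mass x w = 0\<close> the quotient is \<open>0\<close>; almost surely no proposal is rejected
  there.
\<close>

definition move_density :: "real ^ 'd \<Rightarrow> (real ^ 'd) \<times> (real ^ 'd) \<times> bool \<Rightarrow> real" where
  "move_density x = (\<lambda>(w, y, b). if b then acc x w else
     (1 - acc x w) * (1 - acc y w) * of_bool (same_cell w x y) / enn2real (cell_mass x w))"

abbreviation aux :: "((real ^ 'd) \<times> (real ^ 'd) \<times> bool) measure" where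
  "aux \<equiv> std_gaussian \<Otimes>\<^sub>M (P \<Otimes>\<^sub>M count_space UNIV)"

text \<open>The law of the start together with the proposal, the resampled point and the flag. The
  flag has counting measure in \<open>aux\<close>, so the two branches of
  \<open>move_density\<close> add up, after integration over \<open>y\<close>, to 1 for almost every
  start and proposal.\<close>

definition moves :: "((real ^ 'd) \<times> (real ^ 'd) \<times> (real ^ 'd) \<times> bool) measure" where
  "moves = density (P \<Otimes>\<^sub>M aux) (\<lambda>(x, v). ennreal (move_density x v))"

lemma cell_mass_le: "cell_mass x w \<le> 1"
proof -
  have "cell_mass x w \<le> (\<integral>\<^sup>+ y. 1 \<partial>P)"
    unfolding cell_mass_def using acc_bounds
    by (intro nn_integral_mono) (auto simp: ennreal_le_1 of_bool_def)
  thus ?thesis using P.emeasure_space_1 by simp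
qed

lemma measurable_cell_mass [measurable (raw)]:
  assumes [measurable]: "g \<in> borel_measurable M" "h \<in> borel_measurable M"
  shows "(\<lambda>z. cell_mass (g z) (h z)) \<in> borel_measurable M"
  unfolding cell_mass_def by measurable

lemma measurable_aux_components:
  assumes "h \<in> M \<rightarrow>\<^sub>M aux"
  shows "(\<lambda>z. fst (h z)) \<in> borel_measurable M" "(\<lambda>z. fst (snd (h z))) \<in> borel_measurable M"
    "Measurable.pred M (\<lambda>z. snd (snd (h z)))"
proof -
  have "sets aux = sets (borel \<Otimes>\<^sub>M (borel \<Otimes>\<^sub>M count_space UNIV))"
    by (intro sets_pair_measure_cong) auto
  hence h [measurable]: "h \<in> M \<rightarrow>\<^sub>M borel \<Otimes>\<^sub>M (borel \<Otimes>\<^sub>M count_space UNIV)"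
    using assms measurable_cong_sets[OF refl] by blast
  show "(\<lambda>z. fst (h z)) \<in> borel_measurable M" "(\<lambda>z. fst (snd (h z))) \<in> borel_measurable M"
    "Measurable.pred M (\<lambda>z. snd (snd (h z)))"
    by (rule measurable_compose[OF h]; measurable)+
qed

lemma measurable_move_density [measurable (raw)]:
  assumes [measurable]: "g \<in> borel_measurable M" and h: "h \<in> M \<rightarrow>\<^sub>M aux"
  shows "(\<lambda>z. move_density (g z) (h z)) \<in> borel_measurable M"
  using measurable_aux_components[OF h, measurable]
  unfolding move_density_def split_beta by measurable

lemma measurable_displacement [measurable (raw)]:
  assumes [measurable]: "g \<in> borel_measurable M" and h: "h \<in> M \<rightarrow>\<^sub>M aux"
  shows "(\<lambda>z. displacement s (g z) (h z)) \<in> borel_measurable M"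
  using measurable_aux_components[OF h, measurable]
  unfolding displacement_def split_beta by measurable

lemma move_density_True [simp]: "move_density x (w, y, True) = acc x w"
  by (simp add: move_density_def)

lemma move_density_nonneg: "0 \<le> move_density x v"
  unfolding move_density_def using acc_bounds by (auto simp: split_beta)

lemma same_cell_bound:
  assumes "same_cell w x y" "w $ k \<noteq> 0"
  shows "\<bar>((1 / s) *\<^sub>R (y - x)) $ k\<bar> \<le> \<bar>w $ k\<bar>"
proof -
  have "\<lfloor>y $ k / (s * w $ k)\<rfloor> = \<lfloor>x $ k / (s * w $ k)\<rfloor>"
    using assms(1) by (auto simp: cell_def fun_eq_iff)
  hence "\<bar>y $ k - x $ k\<bar> \<le> \<bar>s * w $ k\<bar>"
    using assms s_pos by (intro floor_divide_eq_imp_abs_diff_le) auto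
  thus ?thesis using s_pos by (simp add: abs_mult field_simps)
qed

text \<open>In a cell of rejected mass zero almost every point accepts, since the integrand defining
  the mass vanishes almost everywhere; countably many exceptional sets are collected.\<close>

lemma AE_cell_mass: "AE x in P. cell_mass x w = 0 \<longrightarrow> acc x w = 1"
proof -
  have "AE x in P. \<forall>z. cell s w x = z \<longrightarrow> cell_mass x w = 0 \<longrightarrow> acc x w = 1"
    unfolding AE_all_countable
  proof
    fix z
    show "AE x in P. cell s w x = z \<longrightarrow> cell_mass x w = 0 \<longrightarrow> acc x w = 1"
    proof (cases "\<exists>x. cell s w x = z \<and> cell_mass x w = 0")
      case True
      then obtain x0 where x0: "cell s w x0 = z" "cell_mass x0 w = 0" by blast
      have "AE y in P. ennreal ((1 - acc y w) * of_bool (same_cell w x0 y)) = 0"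
        using x0(2) unfolding cell_mass_def by (subst (asm) nn_integral_0_iff_AE) auto
      thus ?thesis
      proof eventually_elim
        case (elim y)
        thus ?case using acc_bounds(2)[of y w] by (auto simp: x0(1)[symmetric] ennreal_eq_0_iff)
      qed
    qed auto
  qed
  thus ?thesis by simp
qed

lemma AE_cell_mass_pair: "AE x in P. AE w in std_gaussian. cell_mass x w = 0 \<longrightarrow> acc x w = 1"
proof -
  interpret pair_sigma_finite P "std_gaussian :: (real ^ 'd) measure" ..
  have "Measurable.pred (P \<Otimes>\<^sub>M std_gaussian) (\<lambda>z. cell_mass (fst z) (snd z) = 0 \<longrightarrow> acc (fst z) (snd z) = 1)"
    by measurable
  hence "{z \<in> space (P \<Otimes>\<^sub>M std_gaussian). cell_mass (fst z) (snd z) = 0 \<longrightarrow> acc (fst z) (snd z) = 1}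
      \<in> sets (P \<Otimes>\<^sub>M std_gaussian)"
    by (rule predE)
  hence "(AE x in P. AE w in std_gaussian. cell_mass x w = 0 \<longrightarrow> acc x w = 1) \<longleftrightarrow>
      (AE w in std_gaussian. AE x in P. cell_mass x w = 0 \<longrightarrow> acc x w = 1)"
    by (rule AE_commute)
  thus ?thesis
    using AE_cell_mass by (simp only: AE_I2)
qed

lemma nn_integral_bool: "(\<integral>\<^sup>+ b. g b \<partial>count_space UNIV) = g True + g False"
  by (subst nn_integral_count_space_finite) (auto simp: UNIV_bool add.commute)

lemma sigma_finite_bool: "sigma_finite_measure (count_space (UNIV :: bool set))"
  by (rule sigma_finite_measure_count_space_finite) simp

sublocale PB: pair_sigma_finite P "count_space (UNIV :: bool set)"
  by (simp add: pair_sigma_finite_def sigma_finite_bool P.sigma_finite_measure_axioms)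

lemma sigma_finite_aux: "sigma_finite_measure aux"
  by (intro sigma_finite_pair_measure sigma_finite_bool P.sigma_finite_measure_axioms
    G.sigma_finite_measure_axioms)

sublocale aux: sigma_finite_measure aux by (rule sigma_finite_aux)
sublocale PA: pair_sigma_finite P aux
  by (simp add: pair_sigma_finite_def sigma_finite_aux P.sigma_finite_measure_axioms)
sublocale PG: pair_sigma_finite P "std_gaussian :: (real ^ 'd) measure" ..
sublocale PP: pair_sigma_finite P P ..

lemma nn_integral_aux:
  assumes [measurable]: "F \<in> borel_measurable aux"
  shows "(\<integral>\<^sup>+ v. F v \<partial>aux) =
    (\<integral>\<^sup>+ w. \<integral>\<^sup>+ y. F (w, y, True) + F (w, y, False) \<partial>P \<partial>std_gaussian)"
proof -
  have sf: "sigma_finite_measure (P \<Otimes>\<^sub>M count_space (UNIV :: bool set))"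
    by (intro sigma_finite_pair_measure sigma_finite_bool P.sigma_finite_measure_axioms)
  have "(\<integral>\<^sup>+ v. F v \<partial>aux) = (\<integral>\<^sup>+ w. \<integral>\<^sup>+ v. F (w, v) \<partial>(P \<Otimes>\<^sub>M count_space UNIV) \<partial>std_gaussian)"
    by (rule sigma_finite_measure.nn_integral_fst[OF sf, symmetric]) measurable
  also have "\<dots> = (\<integral>\<^sup>+ w. \<integral>\<^sup>+ y. \<integral>\<^sup>+ b. F (w, y, b) \<partial>count_space UNIV \<partial>P \<partial>std_gaussian)"
    by (intro nn_integral_cong sigma_finite_measure.nn_integral_fst[OF sigma_finite_bool, symmetric]) measurable
  finally show ?thesis by (simp add: nn_integral_bool)
qed

lemma nn_integral_move_density_False:
  "(\<integral>\<^sup>+ y. ennreal (move_density x (w, y, False)) \<partial>P) =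
     (if cell_mass x w = 0 then 0 else ennreal (1 - acc x w))"
proof (cases "cell_mass x w = 0")
  case True
  thus ?thesis by (simp add: move_density_def)
next
  case False
  have fin: "cell_mass x w < \<top>" using cell_mass_le[of x w] by (rule order.strict_trans1) simp
  have pos: "enn2real (cell_mass x w) > 0"
    using False fin by (simp add: enn2real_positive_iff zero_less_iff_neq_zero)
  have "(\<integral>\<^sup>+ y. ennreal (move_density x (w, y, False)) \<partial>P) =
    (\<integral>\<^sup>+ y. ennreal ((1 - acc x w) / enn2real (cell_mass x w)) *
       ennreal ((1 - acc y w) * of_bool (same_cell w x y)) \<partial>P)"
    using acc_bounds pos
    by (intro nn_integral_cong) (simp add: move_density_def ennreal_mult[symmetric])
  also have "\<dots> = ennreal ((1 - acc x w) / enn2real (cell_mass x w)) * cell_mass x w"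
    by (subst nn_integral_cmult) (auto simp: cell_mass_def)
  also have "\<dots> = ennreal ((1 - acc x w) / enn2real (cell_mass x w)) * ennreal (enn2real (cell_mass x w))"
    using fin by simp
  also have "\<dots> = ennreal (1 - acc x w)"
    using pos acc_bounds by (subst ennreal_mult[symmetric]) auto
  finally show ?thesis using False by simp
qed

lemma nn_integral_move_density_y:
  assumes "cell_mass x w = 0 \<longrightarrow> acc x w = 1"
  shows "(\<integral>\<^sup>+ y. ennreal (move_density x (w, y, True)) + ennreal (move_density x (w, y, False)) \<partial>P) = 1"
  using assms acc_bounds P.emeasure_space_1
  by (subst nn_integral_add)
    (auto simp: nn_integral_move_density_False ennreal_plus[symmetric] simp del: ennreal_plus)

text \<open>Integrating out \<open>y\<close> and the flag leaves mass 1 for almost every proposal,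
  so the proposal stays standard Gaussian given the start. The quantifier over \<open>h\<close> is
  inside, so that one exceptional set serves all test functions and the conditional law is
  identified.\<close>

lemma AE_kernel_fst:
  "AE x in P. \<forall>h \<in> borel_measurable borel.
     (\<integral>\<^sup>+ v. ennreal (move_density x v) * h (fst v) \<partial>aux) = (\<integral>\<^sup>+ w. h w \<partial>std_gaussian)"
  using AE_cell_mass_pair
proof eventually_elim
  case (elim x)
  show ?case
  proof
    fix h :: "real ^ 'd \<Rightarrow> ennreal" assume [measurable]: "h \<in> borel_measurable borel"
    have "(\<integral>\<^sup>+ v. ennreal (move_density x v) * h (fst v) \<partial>aux) =
       (\<integral>\<^sup>+ w. \<integral>\<^sup>+ y. (ennreal (move_density x (w, y, True)) + ennreal (move_density x (w, y, False))) * h w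
          \<partial>P \<partial>std_gaussian)"
      by (subst nn_integral_aux) (auto simp: distrib_right)
    also have "\<dots> = (\<integral>\<^sup>+ w. h w \<partial>std_gaussian)"
    proof (rule nn_integral_cong_AE, use elim in eventually_elim)
      case (elim w)
      thus ?case
        by (subst nn_integral_multc)
          (measurable, simp only: nn_integral_move_density_y[OF elim] mult_1_left)
    qed
    finally show "(\<integral>\<^sup>+ v. ennreal (move_density x v) * h (fst v) \<partial>aux) = (\<integral>\<^sup>+ w. h w \<partial>std_gaussian)" .
  qed
qed

lemma nn_integral_moves:
  assumes [measurable]: "F \<in> borel_measurable (P \<Otimes>\<^sub>M aux)"
  shows "(\<integral>\<^sup>+ z. F z \<partial>moves) = (\<integral>\<^sup>+ x. \<integral>\<^sup>+ v. ennreal (move_density x v) * F (x, v) \<partial>aux \<partial>P)"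
  unfolding moves_def
  by (subst nn_integral_density) (auto simp: aux.nn_integral_fst[symmetric] split_beta)

lemma nn_integral_moves_fst:
  assumes [measurable]: "h \<in> borel_measurable (borel \<Otimes>\<^sub>M borel)"
  shows "(\<integral>\<^sup>+ (x, w, _). h (x, w) \<partial>moves) = (\<integral>\<^sup>+ x. \<integral>\<^sup>+ w. h (x, w) \<partial>std_gaussian \<partial>P)"
proof -
  have "(\<integral>\<^sup>+ (x, w, _). h (x, w) \<partial>moves) =
      (\<integral>\<^sup>+ x. \<integral>\<^sup>+ v. ennreal (move_density x v) * h (x, fst v) \<partial>aux \<partial>P)"
    by (subst nn_integral_moves) (auto simp: split_beta)
  also have "\<dots> = (\<integral>\<^sup>+ x. \<integral>\<^sup>+ w. h (x, w) \<partial>std_gaussian \<partial>P)"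
  proof (rule nn_integral_cong_AE, use AE_kernel_fst in eventually_elim)
    case (elim x)
    have "(\<lambda>w. h (x, w)) \<in> borel_measurable borel" by measurable
    from elim[rule_format, OF this] show ?case .
  qed
  finally show ?thesis .
qed

lemma sets_moves [measurable_cong, simp]: "sets moves = sets (P \<Otimes>\<^sub>M aux)"
  by (simp add: moves_def)

lemma space_moves [simp]: "space moves = UNIV"
  by (simp add: moves_def space_pair_measure)

lemma prob_space_moves: "prob_space moves"
proof
  have "emeasure moves (space moves) = (\<integral>\<^sup>+ (x, w, _). 1 \<partial>moves)"
    by (simp add: case_prod_unfold)
  also have "\<dots> = 1"
    using nn_integral_moves_fst[of "\<lambda>_. 1"] G.emeasure_space_1 P.emeasure_space_1 by simp
  finally show "emeasure moves (space moves) = 1" .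
qed

text \<open>With the proposal outermost, both branches are integrals over end points for a fixed
  \<open>w\<close>, the form in which detailed balance can be read off.\<close>

lemma nn_integral_moves_displacement:
  assumes [measurable]: "h \<in> borel_measurable (borel \<Otimes>\<^sub>M borel)"
  shows "(\<integral>\<^sup>+ (x, v). h (x, displacement s x v) \<partial>moves) =
     (\<integral>\<^sup>+ w. \<integral>\<^sup>+ x. ennreal (acc x w) * h (x, w) \<partial>P \<partial>std_gaussian) +
     (\<integral>\<^sup>+ w. \<integral>\<^sup>+ x. \<integral>\<^sup>+ y. ennreal (move_density x (w, y, False)) * h (x, (1 / s) *\<^sub>R (y - x))
        \<partial>P \<partial>P \<partial>std_gaussian)"
proof -
  have "(\<integral>\<^sup>+ (x, v). h (x, displacement s x v) \<partial>moves) =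
     (\<integral>\<^sup>+ x. \<integral>\<^sup>+ w. \<integral>\<^sup>+ y. ennreal (acc x w) * h (x, w) +
        ennreal (move_density x (w, y, False)) * h (x, (1 / s) *\<^sub>R (y - x)) \<partial>P \<partial>std_gaussian \<partial>P)"
    by (subst nn_integral_moves)
      (auto simp: split_beta nn_integral_aux displacement_def)
  also have "\<dots> = (\<integral>\<^sup>+ w. \<integral>\<^sup>+ x. \<integral>\<^sup>+ y. ennreal (acc x w) * h (x, w) +
        ennreal (move_density x (w, y, False)) * h (x, (1 / s) *\<^sub>R (y - x)) \<partial>P \<partial>P \<partial>std_gaussian)"
    by (subst PG.Fubini') auto
  finally show ?thesis
    using P.emeasure_space_1 by (simp add: nn_integral_add)
qed

lemma cell_mass_same_cell: "same_cell w x y \<Longrightarrow> cell_mass x w = cell_mass y w"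
  by (simp add: cell_mass_def)

text \<open>Detailed balance holds in each branch. For accepted moves, \<open>f x * acc x w\<close>
  is the minimum of the density at the two end points, and reversing the move replaces
  \<open>w\<close> by \<open>- w\<close>, which has the same Gaussian law. For rejected moves, the
  two end points share a cell, hence the normalising constant, and the density is symmetric in them.
  Both the law of the moved point and the symmetry of the displacement are consequences.\<close>

lemma nn_integral_moves_reversible:
  assumes h [measurable]: "h \<in> borel_measurable (borel \<Otimes>\<^sub>M borel)"
  shows "(\<integral>\<^sup>+ (x, v). h (x + s *\<^sub>R displacement s x v, - displacement s x v) \<partial>moves) =
    (\<integral>\<^sup>+ (x, v). h (x, displacement s x v) \<partial>moves)"
proof -
  define h' where "h' = (\<lambda>(x, w). h (x + s *\<^sub>R w, - w))"
  have h' [measurable]: "h' \<in> borel_measurable (borel \<Otimes>\<^sub>M borel)"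
    unfolding h'_def by measurable
  have "(\<integral>\<^sup>+ w. \<integral>\<^sup>+ x. ennreal (acc x w) * h' (x, w) \<partial>P \<partial>std_gaussian) =
     (\<integral>\<^sup>+ w. \<integral>\<^sup>+ x. ennreal (min (f x) (f (x + s *\<^sub>R w))) * h (x + s *\<^sub>R w, - w) \<partial>lborel \<partial>std_gaussian)"
    unfolding P_eq by (subst nn_integral_density)
      (auto simp: h'_def f_mult_acc[symmetric] ennreal_mult f_nonneg acc_bounds mult.assoc)
  also have "\<dots> = (\<integral>\<^sup>+ w. \<integral>\<^sup>+ x. ennreal (min (f (x - s *\<^sub>R w)) (f x)) * h (x, - w) \<partial>lborel \<partial>std_gaussian)"
  proof (rule nn_integral_cong)
    fix w :: "real ^ 'd"
    show "(\<integral>\<^sup>+ x. ennreal (min (f x) (f (x + s *\<^sub>R w))) * h (x + s *\<^sub>R w, - w) \<partial>lborel) =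
        (\<integral>\<^sup>+ x. ennreal (min (f (x - s *\<^sub>R w)) (f x)) * h (x, - w) \<partial>lborel)"
      by (subst nn_integral_lborel_shift[symmetric, where t = "s *\<^sub>R w"]) simp_all
  qed
  also have "\<dots> = (\<integral>\<^sup>+ w. \<integral>\<^sup>+ x. ennreal (min (f (x + s *\<^sub>R w)) (f x)) * h (x, w) \<partial>lborel \<partial>std_gaussian)"
    by (subst nn_integral_std_gaussian_uminus[symmetric]) simp_all
  also have "\<dots> = (\<integral>\<^sup>+ w. \<integral>\<^sup>+ x. ennreal (acc x w) * h (x, w) \<partial>P \<partial>std_gaussian)"
    unfolding P_eq by (subst nn_integral_density)
      (auto simp: f_mult_acc[symmetric] ennreal_mult f_nonneg acc_bounds mult.assoc min.commute[of "f (_ + _)"])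
  finally have T: "(\<integral>\<^sup>+ w. \<integral>\<^sup>+ x. ennreal (acc x w) * h' (x, w) \<partial>P \<partial>std_gaussian) = \<dots>" .

  have *: "ennreal (move_density x (w, y, False)) * h' (x, (1 / s) *\<^sub>R (y - x)) =
      ennreal (move_density y (w, x, False)) * h (y, (1 / s) *\<^sub>R (x - y))" for x y w
  proof -
    have "h' (x, (1 / s) *\<^sub>R (y - x)) = h (y, (1 / s) *\<^sub>R (x - y))"
      using s_pos by (simp add: h'_def scaleR_diff_right)
    moreover have "move_density x (w, y, False) = move_density y (w, x, False)"
      using cell_mass_same_cell[of w x y] by (cases "same_cell w x y") (auto simp: move_density_def)
    ultimately show ?thesis by simp
  qed
  have "(\<integral>\<^sup>+ w. \<integral>\<^sup>+ x. \<integral>\<^sup>+ y. ennreal (move_density x (w, y, False)) * h' (x, (1 / s) *\<^sub>R (y - x))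
        \<partial>P \<partial>P \<partial>std_gaussian) =
      (\<integral>\<^sup>+ w. \<integral>\<^sup>+ x. \<integral>\<^sup>+ y. ennreal (move_density x (w, y, False)) * h (x, (1 / s) *\<^sub>R (y - x))
        \<partial>P \<partial>P \<partial>std_gaussian)"
    unfolding * by (intro nn_integral_cong PP.Fubini') simp
  with T have "(\<integral>\<^sup>+ (x, v). h' (x, displacement s x v) \<partial>moves) = (\<integral>\<^sup>+ (x, v). h (x, displacement s x v) \<partial>moves)"
    unfolding nn_integral_moves_displacement[OF h] nn_integral_moves_displacement[OF h'] by simp
  thus ?thesis by (simp add: h'_def)
qed

text \<open>If a coordinate of \<open>w\<close> vanished, its cells would be unbounded by the
  convention on division and the displacement would not be controlled by \<open>w\<close>; this has
  probability 0.\<close>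

lemma AE_moves_nonzero: "AE (x, w, _) in moves. \<forall>k. w $ k \<noteq> 0"
proof -
  have m: "{w :: real ^ 'd. \<exists>k. w $ k = 0} \<in> sets borel" by measurable
  define h :: "(real ^ 'd) \<times> (real ^ 'd) \<Rightarrow> ennreal" where
    "h = (\<lambda>z. indicator {w. \<exists>k. w $ k = 0} (snd z))"
  have [measurable]: "h \<in> borel_measurable (borel \<Otimes>\<^sub>M borel)"
    unfolding h_def using m by measurable
  have "AE w in (std_gaussian :: (real ^ 'd) measure). \<forall>k. w $ k \<noteq> 0"
    unfolding AE_all_countable by (intro allI AE_std_gaussian_vec_nth_neq_0)
  hence "(\<integral>\<^sup>+ w. h (x, w) \<partial>std_gaussian) = 0" for x
    using m by (subst nn_integral_0_iff_AE) (auto simp: h_def indicator_def elim!: eventually_mono)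
  hence "(\<integral>\<^sup>+ (x, w, _). h (x, w) \<partial>moves) = 0"
    by (subst nn_integral_moves_fst) auto
  hence "AE z in moves. (\<lambda>(x, w, _). h (x, w)) z = 0"
    by (subst (asm) nn_integral_0_iff_AE) (auto simp: case_prod_unfold)
  thus ?thesis
    by eventually_elim (auto simp: h_def indicator_def split: if_splits)
qed

lemma AE_moves_same_cell: "AE (x, w, y, b) in moves. b \<or> same_cell w x y"
  unfolding moves_def
  by (subst AE_density) (auto intro!: AE_I2 simp: move_density_def split: if_splits)

lemma AE_displacement_le: "AE (x, v) in moves. \<forall>k. \<bar>displacement s x v $ k\<bar> \<le> \<bar>fst v $ k\<bar>"
  using AE_moves_nonzero AE_moves_same_cell
proof eventually_elim
  case (elim z)
  obtain x w y b where z: "z = (x, w, y, b)" by (metis surj_pair)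
  show ?case using elim same_cell_bound[of w x y] by (auto simp: z displacement_def)
qed

text \<open>The displacement differs from the proposal only after a rejection, and then by at most
  twice the norm of the proposal. Integrating out the resampled point leaves the rejection
  probability as weight.\<close>

lemma nn_integral_displacement_error:
  assumes "0 < q"
  shows "(\<integral>\<^sup>+ (x, v). ennreal (norm (displacement s x v - fst v) powr q) \<partial>moves) \<le>
    ennreal (2 powr q) * (\<integral>\<^sup>+ x. \<integral>\<^sup>+ w. ennreal (norm w powr q * (1 - acc x w)) \<partial>std_gaussian \<partial>P)"
proof -
  have "(\<integral>\<^sup>+ (x, v). ennreal (norm (displacement s x v - fst v) powr q) \<partial>moves) \<le>
     (\<integral>\<^sup>+ (x, v). ennreal (2 powr q) * ennreal (norm (fst v) powr q * of_bool (\<not> snd (snd v))) \<partial>moves)"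
  proof (rule nn_integral_mono_AE, use AE_displacement_le in eventually_elim)
    case (elim z)
    obtain x w y b where z: "z = (x, w, y, b)" by (metis surj_pair)
    have "norm (displacement s x (w, y, b)) \<le> norm w"
      using elim by (intro norm_le_componentwise_cart) (auto simp: z)
    hence "norm (displacement s x (w, y, b) - w) \<le> 2 * norm w"
      using norm_triangle_ineq4[of "displacement s x (w, y, b)" w] by linarith
    hence "norm (displacement s x (w, y, b) - w) powr q \<le> (2 * norm w) powr q"
      using assms by (intro powr_mono2) auto
    also have "\<dots> = 2 powr q * norm w powr q" by (simp add: powr_mult)
    finally show ?case
      using assms by (cases b) (auto simp: z displacement_def ennreal_mult[symmetric])
  qed
  also have "\<dots> = ennreal (2 powr q) * (\<integral>\<^sup>+ (x, v). ennreal (norm (fst v) powr q * of_bool (\<not> snd (snd v))) \<partial>moves)"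
    by (simp add: case_prod_unfold nn_integral_cmult)
  also have "(\<integral>\<^sup>+ (x, v). ennreal (norm (fst v) powr q * of_bool (\<not> snd (snd v))) \<partial>moves) =
     (\<integral>\<^sup>+ x. \<integral>\<^sup>+ w. \<integral>\<^sup>+ y. ennreal (move_density x (w, y, False)) * ennreal (norm w powr q) \<partial>P \<partial>std_gaussian \<partial>P)"
    by (subst nn_integral_moves) (auto simp: split_beta nn_integral_aux)
  also have "\<dots> \<le> (\<integral>\<^sup>+ x. \<integral>\<^sup>+ w. ennreal (norm w powr q * (1 - acc x w)) \<partial>std_gaussian \<partial>P)"
    by (intro nn_integral_mono, subst nn_integral_multc)
      (auto simp: nn_integral_move_density_False ennreal_mult acc_bounds mult.commute)
  finally show ?thesis by (simp add: mult_left_mono)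
qed

lemma AE_lborel_affine:
  fixes t :: "real ^ 'd"
  assumes "AE x in lborel. Q x" "c \<noteq> 0"
  shows "AE x in lborel. Q (t + c *\<^sub>R x)"
proof -
  obtain N where N: "N \<in> sets borel" "emeasure lborel N = 0" "\<And>x. x \<notin> N \<Longrightarrow> Q x"
    using assms(1) by (rule AE_E) (use that in auto)
  have "AE x in density (distr lborel borel (\<lambda>x. t + c *\<^sub>R x)) (\<lambda>_. \<bar>c\<bar> ^ DIM(real ^ 'd)). x \<notin> N"
    unfolding lborel_affine[OF assms(2), symmetric] using N by (intro AE_not_in) auto
  hence "AE x in lborel. t + c *\<^sub>R x \<notin> N"
    using N(1) assms(2) by (auto simp: AE_density AE_distr_iff)
  thus ?thesis by eventually_elim (rule N(3))
qed

lemma P_absolutely_continuous: "AE x in lborel. Q x \<Longrightarrow> AE x in P. Q x"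
  unfolding P_eq by (subst AE_density) auto

lemma std_gaussian_absolutely_continuous:
  "AE w in lborel. Q w \<Longrightarrow> AE w in (std_gaussian :: (real ^ 'd) measure). Q w"
  unfolding std_gaussian_def by (subst AE_density) auto

text \<open>Given the start, an accepted displacement has a density with respect to the Gaussian law
  and a resampled end point has one with respect to \<open>P\<close>; both laws have Lebesgue
  densities. Here the resampling pays off: remaining at \<open>x\<close> would charge the null set
  of zero displacements.\<close>

lemma moves_absolutely_continuous:
  "absolutely_continuous (lborel \<Otimes>\<^sub>M lborel)
    (distr moves (borel \<Otimes>\<^sub>M borel) (\<lambda>(x, v). (x, s *\<^sub>R displacement s x v)))"
  unfolding absolutely_continuous_def
proof
  fix N :: "((real ^ 'd) \<times> (real ^ 'd)) set"
  assume N: "N \<in> null_sets (lborel \<Otimes>\<^sub>M (lborel :: (real ^ 'd) measure))"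
  hence N' [measurable]: "N \<in> sets (borel \<Otimes>\<^sub>M (borel :: (real ^ 'd) measure))"
    by (auto simp: null_sets_def cong: sets_pair_measure_cong)
  define h :: "(real ^ 'd) \<times> (real ^ 'd) \<Rightarrow> ennreal" where
    "h = (\<lambda>(x, u). indicator N (x, s *\<^sub>R u))"
  have h [measurable]: "h \<in> borel_measurable (borel \<Otimes>\<^sub>M borel)"
    unfolding h_def using N' by measurable
  have "AE z in lborel \<Otimes>\<^sub>M lborel. z \<notin> N" using N by (rule AE_not_in)
  hence "AE x in lborel. AE c in lborel. (x, c) \<notin> N"
    by (rule lborel_pair.AE_pair)
  hence ae: "AE x in P. AE c in lborel. (x, c) \<notin> N" by (rule P_absolutely_continuous)
  have "(\<integral>\<^sup>+ (x, v). h (x, displacement s x v) \<partial>moves) =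
     (\<integral>\<^sup>+ x. \<integral>\<^sup>+ w. ennreal (acc x w) * h (x, w) \<partial>std_gaussian \<partial>P) +
     (\<integral>\<^sup>+ x. \<integral>\<^sup>+ w. \<integral>\<^sup>+ y. ennreal (move_density x (w, y, False)) * h (x, (1 / s) *\<^sub>R (y - x))
        \<partial>P \<partial>std_gaussian \<partial>P)"
    unfolding nn_integral_moves_displacement[OF h]
    by (intro arg_cong2[where f = "(+)"]; subst PG.Fubini') auto
  also have "(\<integral>\<^sup>+ x. \<integral>\<^sup>+ w. ennreal (acc x w) * h (x, w) \<partial>std_gaussian \<partial>P) = (\<integral>\<^sup>+ x. 0 \<partial>P)"
  proof (rule nn_integral_cong_AE, use ae in eventually_elim)
    case (elim x)
    have "AE w in (std_gaussian :: (real ^ 'd) measure). (x, s *\<^sub>R w) \<notin> N"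
      using AE_lborel_affine[OF elim, of s 0] s_pos by (intro std_gaussian_absolutely_continuous) auto
    thus ?case
      by (subst nn_integral_0_iff_AE) (auto simp: h_def elim!: eventually_mono)
  qed
  also have "(\<integral>\<^sup>+ x. \<integral>\<^sup>+ w. \<integral>\<^sup>+ y. ennreal (move_density x (w, y, False)) * h (x, (1 / s) *\<^sub>R (y - x))
        \<partial>P \<partial>std_gaussian \<partial>P) = (\<integral>\<^sup>+ x. \<integral>\<^sup>+ w. 0 \<partial>(std_gaussian :: (real ^ 'd) measure) \<partial>P)"
  proof (rule nn_integral_cong_AE, use ae in eventually_elim)
    case (elim x)
    have "AE y in P. (x, y - x) \<notin> N"
      using AE_lborel_affine[OF elim, of 1 "- x"] by (intro P_absolutely_continuous) auto
    hence "(\<integral>\<^sup>+ y. ennreal (move_density x (w, y, False)) * h (x, (1 / s) *\<^sub>R (y - x)) \<partial>P) = 0" for w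
      using s_pos by (subst nn_integral_0_iff_AE) (auto simp: h_def elim!: eventually_mono)
    thus ?case by simp
  qed
  finally have "(\<integral>\<^sup>+ (x, v). h (x, displacement s x v) \<partial>moves) = 0" by simp
  moreover have [measurable]: "(\<lambda>(x, v). (x, s *\<^sub>R displacement s x v)) \<in> moves \<rightarrow>\<^sub>M borel \<Otimes>\<^sub>M borel"
    by (simp add: case_prod_unfold)
  ultimately show "N \<in> null_sets (distr moves (borel \<Otimes>\<^sub>M borel) (\<lambda>(x, v). (x, s *\<^sub>R displacement s x v)))"
    using N' by (simp add: null_sets_def h_def case_prod_unfold nn_integral_distr flip: nn_integral_indicator)
qed

lemma distr_moves_source: "distr moves borel fst = P"
  and distr_moves_target: "distr moves borel (\<lambda>(x, v). x + s *\<^sub>R displacement s x v) = P"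
proof -
  have m [measurable]: "(\<lambda>(x, v). x + s *\<^sub>R displacement s x v) \<in> borel_measurable moves"
    "fst \<in> borel_measurable moves"
    by (simp_all add: case_prod_unfold)
  show source: "distr moves borel fst = P"
  proof (rule measure_eqI)
    fix A assume "A \<in> sets (distr moves borel fst)"
    hence [measurable]: "A \<in> sets borel" by simp
    have "emeasure (distr moves borel fst) A = (\<integral>\<^sup>+ (x, w, _). indicator A x \<partial>moves)"
      by (simp add: case_prod_unfold nn_integral_distr flip: nn_integral_indicator)
    also have "\<dots> = (\<integral>\<^sup>+ x. \<integral>\<^sup>+ w. indicator A x \<partial>(std_gaussian :: (real ^ 'd) measure) \<partial>P)"
      using nn_integral_moves_fst[of "\<lambda>z. indicator A (fst z)"] by simp
    finally show "emeasure (distr moves borel fst) A = emeasure P A"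
      using G.emeasure_space_1 by simp
  qed simp
  have "distr moves borel (\<lambda>(x, v). x + s *\<^sub>R displacement s x v) = distr moves borel fst"
  proof (rule measure_eqI)
    fix A assume "A \<in> sets (distr moves borel (\<lambda>(x, v). x + s *\<^sub>R displacement s x v))"
    hence [measurable]: "A \<in> sets borel" by simp
    show "emeasure (distr moves borel (\<lambda>(x, v). x + s *\<^sub>R displacement s x v)) A =
        emeasure (distr moves borel fst) A"
      using nn_integral_moves_reversible[of "\<lambda>z. indicator A (fst z)"]
      by (simp add: case_prod_unfold nn_integral_distr flip: nn_integral_indicator)
  qed simp
  with source show "distr moves borel (\<lambda>(x, v). x + s *\<^sub>R displacement s x v) = P" by simp
qed

lemma measurable_moves_displacement [measurable]: "(\<lambda>(x, v). displacement s x v) \<in> borel_measurable moves"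
  by (simp add: case_prod_unfold)

text \<open>By reversibility the displacement is symmetric, so its exponential moment is a mean of
  hyperbolic cosines. These increase with the absolute value, and the coordinatewise domination by
  the Gaussian proposal carries over.\<close>

lemma nn_integral_exp_displacement:
  "(\<integral>\<^sup>+ (x, v). ennreal (exp (t * displacement s x v $ k)) \<partial>moves) \<le> ennreal (exp (t\<^sup>2 / 2))"
proof -
  define E where "E = (\<lambda>t. \<integral>\<^sup>+ (x, v). ennreal (exp (t * displacement s x v $ k)) \<partial>moves)"
  have sym: "E (- t) = E t"
    using nn_integral_moves_reversible[of "\<lambda>z. ennreal (exp (t * snd z $ k))"] by (simp add: E_def)
  have G: "(\<integral>\<^sup>+ (x, w, _). ennreal (exp (t * w $ k)) \<partial>moves) = ennreal (exp (t\<^sup>2 / 2))" for t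
    using nn_integral_moves_fst[of "\<lambda>z. ennreal (exp (t * snd z $ k))"] P.emeasure_space_1
    by (simp add: nn_integral_exp_std_gaussian)
  have "2 * E t = E t + E (- t)" by (simp add: sym mult_2)
  also have "\<dots> = (\<integral>\<^sup>+ (x, v). ennreal (exp (t * displacement s x v $ k) + exp (- t * displacement s x v $ k)) \<partial>moves)"
    unfolding E_def by (subst nn_integral_add[symmetric]) (auto simp: case_prod_unfold)
  also have "\<dots> \<le> (\<integral>\<^sup>+ (x, w, _). ennreal (exp (t * w $ k) + exp (- t * w $ k)) \<partial>moves)"
  proof (rule nn_integral_mono_AE, use AE_displacement_le in eventually_elim)
    case (elim z)
    obtain x w y b where z: "z = (x, w, y, b)" by (metis surj_pair)
    have "\<bar>t * displacement s x (w, y, b) $ k\<bar> \<le> \<bar>t * w $ k\<bar>"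
      using elim by (simp add: z abs_mult mult_left_mono)
    hence "cosh \<bar>t * displacement s x (w, y, b) $ k\<bar> \<le> cosh \<bar>t * w $ k\<bar>"
      by (subst cosh_real_nonneg_le_iff) auto
    hence "cosh (t * displacement s x (w, y, b) $ k) \<le> cosh (t * w $ k)"
      by (simp only: cosh_real_abs)
    thus ?case by (auto simp: z cosh_def simp del: ennreal_plus intro!: ennreal_leI)
  qed
  also have "\<dots> = (\<integral>\<^sup>+ (x, w, _). ennreal (exp (t * w $ k)) \<partial>moves) +
      (\<integral>\<^sup>+ (x, w, _). ennreal (exp (- t * w $ k)) \<partial>moves)"
    by (subst nn_integral_add[symmetric]) (auto simp: case_prod_unfold)
  also have "\<dots> = 2 * ennreal (exp (t\<^sup>2 / 2))" unfolding G by (simp add: mult_2)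
  finally show ?thesis
    unfolding E_def by (subst (asm) ennreal_mult_le_mult_iff) auto
qed

lemma sub_gaussian_coupling_moves:
  "sub_gaussian_coupling P (distr moves (borel \<Otimes>\<^sub>M borel) (\<lambda>(x, v). (x, displacement s x v)))"
  (is "sub_gaussian_coupling P ?Q")
proof -
  interpret moves: prob_space moves by (rule prob_space_moves)
  let ?d = "\<lambda>(x, v). displacement s x v"
  have [measurable]: "(\<lambda>(x, v). (x, displacement s x v)) \<in> moves \<rightarrow>\<^sub>M borel \<Otimes>\<^sub>M borel"
    by (simp add: case_prod_unfold)
  have exp_int: "integrable moves (\<lambda>z. exp (t * ?d z $ k))" for t k
    by (rule integrableI_bounded)
      (auto simp: case_prod_unfold intro: order.strict_trans1[OF nn_integral_exp_displacement[of t k, unfolded case_prod_unfold]])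
  have exp_le: "(\<integral>z. exp (t * ?d z $ k) \<partial>moves) \<le> exp (t\<^sup>2 / 2)" for t k
  proof -
    have "ennreal (\<integral>z. exp (t * ?d z $ k) \<partial>moves) = (\<integral>\<^sup>+ z. ennreal (exp (t * ?d z $ k)) \<partial>moves)"
      by (rule nn_integral_eq_integral[OF exp_int, symmetric]) simp
    also have "\<dots> \<le> ennreal (exp (t\<^sup>2 / 2))"
      using nn_integral_exp_displacement[of t k] by (simp add: case_prod_unfold)
    finally show ?thesis by simp
  qed
  have int: "integrable moves (\<lambda>z. ?d z $ k)" for k
  proof (rule Bochner_Integration.integrable_bound)
    show "integrable moves (\<lambda>z. exp (1 * ?d z $ k) + exp ((-1) * ?d z $ k))"
      by (intro Bochner_Integration.integrable_add exp_int)
    show "AE z in moves. norm (?d z $ k) \<le> norm (exp (1 * ?d z $ k) + exp ((-1) * ?d z $ k))"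
      using abs_le_exp_add_exp by (intro AE_I2) (simp add: abs_of_pos add_pos_pos)
  qed measurable
  have mean: "(\<integral>z. ?d z $ k \<partial>moves) = 0" for k
  proof -
    have "distr moves borel (\<lambda>z. - ?d z $ k) = distr moves borel (\<lambda>z. ?d z $ k)"
    proof (rule measure_eqI)
      fix A assume "A \<in> sets (distr moves borel (\<lambda>z. - ?d z $ k))"
      hence [measurable]: "A \<in> sets borel" by simp
      show "emeasure (distr moves borel (\<lambda>z. - ?d z $ k)) A = emeasure (distr moves borel (\<lambda>z. ?d z $ k)) A"
        using nn_integral_moves_reversible[of "\<lambda>z. indicator A (snd z $ k)"]
        by (simp add: case_prod_unfold nn_integral_distr flip: nn_integral_indicator)
    qed simp
    hence "(\<integral>y. y \<partial>distr moves borel (\<lambda>z. - ?d z $ k)) = (\<integral>y. y \<partial>distr moves borel (\<lambda>z. ?d z $ k))"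
      by simp
    thus ?thesis by (subst (asm) (1 2) integral_distr) auto
  qed
  have "distr ?Q borel fst = P"
    using distr_moves_source by (subst distr_distr) (auto simp: comp_def case_prod_unfold)
  moreover have "prob_space ?Q" by (rule moves.prob_space_distr) measurable
  moreover have meanQ: "(\<integral>z. snd z $ k \<partial>?Q) = 0" for k
    using mean[of k] by (subst integral_distr) (auto simp: case_prod_unfold)
  moreover have "sub_gamma_vec ?Q 1 0 snd"
    unfolding sub_gamma_vec_def sub_gamma_def meanQ
  proof (intro allI conjI impI)
    fix k t
    show "integrable ?Q (\<lambda>z. snd z $ k)"
      using int[of k] by (subst integrable_distr_eq) (auto simp: case_prod_unfold)
    show "integrable ?Q (\<lambda>z. exp (t * (snd z $ k - 0)))"
      using exp_int[of t k] by (subst integrable_distr_eq) (auto simp: case_prod_unfold)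
    have eq: "(\<integral>z. exp (t * (snd z $ k - 0)) \<partial>?Q) = (\<integral>z. exp (t * ?d z $ k) \<partial>moves)"
      by (subst integral_distr) (auto simp: case_prod_unfold)
    \<comment> \<open>The tangent of \<open>exp\<close> at 0 and the vanishing mean show that the
      moment is at least 1, so that \<open>ln\<close> is applied to a positive number.\<close>
    have "(\<integral>z. 1 + t * ?d z $ k \<partial>moves) \<le> (\<integral>z. exp (t * ?d z $ k) \<partial>moves)"
      using int exp_int by (intro integral_mono) auto
    also have "(\<integral>z. 1 + t * ?d z $ k \<partial>moves) = 1"
      using int[of k] mean[of k] by (simp add: moves.prob_space[unfolded space_moves])
    finally have "0 < (\<integral>z. exp (t * ?d z $ k) \<partial>moves)" by simp
    hence "ln (\<integral>z. exp (t * ?d z $ k) \<partial>moves) \<le> ln (exp (t\<^sup>2 / 2))"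
      using exp_le[of t k] by (subst ln_le_cancel_iff) auto
    thus "ln (\<integral>z. exp (t * (snd z $ k - 0)) \<partial>?Q) \<le> t\<^sup>2 * 1 / (2 * (1 - 0 * \<bar>t\<bar>))"
      unfolding eq by simp
  qed
  ultimately show ?thesis by (simp add: sub_gaussian_coupling_def)
qed

end

text \<open>The event that the packing number is at least \<open>m\<close>, with a finite witness,
  so that only maxima over finite families of Gaussian variables enter.\<close>

definition separated_event ::
    "'x measure \<Rightarrow> ('x \<Rightarrow> 's set) \<Rightarrow> ('x \<Rightarrow> 's \<Rightarrow> 's \<Rightarrow> real) \<Rightarrow> real \<Rightarrow> nat \<Rightarrow> 'x set" where
  "separated_event M N \<rho> a m = {x \<in> space M. \<exists>A \<subseteq> N x. finite A \<and> m \<le> card A \<and>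
     (\<forall>\<omega>\<in>A. \<forall>\<omega>'\<in>A. \<omega> \<noteq> \<omega>' \<longrightarrow> a < \<rho> x \<omega> \<omega>')}"

text \<open>Splitting a family of pairs undoes forming it, so the law of pairs given by
  \<open>distr_pair_PiM\<close> is pushed back to the product of the two families. The Taylor bound
  is stated for two families, the moves are independent as pairs.\<close>

lemma AE_split_pair_PiM:
  assumes "finite I" "product_sigma_finite M" "product_sigma_finite N"
    and "AE (x, y) in PiM I M \<Otimes>\<^sub>M PiM I N. Q x y"
  shows "AE z in PiM I (\<lambda>i. M i \<Otimes>\<^sub>M N i). Q (\<lambda>i\<in>I. fst (z i)) (\<lambda>i\<in>I. snd (z i))"
proof -
  let ?AB = "PiM I M \<Otimes>\<^sub>M PiM I N" and ?C = "PiM I (\<lambda>i. M i \<Otimes>\<^sub>M N i)"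
  let ?\<Phi> = "\<lambda>(x, y). \<lambda>i\<in>I. (x i, y i)"
  let ?\<Psi> = "\<lambda>z. (\<lambda>i\<in>I. fst (z i), \<lambda>i\<in>I. snd (z i))"
  have [measurable]: "?\<Phi> \<in> ?AB \<rightarrow>\<^sub>M ?C" "?\<Psi> \<in> ?C \<rightarrow>\<^sub>M ?AB" by measurable
  have id: "?\<Psi> (?\<Phi> p) = p" if "p \<in> space ?AB" for p
    using that by (auto simp: space_pair_measure space_PiM PiE_def extensional_def fun_eq_iff)
  have "distr ?C ?AB ?\<Psi> = distr (distr ?AB ?C ?\<Phi>) ?AB ?\<Psi>"
    using distr_pair_PiM[OF assms(1-3)] by simp
  also have "\<dots> = distr ?AB ?AB (?\<Psi> \<circ> ?\<Phi>)"
    by (rule distr_distr) measurable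
  also have "\<dots> = distr ?AB ?AB (\<lambda>p. p)"
    by (rule distr_cong) (simp_all only: comp_apply id)
  finally have eq: "distr ?C ?AB ?\<Psi> = ?AB" by simp
  have "AE p in distr ?C ?AB ?\<Psi>. case p of (x, y) \<Rightarrow> Q x y"
    unfolding eq by (rule assms(4))
  from AE_distrD[OF _ this] show ?thesis by simp
qed

section \<open>Independent moves of all inputs, and conditioning on the inputs\<close>

context proposal
begin

context
  fixes I :: "'i set"
  assumes finite_I: "finite I"
begin

definition joint_density where
  "joint_density = (\<lambda>(x, v). \<Prod>i\<in>I. move_density (x i) (v i))"

text \<open>The starts and the auxiliary variables form two separate families, so that conditioning
  on the inputs is Fubini for the outer product; \<open>distr_joint\<close> recovers the independent
  moves.\<close>

definition joint where
  "joint = density (PiM I (\<lambda>_. P) \<Otimes>\<^sub>M PiM I (\<lambda>_. aux)) (\<lambda>z. ennreal (joint_density z))"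

lemma joint_density_nonneg: "0 \<le> joint_density z"
  unfolding joint_density_def by (auto simp: split_beta intro!: prod_nonneg move_density_nonneg)

lemma measurable_joint_density [measurable]:
  "joint_density \<in> borel_measurable (PiM I (\<lambda>_. P) \<Otimes>\<^sub>M PiM I (\<lambda>_. aux))"
  unfolding joint_density_def split_beta
  by (intro borel_measurable_prod measurable_move_density) measurable

lemma sets_joint [measurable_cong]: "sets joint = sets (PiM I (\<lambda>_. P) \<Otimes>\<^sub>M PiM I (\<lambda>_. aux))"
  by (simp add: joint_def)

lemma space_joint: "space joint = space (PiM I (\<lambda>_. P)) \<times> space (PiM I (\<lambda>_. aux))"
  by (simp add: joint_def space_pair_measure)

text \<open>The density is a product over \<open>I\<close>, so collecting the coordinates into pairs
  gives a product of copies of \<open>moves\<close>, and a map acting coordinatewise preserves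
  products.\<close>

lemma distr_joint:
  assumes T [measurable]: "T \<in> P \<Otimes>\<^sub>M aux \<rightarrow>\<^sub>M C"
  shows "distr joint (PiM I (\<lambda>_. C)) (\<lambda>(x, v). \<lambda>i\<in>I. T (x i, v i)) = PiM I (\<lambda>_. distr moves C T)"
proof -
  let ?C = "PiM I (\<lambda>_. P \<Otimes>\<^sub>M aux)"
  let ?\<Phi> = "\<lambda>(x, v). \<lambda>i\<in>I. (x i, v i) :: (real ^ 'd) \<times> (real ^ 'd) \<times> (real ^ 'd) \<times> bool"
  let ?D = "\<lambda>z. \<Prod>i\<in>I. ennreal (case z i of (x, v) \<Rightarrow> move_density x v)"
  have \<Phi> [measurable]: "?\<Phi> \<in> PiM I (\<lambda>_. P) \<Otimes>\<^sub>M PiM I (\<lambda>_. aux) \<rightarrow>\<^sub>M ?C" by measurable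
  have Dm: "(\<lambda>(x, v). ennreal (move_density x v)) \<in> borel_measurable (P \<Otimes>\<^sub>M aux)"
    by (simp add: case_prod_unfold)
  have D [measurable]: "?D \<in> borel_measurable ?C"
    unfolding case_prod_unfold by measurable
  have psf: "product_sigma_finite (\<lambda>_. P \<Otimes>\<^sub>M aux)"
    by (intro product_sigma_finite_const sigma_finite_pair_measure P.sigma_finite_measure_axioms sigma_finite_aux)
  have pr: "prob_space (density (P \<Otimes>\<^sub>M aux) (\<lambda>p. ennreal (move_density (fst p) (snd p))))"
    using prob_space_moves by (simp add: moves_def case_prod_unfold)
  have "distr joint ?C ?\<Phi> = distr (density (PiM I (\<lambda>_. P) \<Otimes>\<^sub>M PiM I (\<lambda>_. aux)) (\<lambda>z. ?D (?\<Phi> z))) ?C ?\<Phi>"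
    unfolding joint_def joint_density_def
    by (intro distr_cong arg_cong2[where f = density])
      (auto simp: prod_ennreal[symmetric] move_density_nonneg fun_eq_iff)
  also have "\<dots> = density (distr (PiM I (\<lambda>_. P) \<Otimes>\<^sub>M PiM I (\<lambda>_. aux)) ?C ?\<Phi>) ?D"
    by (rule density_distr[symmetric]) measurable
  also have "\<dots> = density ?C ?D"
    by (subst distr_pair_PiM)
      (simp_all add: finite_I product_sigma_finite_const P.sigma_finite_measure_axioms sigma_finite_aux)
  also have "\<dots> = PiM I (\<lambda>_. moves)"
    unfolding moves_def
    by (subst PiM_density[symmetric])
      (use Dm psf finite_I pr in \<open>auto simp: case_prod_unfold
        intro!: product_sigma_finite_const prob_space_imp_sigma_finite\<close>)
  finally have eq: "distr joint ?C ?\<Phi> = PiM I (\<lambda>_. moves)" .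
  have Tm: "T \<in> moves \<rightarrow>\<^sub>M C" by simp
  \<comment> \<open>Only the \<sigma>-algebra of \<open>C\<close> matters here. It is replaced by
    the image law, a probability measure, as the product rule below asks.\<close>
  have "PiM I (\<lambda>_. distr moves C T) = PiM I (\<lambda>_. distr moves (distr moves C T) T)"
    by (intro PiM_cong refl distr_cong) auto
  also have "\<dots> = distr (PiM I (\<lambda>_. moves)) (PiM I (\<lambda>_. distr moves C T)) (compose I T)"
    by (rule distr_PiM_finite_prob_space'[symmetric])
      (auto simp: finite_I prob_space_moves intro!: prob_space.prob_space_distr)
  also have "\<dots> = distr (distr joint ?C ?\<Phi>) (PiM I (\<lambda>_. C)) (compose I T)"
    unfolding eq by (intro distr_cong refl sets_PiM_cong) auto
  also have "\<dots> = distr joint (PiM I (\<lambda>_. C)) (compose I T \<circ> ?\<Phi>)"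
    by (rule distr_distr) (unfold compose_def, measurable)
  also have "compose I T \<circ> ?\<Phi> = (\<lambda>(x, v). \<lambda>i\<in>I. T (x i, v i))"
    by (auto simp: fun_eq_iff compose_def)
  finally show ?thesis ..
qed

lemma measurable_joint [measurable (raw)]:
  assumes [measurable]: "T \<in> P \<Otimes>\<^sub>M aux \<rightarrow>\<^sub>M C"
  shows "(\<lambda>(x, v). \<lambda>i\<in>I. T (x i, v i)) \<in> joint \<rightarrow>\<^sub>M PiM I (\<lambda>_. C)"
  by measurable

text \<open>The kernel is known to be a probability measure only for almost every \<open>x\<close>;
  a finite-valued density suffices to form products for all \<open>x\<close>.\<close>

lemma sigma_finite_kernel: "sigma_finite_measure (density aux (\<lambda>v. ennreal (move_density x v)))"
  by (subst aux.sigma_finite_iff_density_finite) auto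

lemma sigma_finite_PiM_aux: "sigma_finite_measure (PiM I (\<lambda>_. aux))"
proof -
  interpret product_sigma_finite "\<lambda>_ :: 'i. aux"
    by (rule product_sigma_finite_const[OF sigma_finite_aux])
  show ?thesis by (rule sigma_finite[OF finite_I])
qed

text \<open>The conditional density factors over \<open>I\<close>, and each factor has a Gaussian
  first marginal outside a null set of starts. This gives the minoration exactly independent
  Gaussian vectors for fixed inputs.\<close>

lemma AE_distr_kernel:
  "AE x in PiM I (\<lambda>_. P).
    distr (density (PiM I (\<lambda>_. aux)) (\<lambda>v. ennreal (joint_density (x, v)))) (gauss_product I)
      (\<lambda>v. \<lambda>i\<in>I. fst (v i)) = gauss_product I"
proof -
  let ?K = "\<lambda>x. density aux (\<lambda>v. ennreal (move_density x v))"
  have [measurable]: "fst \<in> borel_measurable aux" "fst \<in> aux \<rightarrow>\<^sub>M std_gaussian" by measurable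
  have "AE x in P. distr (?K x) std_gaussian fst = std_gaussian"
    using AE_kernel_fst
  proof eventually_elim
    case (elim x)
    show ?case
    proof (rule measure_eqI)
      fix A assume "A \<in> sets (distr (?K x) std_gaussian fst)"
      hence [measurable]: "A \<in> sets borel" by simp
      have "emeasure (distr (?K x) std_gaussian fst) A =
          (\<integral>\<^sup>+ v. ennreal (move_density x v) * indicator A (fst v) \<partial>aux)"
        by (simp add: nn_integral_distr nn_integral_density flip: nn_integral_indicator)
      also have "\<dots> = (\<integral>\<^sup>+ w. indicator A w \<partial>std_gaussian)"
        using elim by (rule bspec) measurable
      finally show "emeasure (distr (?K x) std_gaussian fst) A = emeasure std_gaussian A"
        by simp
    qed simp
  qed
  hence "AE x in PiM I (\<lambda>_. P). \<forall>i\<in>I. distr (?K (x i)) std_gaussian fst = std_gaussian"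
    using finite_I by (intro AE_finite_allI AE_PiM_component) (auto intro: prob_P)
  thus ?thesis
  proof eventually_elim
    case (elim x)
    have pr: "prob_space (?K (x i))" if "i \<in> I" for i
      using elim that G.prob_space_axioms prob_space_distrD[of fst "?K (x i)" std_gaussian] by auto
    have "density (PiM I (\<lambda>_. aux)) (\<lambda>v. ennreal (joint_density (x, v))) = PiM I (\<lambda>i. ?K (x i))"
      by (subst PiM_density[symmetric])
        (auto simp: finite_I joint_density_def prod_ennreal move_density_nonneg
          product_sigma_finite_def sigma_finite_aux sigma_finite_kernel)
    hence "distr (density (PiM I (\<lambda>_. aux)) (\<lambda>v. ennreal (joint_density (x, v)))) (gauss_product I)
        (\<lambda>v. \<lambda>i\<in>I. fst (v i)) = distr (PiM I (\<lambda>i. ?K (x i))) (gauss_product I) (compose I fst)"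
      by (simp add: compose_def[abs_def])
    also have "\<dots> = PiM I (\<lambda>i. distr (?K (x i)) std_gaussian fst)"
      by (rule distr_PiM_finite_prob_space') (auto simp: finite_I pr G.prob_space_axioms)
    also have "\<dots> = gauss_product I"
      using elim by (intro PiM_cong) auto
    finally show ?case .
  qed
qed

text \<open>\<open>G\<close> is the conditional mean of \<open>g\<close> given the inputs. For fixed
  inputs \<open>g\<close> dominates the maximum over any finite subset of \<open>N x\<close>: a well
  separated subset forces \<open>B * a \<le> G x\<close>, and a single point forces
  \<open>0 \<le> G x\<close>. Markov's inequality for \<open>G\<close> gives the bound.\<close>

lemma outer_measure_packing_le:
  fixes N :: "('i \<Rightarrow> real ^ 'd) \<Rightarrow> 's set" and H :: "'i \<Rightarrow> ('i \<Rightarrow> real ^ 'd) \<Rightarrow> 's \<Rightarrow> real ^ 'd"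
  assumes g: "integrable joint g"
    and bound: "AE (x, v) in joint. \<forall>\<omega>\<in>N x. pairing I (\<lambda>i. - H i x \<omega>) (\<lambda>i. fst (v i)) \<le> g (x, v)"
    and nonempty: "AE x in PiM I (\<lambda>_. P). N x \<noteq> {}"
    and B: "0 < B" and a: "0 < a" and M: "4 * exp ((512 * B\<^sup>2)\<^sup>2) \<le> real M"
  shows "outer_measure_of (PiM I (\<lambda>_. P)) (separated_event (PiM I (\<lambda>_. P)) N (gradient_dist I H) a M) \<le>
    ennreal ((\<integral>z. g z \<partial>joint) / (B * a))"
    (is "outer_measure_of ?A ?S \<le> _")
proof -
  let ?B = "PiM I (\<lambda>_. aux)"
  have psA: "prob_space ?A" by (intro prob_space_PiM prob_P)
  interpret A: prob_space ?A by fact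
  interpret Bs: sigma_finite_measure ?B by (rule sigma_finite_PiM_aux)
  interpret AB: pair_sigma_finite ?A ?B ..
  have [measurable]: "g \<in> borel_measurable joint" using g by auto
  hence gm [measurable]: "g \<in> borel_measurable (?A \<Otimes>\<^sub>M ?B)" by simp
  define G where "G = (\<lambda>x. \<integral>v. joint_density (x, v) * g (x, v) \<partial>?B)"
  have int: "integrable (?A \<Otimes>\<^sub>M ?B) (\<lambda>z. joint_density z * g z)"
    using g unfolding joint_def by (subst (asm) integrable_density) (auto simp: joint_density_nonneg)
  have Gint: "integrable ?A G"
    unfolding G_def using AB.integrable_fst'[OF int] by simp
  have G_eq: "(\<integral>x. G x \<partial>?A) = (\<integral>z. g z \<partial>joint)"
    unfolding G_def joint_def using AB.integral_fst'[OF int]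
    by (subst integral_density) (auto simp: joint_density_nonneg)
  have "AE z in ?A \<Otimes>\<^sub>M ?B. 0 < joint_density z \<longrightarrow>
      (\<forall>\<omega>\<in>N (fst z). pairing I (\<lambda>i. - H i (fst z) \<omega>) (\<lambda>i. fst (snd z i)) \<le> g z)"
    using bound unfolding joint_def by (subst (asm) AE_density) (auto simp: case_prod_unfold)
  from AB.AE_pair[OF this] AB.AE_integrable_fst'[OF int] AE_distr_kernel nonempty
  have good: "AE x in ?A. 0 \<le> G x \<and> (x \<in> ?S \<longrightarrow> B * a \<le> G x)"
  proof eventually_elim
    case (elim x)
    have le: "(\<integral>w. \<phi> w \<partial>gauss_product I) \<le> G x"
      if \<phi>: "integrable (gauss_product I) \<phi>"
        and A: "\<phi> = (\<lambda>w. Max ((\<lambda>\<omega>. pairing I (\<lambda>i. - H i x \<omega>) w) ` A))"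
          "finite A" "A \<noteq> {}" "A \<subseteq> N x" for \<phi> A
    proof -
      have [measurable]: "\<phi> \<in> borel_measurable (gauss_product I)" using \<phi> by auto
      have [measurable]: "(\<lambda>v. \<lambda>i\<in>I. fst (v i)) \<in> ?B \<rightarrow>\<^sub>M gauss_product I" by measurable
      have [measurable]: "(\<lambda>v. joint_density (x, v)) \<in> borel_measurable ?B"
        unfolding joint_density_def by simp
      have "integrable (distr (density ?B (\<lambda>v. ennreal (joint_density (x, v)))) (gauss_product I)
          (\<lambda>v. \<lambda>i\<in>I. fst (v i))) \<phi>"
        using \<phi> elim(3) by simp
      hence i: "integrable ?B (\<lambda>v. joint_density (x, v) * \<phi> (\<lambda>i\<in>I. fst (v i)))"
        by (subst (asm) integrable_distr_eq) (auto simp: integrable_density joint_density_nonneg)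
      have "(\<integral>w. \<phi> w \<partial>gauss_product I) =
        (\<integral>w. \<phi> w \<partial>distr (density ?B (\<lambda>v. ennreal (joint_density (x, v)))) (gauss_product I) (\<lambda>v. \<lambda>i\<in>I. fst (v i)))"
        using elim(3) by simp
      also have "\<dots> = (\<integral>v. joint_density (x, v) * \<phi> (\<lambda>i\<in>I. fst (v i)) \<partial>?B)"
        by (subst integral_distr) (auto simp: integral_density joint_density_nonneg)
      also have "\<dots> \<le> G x"
        unfolding G_def
      proof (rule integral_mono_AE[OF i])
        show "integrable ?B (\<lambda>v. joint_density (x, v) * g (x, v))" using elim(2) by simp
        show "AE v in ?B. joint_density (x, v) * \<phi> (\<lambda>i\<in>I. fst (v i)) \<le> joint_density (x, v) * g (x, v)"
          using elim(1)
        proof eventually_elim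
          case (elim v)
          show ?case
          \<comment> \<open>The bound by \<open>g\<close> is available only where the density is
            positive; elsewhere both sides are 0.\<close>
          proof (cases "joint_density (x, v) = 0")
            case False
            hence "0 < joint_density (x, v)" using joint_density_nonneg[of "(x, v)"] by simp
            with elim A have "\<phi> (\<lambda>i\<in>I. fst (v i)) \<le> g (x, v)"
              by (auto simp: pairing_restrict)
            thus ?thesis by (intro mult_left_mono joint_density_nonneg)
          qed simp
        qed
      qed
      finally show ?thesis .
    qed
    have max_int: "integrable (gauss_product I) (\<lambda>w. Max ((\<lambda>\<omega>. pairing I (\<lambda>i. - H i x \<omega>) w) ` A))"
      if "finite A" "A \<noteq> {}" for A :: "'s set"
      using that
    proof (induction A rule: finite_ne_induct)
      case (insert \<omega> A)
      thus ?case
        by (simp add: Max_insert integrable_pairing[OF finite_I])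
    qed (simp add: integrable_pairing[OF finite_I])
    \<comment> \<open>A maximum over one point has Gaussian mean 0. Hence \<open>G\<close> is
      nonnegative almost everywhere, as Markov's inequality requires.\<close>
    obtain \<omega>0 where "\<omega>0 \<in> N x" using elim(4) by auto
    hence "(\<integral>w. Max ((\<lambda>\<omega>. pairing I (\<lambda>i. - H i x \<omega>) w) ` {\<omega>0}) \<partial>gauss_product I) \<le> G x"
      by (intro le[OF max_int refl]) auto
    moreover have "(\<integral>w. pairing I (\<lambda>i. - H i x \<omega>0) w \<partial>gauss_product I) = 0"
      by (rule integral_pairing[OF finite_I])
    ultimately have "0 \<le> G x" by simp
    moreover have "B * a \<le> G x" if xS: "x \<in> ?S"
    proof -
      from xS obtain A where A: "A \<subseteq> N x" "finite A" "M \<le> card A"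
        and sep: "\<forall>\<omega>\<in>A. \<forall>\<omega>'\<in>A. \<omega> \<noteq> \<omega>' \<longrightarrow> a < gradient_dist I H x \<omega> \<omega>'"
        unfolding separated_event_def mem_Collect_eq by (elim conjE exE)
      have "0 < real M" by (rule order.strict_trans2[OF _ M]) simp
      hence "A \<noteq> {}" using A by auto
      have "B * a \<le> (\<integral>w. Max ((\<lambda>\<omega>. pairing I (\<lambda>i. - H i x \<omega>) w) ` A) \<partial>gauss_product I)"
      proof (rule gauss_product_max_ge_separation[OF finite_I \<open>finite A\<close> _ B a])
        show "4 * exp ((512 * B\<^sup>2)\<^sup>2) \<le> real (card A)" using M A(3) by simp
        fix \<omega> \<omega>' assume "\<omega> \<in> A" "\<omega>' \<in> A" "\<omega> \<noteq> \<omega>'"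
        hence "a < gradient_dist I H x \<omega> \<omega>'" using sep by simp
        hence "a\<^sup>2 \<le> (gradient_dist I H x \<omega> \<omega>')\<^sup>2" using a by (intro power_mono) auto
        also have "\<dots> = pairing I (\<lambda>i. - H i x \<omega> - - H i x \<omega>') (\<lambda>i. - H i x \<omega> - - H i x \<omega>')"
          unfolding gradient_dist_def pairing_def
          by (subst real_sqrt_pow2)
            (auto intro!: sum_nonneg, auto intro!: sum.cong simp: power2_norm_eq_inner inner_simps inner_commute)
        finally show "a\<^sup>2 \<le> \<dots>" .
      qed (use max_int A \<open>A \<noteq> {}\<close> in auto)
      also have "\<dots> \<le> G x" using A \<open>A \<noteq> {}\<close> by (intro le[OF max_int refl]) auto
      finally show ?thesis .
    qed
    ultimately show ?case by blast
  qed
  have [measurable]: "G \<in> borel_measurable ?A" using Gint by auto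
  \<comment> \<open>The event need not be measurable. It lies in the measurable set where
    \<open>G\<close> is large, enlarged by a null set.\<close>
  obtain Z where Z: "{x \<in> space ?A. \<not> (0 \<le> G x \<and> (x \<in> ?S \<longrightarrow> B * a \<le> G x))} \<subseteq> Z" "Z \<in> null_sets ?A"
    using good unfolding eventually_ae_filter by blast
  have "outer_measure_of ?A ?S \<le> outer_measure_of ?A ({x \<in> space ?A. B * a \<le> G x} \<union> Z)"
    using Z(1) by (intro outer_measure_of_mono) (auto simp: separated_event_def)
  also have "\<dots> = emeasure ?A ({x \<in> space ?A. B * a \<le> G x} \<union> Z)"
    using Z(2) by (intro outer_measure_of_eq) auto
  also have "\<dots> = emeasure ?A {x \<in> space ?A. B * a \<le> G x}"
    using Z(2) by (intro emeasure_Un_null_set) auto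
  also have "\<dots> \<le> ennreal (1 / (B * a) * (\<integral>x. G x \<partial>?A))"
    using good B a Gint by (intro integral_Markov_inequality) (auto elim: eventually_mono)
  finally show ?thesis by (simp add: G_eq)
qed

end
end

subsection \<open>Measurable majorants\<close>

lemma ennpowr_ennreal: "0 \<le> b \<Longrightarrow> ennpowr (ennreal b) r = ennreal (b powr r)"
  by (simp add: ennpowr_def)

lemma ennpowr_le_iff:
  assumes "0 < r" "0 \<le> c"
  shows "ennpowr a r \<le> ennreal c \<longleftrightarrow> a \<le> ennreal (c powr (1 / r))"
proof (cases a)
  case (real b)
  have "b powr r \<le> c \<longleftrightarrow> b \<le> c powr (1 / r)"
  proof
    assume "b powr r \<le> c"
    hence "(b powr r) powr (1 / r) \<le> c powr (1 / r)" using assms by (intro powr_mono2) auto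
    thus "b \<le> c powr (1 / r)" using assms real by (simp add: powr_powr)
  next
    assume "b \<le> c powr (1 / r)"
    hence "b powr r \<le> (c powr (1 / r)) powr r" using assms real by (intro powr_mono2) auto
    thus "b powr r \<le> c" using assms by (simp add: powr_powr)
  qed
  thus ?thesis using real assms by (simp add: ennpowr_ennreal)
qed (simp add: ennpowr_def top_unique)

lemma le_ennpowr_iff:
  assumes "0 < r"
  shows "ennpowr a r \<le> b \<longleftrightarrow> a \<le> ennpowr b (1 / r)"
proof (cases b)
  case (real c)
  thus ?thesis using assms by (simp add: ennpowr_le_iff ennpowr_ennreal)
qed (simp add: ennpowr_def)

text \<open>Young's inequality with constant 1: both factors are at most powers of
  \<open>max x y\<close>, whose exponents add up to 1.\<close>

lemma powr_conjugate_le: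
  fixes x y p q :: real
  assumes "0 < p" "0 < q" "1 / p + 1 / q = 1" "0 \<le> x" "0 \<le> y"
  shows "x powr (1 / p) * y powr (1 / q) \<le> x + y"
proof -
  let ?m = "max x y"
  have "x powr (1 / p) * y powr (1 / q) \<le> ?m powr (1 / p) * ?m powr (1 / q)"
    using assms by (intro mult_mono powr_mono2) auto
  also have "\<dots> = ?m"
    using assms by (simp add: powr_add[symmetric])
  finally show ?thesis using assms by simp
qed

lemma ennpowr_conjugate_le:
  assumes "0 < p" "0 < q" "1 / p + 1 / q = 1"
  shows "ennpowr x (1 / p) * ennpowr y (1 / q) \<le> x + y"
proof (cases "x = \<top> \<or> y = \<top>")
  case False
  then obtain a b where "x = ennreal a" "0 \<le> a" "y = ennreal b" "0 \<le> b"
    by (metis ennreal_cases)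
  thus ?thesis
    using powr_conjugate_le[OF assms, of a b]
    by (simp add: ennpowr_ennreal ennreal_mult[symmetric] ennreal_plus[symmetric] del: ennreal_plus)
qed auto

lemma mult_le_powr_conjugate:
  fixes x y :: real
  assumes "0 < l" "0 \<le> x" "0 \<le> y"
  shows "x * y \<le> x powr (1 + l) + y powr ((1 + l) / l)"
proof -
  have "(x powr (1 + l)) powr (1 / (1 + l)) * (y powr ((1 + l) / l)) powr (1 / ((1 + l) / l)) \<le>
      x powr (1 + l) + y powr ((1 + l) / l)"
    using assms by (intro powr_conjugate_le) (auto simp: field_simps)
  thus ?thesis using assms by (simp add: powr_powr)
qed

text \<open>The infimum is only approached, so a slightly larger constant buys a measurable
  majorant.\<close>

lemma outer_nn_integral_majorant:
  assumes "outer_nn_integral M F \<le> ennreal c" "0 \<le> c" "c < c'"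
  obtains g where "g \<in> borel_measurable M" "\<And>x. x \<in> space M \<Longrightarrow> F x \<le> g x"
    "(\<integral>\<^sup>+ x. g x \<partial>M) \<le> ennreal c'"
proof -
  have "outer_nn_integral M F < ennreal c'"
    using assms by (intro order.strict_trans1[OF assms(1)]) (auto simp: ennreal_lessI)
  then obtain g where "g \<in> borel_measurable M" "\<forall>x\<in>space M. F x \<le> g x" "(\<integral>\<^sup>+ x. g x \<partial>M) < ennreal c'"
    unfolding outer_nn_integral_def by (auto simp: INF_less_iff)
  thus ?thesis by (intro that[of g]) auto
qed

text \<open>The exceptional null set is encoded by a function that is infinite there and has
  integral 0. Exponent \<infinity> thus yields a pointwise bound everywhere, just as finite
  exponents do.\<close>

lemma outer_esssup_majorant:
  assumes "outer_esssup M F \<le> ennreal c" "0 \<le> c" "c < c'"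
  obtains u where "u \<in> borel_measurable M" "(\<integral>\<^sup>+ x. u x \<partial>M) = 0"
    "\<And>x. x \<in> space M \<Longrightarrow> F x \<le> ennreal c' \<or> u x = \<top>"
proof -
  have "outer_esssup M F < ennreal c'"
    using assms by (intro order.strict_trans1[OF assms(1)]) (auto simp: ennreal_lessI)
  then obtain d where "AE x in M. F x \<le> d" "d < ennreal c'"
    unfolding outer_esssup_def by (auto simp: Inf_less_iff)
  hence "AE x in M. F x \<le> ennreal c'" by (auto elim!: eventually_mono)
  then obtain N where N: "N \<in> null_sets M" "{x \<in> space M. \<not> F x \<le> ennreal c'} \<subseteq> N"
    unfolding eventually_ae_filter by blast
  show ?thesis
  proof (rule that)
    show "(\<lambda>x. \<top> * indicator N x :: ennreal) \<in> borel_measurable M"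
      using N(1) by (intro borel_measurable_times_ennreal borel_measurable_indicator) auto
    show "(\<integral>\<^sup>+ x. \<top> * indicator N x \<partial>M) = 0"
      using N(1) by (subst nn_integral_cmult_indicator) auto
    show "F x \<le> ennreal c' \<or> \<top> * indicator N x = (\<top> :: ennreal)" if "x \<in> space M" for x
      using N(2) that by (cases "x \<in> N") auto
  qed
qed

text \<open>Normalising by \<open>a powr - p\<close> takes the scale out of the majorant, whose
  integral is then bounded independently of the problem index.\<close>

lemma Lp_norm_majorant:
  assumes "Lp_norm M (ennreal p) F \<le> ennreal (C * a)" "0 < p" "0 \<le> C" "0 < a"
  obtains u where "u \<in> borel_measurable M" "(\<integral>\<^sup>+ x. u x \<partial>M) \<le> ennreal ((C + 1) powr p)"
    "\<And>x. x \<in> space M \<Longrightarrow> F x \<le> ennreal a * ennpowr (u x) (1 / p)"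
proof -
  have o: "outer_nn_integral M (\<lambda>x. ennpowr (F x) p) \<le> ennreal ((C * a) powr p)"
    using assms by (simp add: Lp_norm_def ennpowr_le_iff)
  have lt: "(C * a) powr p < ((C + 1) * a) powr p"
    using assms by (intro powr_less_mono2) auto
  obtain g where g [measurable]: "g \<in> borel_measurable M"
    and le: "\<And>x. x \<in> space M \<Longrightarrow> ennpowr (F x) p \<le> g x"
    and int: "(\<integral>\<^sup>+ x. g x \<partial>M) \<le> ennreal (((C + 1) * a) powr p)"
    by (rule outer_nn_integral_majorant[OF o _ lt]) auto
  define u where "u = (\<lambda>x. ennreal (a powr - p) * g x)"
  show ?thesis
  proof (rule that)
    show "u \<in> borel_measurable M" unfolding u_def by measurable
    have "(\<integral>\<^sup>+ x. u x \<partial>M) \<le> ennreal (a powr - p) * ennreal (((C + 1) * a) powr p)"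
      unfolding u_def using int by (subst nn_integral_cmult) (auto intro: mult_left_mono)
    also have "\<dots> = ennreal ((C + 1) powr p)"
      using assms by (simp add: ennreal_mult[symmetric] powr_mult powr_minus del: distrib_right)
    finally show "(\<integral>\<^sup>+ x. u x \<partial>M) \<le> ennreal ((C + 1) powr p)" .
    fix x assume "x \<in> space M"
    hence "F x \<le> ennpowr (g x) (1 / p)" using le assms by (simp add: le_ennpowr_iff)
    also have "\<dots> = ennreal a * ennpowr (u x) (1 / p)"
    proof (cases "g x")
      case (real b)
      have "a * (a powr - p) powr (1 / p) = 1"
        using assms by (simp add: powr_powr powr_neg_one)
      hence "a * ((a powr - p * b) powr (1 / p)) = b powr (1 / p)"
        using real by (simp add: powr_mult mult.assoc[symmetric])
      thus ?thesis
        using assms real by (simp add: u_def ennpowr_ennreal ennreal_mult[symmetric])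
    next
      case top
      thus ?thesis using assms by (simp add: u_def ennpowr_def ennreal_mult_top)
    qed
    finally show "F x \<le> ennreal a * ennpowr (u x) (1 / p)" .
  qed
qed

text \<open>One bound for all cases of \<open>Lp_norm_product_majorant\<close>: the square serves
  when \<open>\<gamma>\<close> is 0 or infinite, the two powers otherwise.\<close>

definition moment_const :: "real \<Rightarrow> ennreal \<Rightarrow> real" where
  "moment_const C \<gamma> = (C + 1)\<^sup>2 + (C + 1) powr (1 + 1 / enn2real \<gamma>) + (C + 1) powr (1 + enn2real \<gamma>)"

lemma moment_const_nonneg: "0 \<le> moment_const C \<gamma>"
  unfolding moment_const_def by (intro add_nonneg_nonneg) auto

text \<open>An additive substitute for Hoelder's inequality. The two factors will be evaluated at
  the original and at the moved inputs, which are dependent; a sum needs only the two marginal laws,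
  while a product would need the joint one.\<close>

lemma Lp_norm_product_majorant:
  assumes F: "Lp_norm M1 (1 + 1 / \<gamma>) F \<le> ennreal (C * a)"
    and G: "Lp_norm M2 (1 + \<gamma>) G \<le> ennreal (C * b)"
    and C: "0 \<le> C" and a: "0 < a" and b: "0 < b"
  obtains u v where "u \<in> borel_measurable M1" "v \<in> borel_measurable M2"
    "(\<integral>\<^sup>+ x. u x \<partial>M1) \<le> ennreal (moment_const C \<gamma>)" "(\<integral>\<^sup>+ x. v x \<partial>M2) \<le> ennreal (moment_const C \<gamma>)"
    "\<And>x y. x \<in> space M1 \<Longrightarrow> y \<in> space M2 \<Longrightarrow> F x * G y \<le> ennreal (a * b) * (u x + v y)"
proof -
  \<comment> \<open>The exponents \<infinity> and 1, stated for arbitrary functions so that the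
    roles of \<open>F\<close> and \<open>G\<close> can be exchanged between the two extreme values
    of \<open>\<gamma>\<close>.\<close>
  have mixed: thesis
    if c: "c > 0" and d: "d > 0" and F': "outer_esssup M F' \<le> ennreal (C * c)"
      and G': "Lp_norm M' (ennreal 1) G' \<le> ennreal (C * d)"
      and *: "\<And>u v. u \<in> borel_measurable M \<Longrightarrow> v \<in> borel_measurable M' \<Longrightarrow>
        (\<integral>\<^sup>+ x. u x \<partial>M) \<le> ennreal (moment_const C \<gamma>) \<Longrightarrow> (\<integral>\<^sup>+ x. v x \<partial>M') \<le> ennreal (moment_const C \<gamma>) \<Longrightarrow>
        (\<And>x y. x \<in> space M \<Longrightarrow> y \<in> space M' \<Longrightarrow> F' x * G' y \<le> ennreal (c * d) * (u x + v y)) \<Longrightarrow> thesis"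
    for c d thesis and F' :: "'x \<Rightarrow> ennreal" and G' :: "'y \<Rightarrow> ennreal" and M M'
  proof -
    obtain u where u: "u \<in> borel_measurable M" "(\<integral>\<^sup>+ x. u x \<partial>M) = 0"
      "\<And>x. x \<in> space M \<Longrightarrow> F' x \<le> ennreal ((C + 1) * c) \<or> u x = \<top>"
      using F' by (rule outer_esssup_majorant[where c' = "(C + 1) * c"]) (use C c d in auto)
    obtain v where v: "v \<in> borel_measurable M'" "(\<integral>\<^sup>+ x. v x \<partial>M') \<le> ennreal ((C + 1) powr 1)"
      "\<And>x. x \<in> space M' \<Longrightarrow> G' x \<le> ennreal d * ennpowr (v x) (1 / 1)"
      using G' by (rule Lp_norm_majorant) (use C c d in auto)
    have p1: "ennpowr z 1 = z" for z
      by (cases z) (auto simp: ennpowr_def)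
    show thesis
    \<comment> \<open>The essential bound contributes a factor \<open>C + 1\<close>, which is moved
      into the second majorant and leads to the square in \<open>moment_const\<close>.\<close>
    proof (rule *[of u "\<lambda>y. ennreal (C + 1) * v y"])
      have "(\<integral>\<^sup>+ x. ennreal (C + 1) * v x \<partial>M') \<le> ennreal (C + 1) * ennreal (C + 1)"
        using v(1,2) C by (subst nn_integral_cmult) (auto intro: mult_left_mono)
      also have "\<dots> \<le> ennreal (moment_const C \<gamma>)"
        using C unfolding moment_const_def power2_eq_square
        by (subst ennreal_mult[symmetric]) (auto intro!: ennreal_leI add_nonneg_nonneg)
      finally show "(\<integral>\<^sup>+ x. ennreal (C + 1) * v x \<partial>M') \<le> ennreal (moment_const C \<gamma>)" .
      fix x y assume xy: "x \<in> space M" "y \<in> space M'"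
      show "F' x * G' y \<le> ennreal (c * d) * (u x + ennreal (C + 1) * v y)"
      proof (cases "u x = \<top>")
        case True
        thus ?thesis using c d by (simp add: ennreal_mult_top)
      next
        case False
        hence "F' x * G' y \<le> ennreal ((C + 1) * c) * (ennreal d * v y)"
          using u(3)[OF xy(1)] v(3)[OF xy(2)] by (intro mult_mono) (auto simp: p1)
        also have "\<dots> = ennreal (c * d) * (ennreal (C + 1) * v y)"
          using c d C by (simp add: ennreal_mult mult_ac)
        also have "\<dots> \<le> ennreal (c * d) * (u x + ennreal (C + 1) * v y)"
          by (intro mult_left_mono) auto
        finally show ?thesis .
      qed
    qed (use u v in auto)
  qed
  consider "\<gamma> = 0" | "\<gamma> = \<top>" | "\<gamma> \<noteq> 0" "\<gamma> \<noteq> \<top>" by blast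
  thus thesis
  proof cases
    case 1
    have F': "outer_esssup M1 F \<le> ennreal (C * a)" using F by (simp add: Lp_norm_def 1)
    have G': "Lp_norm M2 (ennreal 1) G \<le> ennreal (C * b)" using G by (simp add: 1)
    show ?thesis
      by (rule mixed[OF a b F' G']) (rule that)
  next
    case 2
    have F': "Lp_norm M1 (ennreal 1) F \<le> ennreal (C * a)" using F by (simp add: 2)
    have G': "outer_esssup M2 G \<le> ennreal (C * b)" using G by (simp add: Lp_norm_def 2)
    show ?thesis
    proof (rule mixed[OF b a G' F'])
      fix u v assume "u \<in> borel_measurable M2" "v \<in> borel_measurable M1"
        "(\<integral>\<^sup>+ x. u x \<partial>M2) \<le> ennreal (moment_const C \<gamma>)" "(\<integral>\<^sup>+ x. v x \<partial>M1) \<le> ennreal (moment_const C \<gamma>)"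
        "\<And>x y. x \<in> space M2 \<Longrightarrow> y \<in> space M1 \<Longrightarrow> G x * F y \<le> ennreal (b * a) * (u x + v y)"
      thus thesis by (intro that[of v u]) (simp_all add: mult.commute add.commute)
    qed
  next
    case 3
    then obtain r where r: "\<gamma> = ennreal r" "0 < r"
      by (cases \<gamma>) (auto simp: less_le)
    have r': "0 < 1 + 1 / r" "1 / (1 + 1 / r) + 1 / (1 + r) = 1"
      using r by (simp_all add: add_pos_pos divide_simps algebra_simps)
    have e: "1 + 1 / \<gamma> = ennreal (1 + 1 / r)" "1 + \<gamma> = ennreal (1 + r)"
      using r divide_ennreal[of 1 r] ennreal_plus[of 1 "1 / r"] ennreal_plus[of 1 r] by simp_all
    obtain u where u: "u \<in> borel_measurable M1" "(\<integral>\<^sup>+ x. u x \<partial>M1) \<le> ennreal ((C + 1) powr (1 + 1 / r))"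
      "\<And>x. x \<in> space M1 \<Longrightarrow> F x \<le> ennreal a * ennpowr (u x) (1 / (1 + 1 / r))"
      using F[unfolded e] by (rule Lp_norm_majorant) (use C a r' in auto)
    obtain v where v: "v \<in> borel_measurable M2" "(\<integral>\<^sup>+ x. v x \<partial>M2) \<le> ennreal ((C + 1) powr (1 + r))"
      "\<And>x. x \<in> space M2 \<Longrightarrow> G x \<le> ennreal b * ennpowr (v x) (1 / (1 + r))"
      using G[unfolded e] by (rule Lp_norm_majorant) (use C b r in auto)
    show ?thesis
    proof (rule that[of u v])
      show "(\<integral>\<^sup>+ x. u x \<partial>M1) \<le> ennreal (moment_const C \<gamma>)" "(\<integral>\<^sup>+ x. v x \<partial>M2) \<le> ennreal (moment_const C \<gamma>)"
        by (rule order.trans[OF u(2)], use r in \<open>simp add: moment_const_def\<close>)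
          (rule order.trans[OF v(2)], use r in \<open>simp add: moment_const_def\<close>)
      fix x y assume "x \<in> space M1" "y \<in> space M2"
      hence "F x * G y \<le> (ennreal a * ennpowr (u x) (1 / (1 + 1 / r))) * (ennreal b * ennpowr (v y) (1 / (1 + r)))"
        using u v by (intro mult_mono) auto
      also have "\<dots> = ennreal (a * b) * (ennpowr (u x) (1 / (1 + 1 / r)) * ennpowr (v y) (1 / (1 + r)))"
        using a b by (simp add: ennreal_mult mult_ac)
      also have "\<dots> \<le> ennreal (a * b) * (u x + v y)"
        using r r' by (intro mult_left_mono ennpowr_conjugate_le) auto
      finally show "F x * G y \<le> ennreal (a * b) * (u x + v y)" .
    qed (use u v in auto)
  qed
qed

text \<open>Young's inequality for \<open>(c i * a / t) * (norm (H i x \<omega>) / a)\<close>. The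
  majorant \<open>u\<close> depends on neither \<open>\<omega>\<close> nor the weights, so random
  weights may be inserted later: the errors of the moves, with \<open>t = s * \<tau>\<close>. For
  \<open>l = 0\<close> the exponent \<open>(1 + l) / l\<close> is 0 by convention, and
  \<open>K\<close> still exceeds \<open>C + 1\<close>.\<close>

lemma gradient_moment_majorant:
  fixes P :: "(real ^ 'd) measure"
  assumes H: "gradient_moment P I N H l \<le> ennreal (C * a)" and "finite I" and l: "0 \<le> l"
    and C: "0 \<le> C" and a: "0 < a"
  defines "K \<equiv> C + 1 + (C + 1) powr ((1 + l) / l)"
  obtains u where "u \<in> borel_measurable (PiM I (\<lambda>_. P))" "(\<integral>\<^sup>+ x. u x \<partial>PiM I (\<lambda>_. P)) \<le> ennreal K"
    "\<And>x \<omega> (c :: _ \<Rightarrow> real) t. x \<in> space (PiM I (\<lambda>_. P)) \<Longrightarrow> \<omega> \<in> N x \<Longrightarrow> (\<And>i. i \<in> I \<Longrightarrow> 0 \<le> c i) \<Longrightarrow> 0 < t \<Longrightarrow>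
      ennreal (\<Sum>i\<in>I. c i * norm (H i x \<omega>)) \<le>
        ennreal t * (u x + ennreal (K * (\<Sum>i\<in>I. (c i * a / t) powr (1 + l))))"
proof (cases "l = 0")
  case True
  have "outer_esssup (PiM I (\<lambda>_. P)) (\<lambda>x. SUP \<omega>\<in>N x. SUP i\<in>I. ennreal (norm (H i x \<omega>))) \<le> ennreal (C * a)"
    using H True by (simp add: gradient_moment_def Lp_norm_def)
  then obtain u where u: "u \<in> borel_measurable (PiM I (\<lambda>_. P))" "(\<integral>\<^sup>+ x. u x \<partial>PiM I (\<lambda>_. P)) = 0"
    "\<And>x. x \<in> space (PiM I (\<lambda>_. P)) \<Longrightarrow>
      (SUP \<omega>\<in>N x. SUP i\<in>I. ennreal (norm (H i x \<omega>))) \<le> ennreal ((C + 1) * a) \<or> u x = \<top>"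
    by (rule outer_esssup_majorant[where c' = "(C + 1) * a"]) (use C a in auto)
  show ?thesis
  proof (rule that[of u])
    fix x \<omega> and c :: "_ \<Rightarrow> real" and t
    assume x: "x \<in> space (PiM I (\<lambda>_. P))" "\<omega> \<in> N x" and c: "\<And>i. i \<in> I \<Longrightarrow> 0 \<le> c i" and t: "(0 :: real) < t"
    show "ennreal (\<Sum>i\<in>I. c i * norm (H i x \<omega>)) \<le>
        ennreal t * (u x + ennreal (K * (\<Sum>i\<in>I. (c i * a / t) powr (1 + l))))"
    proof (cases "u x = \<top>")
      case True
      thus ?thesis using t by (simp add: ennreal_mult_top)
    next
      case False
      hence *: "(SUP \<omega>\<in>N x. SUP i\<in>I. ennreal (norm (H i x \<omega>))) \<le> ennreal ((C + 1) * a)"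
        using u(3)[OF x(1)] by simp
      have "norm (H i x \<omega>) \<le> (C + 1) * a" if "i \<in> I" for i
      proof -
        have "ennreal (norm (H i x \<omega>)) \<le> ennreal ((C + 1) * a)"
          using order.trans[OF _ *] x(2) that by (meson SUP_upper SUP_upper2)
        thus ?thesis using C a by simp
      qed
      hence "(\<Sum>i\<in>I. c i * norm (H i x \<omega>)) \<le> (\<Sum>i\<in>I. c i * ((C + 1) * a))"
        using c by (intro sum_mono mult_left_mono) auto
      also have "\<dots> = t * ((C + 1) * (\<Sum>i\<in>I. c i * a / t))"
        using t unfolding sum_distrib_left by (intro sum.cong) auto
      also have "\<dots> \<le> t * (K * (\<Sum>i\<in>I. c i * a / t))"
        using t c a C by (intro mult_left_mono mult_right_mono sum_nonneg) (auto simp: K_def)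
      also have "(\<Sum>i\<in>I. c i * a / t) = (\<Sum>i\<in>I. (c i * a / t) powr (1 + l))"
        using \<open>l = 0\<close> c a t by (intro sum.cong) auto
      finally have "ennreal (\<Sum>i\<in>I. c i * norm (H i x \<omega>)) \<le>
          ennreal (t * (K * (\<Sum>i\<in>I. (c i * a / t) powr (1 + l))))" by (rule ennreal_leI)
      also have "\<dots> = ennreal t * ennreal (K * (\<Sum>i\<in>I. (c i * a / t) powr (1 + l)))"
        using t C by (intro ennreal_mult mult_nonneg_nonneg sum_nonneg) (auto simp: K_def)
      also have "\<dots> \<le> ennreal t * (u x + ennreal (K * (\<Sum>i\<in>I. (c i * a / t) powr (1 + l))))"
        by (intro mult_left_mono) auto
      finally show ?thesis .
    qed
  qed (use u in auto)
next
  case False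
  with l have l: "0 < l" by simp
  let ?p = "(1 + l) / l"
  have p: "0 < ?p" using l by simp
  have "ennpowr (outer_nn_integral (PiM I (\<lambda>_. P))
      (\<lambda>x. SUP \<omega>\<in>N x. ennreal (\<Sum>i\<in>I. norm (H i x \<omega>) powr ?p))) (1 / ?p) \<le> ennreal (C * a)"
    using H False by (simp add: gradient_moment_def)
  hence "outer_nn_integral (PiM I (\<lambda>_. P))
      (\<lambda>x. SUP \<omega>\<in>N x. ennreal (\<Sum>i\<in>I. norm (H i x \<omega>) powr ?p)) \<le> ennreal ((C * a) powr (1 / (1 / ?p)))"
    using l C a by (subst (asm) ennpowr_le_iff) auto
  hence o: "outer_nn_integral (PiM I (\<lambda>_. P))
      (\<lambda>x. SUP \<omega>\<in>N x. ennreal (\<Sum>i\<in>I. norm (H i x \<omega>) powr ?p)) \<le> ennreal ((C * a) powr ?p)"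
    by simp
  have lt: "(C * a) powr ?p < ((C + 1) * a) powr ?p"
    using C a p by (intro powr_less_mono2) auto
  obtain g where g [measurable]: "g \<in> borel_measurable (PiM I (\<lambda>_. P))"
    and le: "\<And>x. x \<in> space (PiM I (\<lambda>_. P)) \<Longrightarrow> (SUP \<omega>\<in>N x. ennreal (\<Sum>i\<in>I. norm (H i x \<omega>) powr ?p)) \<le> g x"
    and int: "(\<integral>\<^sup>+ x. g x \<partial>PiM I (\<lambda>_. P)) \<le> ennreal (((C + 1) * a) powr ?p)"
    by (rule outer_nn_integral_majorant[OF o _ lt]) auto
  define u where "u = (\<lambda>x. ennreal (a powr - ?p) * g x)"
  have "K \<ge> 1" using C by (simp add: K_def add_increasing2)
  show ?thesis
  proof (rule that[of u])
    have "(\<integral>\<^sup>+ x. u x \<partial>PiM I (\<lambda>_. P)) \<le> ennreal (a powr - ?p) * ennreal (((C + 1) * a) powr ?p)"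
      unfolding u_def using int by (subst nn_integral_cmult) (auto intro: mult_left_mono)
    also have "\<dots> = ennreal ((C + 1) powr ?p)"
      using a C by (simp add: ennreal_mult[symmetric] powr_mult powr_minus)
    also have "\<dots> \<le> ennreal K" using C by (intro ennreal_leI) (simp add: K_def)
    finally show "(\<integral>\<^sup>+ x. u x \<partial>PiM I (\<lambda>_. P)) \<le> ennreal K" .
    fix x \<omega> and c :: "_ \<Rightarrow> real" and t
    assume x: "x \<in> space (PiM I (\<lambda>_. P))" "\<omega> \<in> N x" and c: "\<And>i. i \<in> I \<Longrightarrow> 0 \<le> c i" and t: "(0 :: real) < t"
    let ?h = "\<Sum>i\<in>I. norm (H i x \<omega>) powr ?p" and ?c = "\<Sum>i\<in>I. (c i * a / t) powr (1 + l)"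
    have h: "ennreal ?h \<le> g x" by (rule order.trans[OF SUP_upper[OF x(2)] le[OF x(1)]])
    have nn: "0 \<le> ?h" "0 \<le> ?c" by (auto intro: sum_nonneg)
    have "(\<Sum>i\<in>I. c i * norm (H i x \<omega>)) \<le>
        (\<Sum>i\<in>I. t * ((c i * a / t) powr (1 + l) + (norm (H i x \<omega>) / a) powr ?p))"
    proof (rule sum_mono)
      fix i assume "i \<in> I"
      hence "(c i * a / t) * (norm (H i x \<omega>) / a) \<le> (c i * a / t) powr (1 + l) + (norm (H i x \<omega>) / a) powr ?p"
        using l c t a by (intro mult_le_powr_conjugate) auto
      hence "t * ((c i * a / t) * (norm (H i x \<omega>) / a)) \<le>
          t * ((c i * a / t) powr (1 + l) + (norm (H i x \<omega>) / a) powr ?p)"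
        using t by (intro mult_left_mono) auto
      thus "c i * norm (H i x \<omega>) \<le> t * ((c i * a / t) powr (1 + l) + (norm (H i x \<omega>) / a) powr ?p)"
        using t a by simp
    qed
    also have "\<dots> = t * (a powr - ?p * ?h + ?c)"
    proof -
      have "(norm (H i x \<omega>) / a) powr ?p = a powr - ?p * norm (H i x \<omega>) powr ?p" for i
        using a by (simp add: powr_divide powr_minus_divide)
      thus ?thesis by (simp only: sum_distrib_left[symmetric] sum.distrib add.commute)
    qed
    also have "\<dots> \<le> t * (a powr - ?p * ?h + K * ?c)"
      using t \<open>K \<ge> 1\<close> nn by (intro mult_left_mono add_left_mono) (auto simp: mult_le_cancel_right1)
    finally have "ennreal (\<Sum>i\<in>I. c i * norm (H i x \<omega>)) \<le> ennreal (t * (a powr - ?p * ?h + K * ?c))"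
      by (rule ennreal_leI)
    also have "\<dots> = ennreal t * (ennreal (a powr - ?p) * ennreal ?h + ennreal (K * ?c))"
      using t \<open>K \<ge> 1\<close> nn by (simp add: ennreal_mult ennreal_plus)
    also have "\<dots> \<le> ennreal t * (u x + ennreal (K * ?c))"
      unfolding u_def using h by (intro mult_left_mono add_right_mono) auto
    finally show "ennreal (\<Sum>i\<in>I. c i * norm (H i x \<omega>)) \<le> ennreal t * (u x + ennreal (K * ?c))" .
  qed (auto simp: u_def)
qed

subsection \<open>Packing numbers\<close>

lemma packing_number_gtD:
  assumes "enat K < packing_number T \<rho> \<epsilon>"
  obtains A where "A \<subseteq> T" "finite A" "card A = Suc K" "\<forall>x\<in>A. \<forall>y\<in>A. x \<noteq> y \<longrightarrow> \<epsilon> < \<rho> x y"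
proof -
  obtain A where A: "A \<subseteq> T" "\<forall>x\<in>A. \<forall>y\<in>A. x \<noteq> y \<longrightarrow> \<epsilon> < \<rho> x y"
    "enat K < (if finite A then enat (card A) else \<infinity>)"
    using assms unfolding packing_number_def less_SUP_iff by auto
  obtain A' where "A' \<subseteq> A" "finite A'" "card A' = Suc K"
  proof (cases "finite A")
    case True
    hence "Suc K \<le> card A" using A(3) by simp
    thus ?thesis using that obtain_subset_with_card_n by metis
  next
    case False
    thus ?thesis using that infinite_arbitrarily_large by metis
  qed
  with A show ?thesis by (intro that[of A']) auto
qed

lemma packing_number_antimono:
  assumes "\<epsilon>' \<le> \<epsilon>"
  shows "packing_number T \<rho> \<epsilon> \<le> packing_number T \<rho> \<epsilon>'"
  unfolding packing_number_def using assms
  by (intro SUP_subset_mono) force+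

lemma packing_number_mono: "T \<subseteq> T' \<Longrightarrow> packing_number T \<rho> \<epsilon> \<le> packing_number T' \<rho> \<epsilon>"
  unfolding packing_number_def by (intro SUP_subset_mono) auto

text \<open>Total boundedness and pigeonhole: a ball of radius \<open>\<epsilon> / 2\<close>
  contains at most one point of a separated set. This covers the finitely many problems that the
  asymptotic bounds do not reach.\<close>

lemma packing_number_mspace_bounded:
  assumes "compact_space (mtopology_of S)" "0 < \<epsilon>"
  obtains K where "packing_number (mspace S) (mdist S) \<epsilon> \<le> enat K"
proof -
  interpret Metric_space "mspace S" "mdist S" by (rule Metric_space_mspace_mdist)
  have "compactin mtopology (mspace S)"
    using assms(1) by (simp add: compact_space_def mtopology_of_def)
  hence "mtotally_bounded (mspace S)" by (rule compactin_imp_mtotally_bounded)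
  then obtain C where C: "finite C" "C \<subseteq> mspace S" "mspace S \<subseteq> (\<Union>x\<in>C. mball x (\<epsilon> / 2))"
    using assms(2) unfolding mtotally_bounded_def by (meson half_gt_zero)
  have "packing_number (mspace S) (mdist S) \<epsilon> \<le> enat (card C)"
  proof (rule ccontr)
    assume "\<not> ?thesis"
    hence "enat (card C) < packing_number (mspace S) (mdist S) \<epsilon>" by simp
    then obtain A where A: "A \<subseteq> mspace S" "finite A" "card A = Suc (card C)"
      "\<forall>x\<in>A. \<forall>y\<in>A. x \<noteq> y \<longrightarrow> \<epsilon> < mdist S x y"
      by (rule packing_number_gtD)
    have "\<forall>x\<in>A. \<exists>c. c \<in> C \<and> x \<in> mball c (\<epsilon> / 2)"
    proof
      fix x assume "x \<in> A"
      hence "x \<in> (\<Union>c\<in>C. mball c (\<epsilon> / 2))" using A(1) C(3) by (meson subsetD)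
      thus "\<exists>c. c \<in> C \<and> x \<in> mball c (\<epsilon> / 2)" by (simp only: UN_iff Bex_def)
    qed
    from bchoice[OF this] obtain c where "\<forall>x\<in>A. c x \<in> C \<and> x \<in> mball (c x) (\<epsilon> / 2)" ..
    hence c: "c x \<in> C \<and> x \<in> mball (c x) (\<epsilon> / 2)" if "x \<in> A" for x using that by (rule bspec)
    have "\<not> inj_on c A"
    proof
      assume "inj_on c A"
      moreover have "c ` A \<subseteq> C" using c by (intro image_subsetI) simp
      ultimately have "card A \<le> card C" using C(1) by (intro card_inj_on_le)
      thus False using A(3) by simp
    qed
    then obtain x y where xy: "x \<in> A" "y \<in> A" "x \<noteq> y" "c x = c y" by (auto simp: inj_on_def)
    have "mdist S (c x) x < \<epsilon> / 2" "mdist S (c x) y < \<epsilon> / 2" "c x \<in> mspace S" "x \<in> mspace S" "y \<in> mspace S"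
      using c[OF xy(1)] c[OF xy(2)] xy(4) by auto
    hence "mdist S x y < \<epsilon>" using triangle''[of x "c x" y] by simp
    thus False using A(4) xy by fastforce
  qed
  thus ?thesis by (rule that)
qed

subsection \<open>One perturbation step\<close>

text \<open>A minimizer bounds the objective from below, so the real-valued infimum is a genuine
  lower bound.\<close>

lemma opt_value_le:
  assumes "is_minimizer S \<psi> x \<omega>0" "\<omega> \<in> mspace S"
  shows "opt_value S \<psi> x \<le> \<psi> x \<omega>"
  unfolding opt_value_def using assms
  by (intro cINF_lower) (auto simp: is_minimizer_def bdd_below_def)

lemma minimizer_near_opt:
  assumes "is_minimizer S \<psi> x \<omega>0" "0 < \<theta>"
  shows "\<omega>0 \<in> near_opt S \<psi> \<theta> x"
proof -
  have "\<psi> x \<omega>0 \<le> opt_value S \<psi> x"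
    unfolding opt_value_def using assms(1) by (intro cINF_greatest) (auto simp: is_minimizer_def)
  thus ?thesis using assms by (auto simp: near_opt_def is_minimizer_def)
qed

lemma AE_ex_minimizer:
  assumes "uniqueness_condition P I S \<psi>"
  shows "AE x in PiM I (\<lambda>_. P). \<exists>\<omega>. is_minimizer S \<psi> x \<omega>"
proof -
  have "AE x in completion (PiM I (\<lambda>_. P)). x \<notin> space (PiM I (\<lambda>_. P)) - unique_min_inputs P I S \<psi>"
    using assms unfolding uniqueness_condition_def by (rule AE_not_in)
  hence "AE x in completion (PiM I (\<lambda>_. P)). x \<in> space (PiM I (\<lambda>_. P)) \<longrightarrow> (\<exists>\<omega>. is_minimizer S \<psi> x \<omega>)"
    by eventually_elim (auto simp: unique_min_inputs_def)
  hence "AE x in PiM I (\<lambda>_. P). x \<in> space (PiM I (\<lambda>_. P)) \<longrightarrow> (\<exists>\<omega>. is_minimizer S \<psi> x \<omega>)"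
    by (simp add: AE_completion_iff)
  thus ?thesis using AE_space by eventually_elim auto
qed

context proposal
begin

text \<open>Under the monotone remainder condition the moments are assumed for independent Gaussian
  vectors only; this is the law of the start and the proposal.\<close>

lemma distr_moves_fst:
  "distr moves (P \<Otimes>\<^sub>M std_gaussian) (\<lambda>(x, v). (x, fst v)) = P \<Otimes>\<^sub>M std_gaussian"
proof (rule measure_eqI)
  fix A assume "A \<in> sets (distr moves (P \<Otimes>\<^sub>M std_gaussian) (\<lambda>(x, v). (x, fst v)))"
  hence A [measurable]: "A \<in> sets (P \<Otimes>\<^sub>M std_gaussian)" by simp
  have "sets (P \<Otimes>\<^sub>M std_gaussian) = sets (borel \<Otimes>\<^sub>M (borel :: (real ^ 'd) measure))"
    by (intro sets_pair_measure_cong) auto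
  hence [measurable]: "A \<in> sets (borel \<Otimes>\<^sub>M borel)" using A by simp
  have [measurable]: "(\<lambda>(x, v). (x, fst v)) \<in> moves \<rightarrow>\<^sub>M P \<Otimes>\<^sub>M std_gaussian"
    unfolding case_prod_unfold by measurable
  have "emeasure (distr moves (P \<Otimes>\<^sub>M std_gaussian) (\<lambda>(x, v). (x, fst v))) A =
      (\<integral>\<^sup>+ (x, w, _). indicator A (x, w) \<partial>moves)"
    by (simp add: nn_integral_distr case_prod_unfold flip: nn_integral_indicator)
  also have "\<dots> = (\<integral>\<^sup>+ x. \<integral>\<^sup>+ w. indicator A (x, w) \<partial>std_gaussian \<partial>P)"
    by (rule nn_integral_moves_fst) measurable
  also have "\<dots> = emeasure (P \<Otimes>\<^sub>M std_gaussian) A"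
    by (subst G.nn_integral_fst) auto
  finally show "emeasure (distr moves (P \<Otimes>\<^sub>M std_gaussian) (\<lambda>(x, v). (x, fst v))) A = \<dots>" .
qed simp

context
  fixes I :: "'i set"
  assumes finite_I: "finite I"
begin

definition target :: "('i \<Rightarrow> real ^ 'd) \<times> ('i \<Rightarrow> (real ^ 'd) \<times> (real ^ 'd) \<times> bool) \<Rightarrow> 'i \<Rightarrow> real ^ 'd" where
  "target = (\<lambda>(x, v). \<lambda>i\<in>I. x i + s *\<^sub>R displacement s (x i) (v i))"

lemma distr_joint_source: "distr (joint I) (PiM I (\<lambda>_. P)) fst = PiM I (\<lambda>_. P)"
proof -
  have "distr (joint I) (PiM I (\<lambda>_. P)) (\<lambda>(x, v). \<lambda>i\<in>I. fst (x i, v i)) = PiM I (\<lambda>_. distr moves P fst)"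
    by (rule distr_joint[OF finite_I]) measurable
  also have "distr moves P fst = P"
    using distr_moves_source by (subst distr_cong[OF refl sets_P refl]) auto
  also have "distr (joint I) (PiM I (\<lambda>_. P)) (\<lambda>(x, v). \<lambda>i\<in>I. fst (x i, v i)) = distr (joint I) (PiM I (\<lambda>_. P)) fst"
    by (intro distr_cong refl)
      (auto simp: space_joint[OF finite_I] space_PiM PiE_def extensional_def fun_eq_iff)
  finally show ?thesis .
qed

lemma distr_joint_target: "distr (joint I) (PiM I (\<lambda>_. P)) target = PiM I (\<lambda>_. P)"
proof -
  have "distr (joint I) (PiM I (\<lambda>_. P)) (\<lambda>(x, v). \<lambda>i\<in>I. (\<lambda>(x, v). x + s *\<^sub>R displacement s x v) (x i, v i)) =
      PiM I (\<lambda>_. distr moves P (\<lambda>(x, v). x + s *\<^sub>R displacement s x v))"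
    by (rule distr_joint[OF finite_I]) (unfold case_prod_unfold, measurable)
  also have "distr moves P (\<lambda>(x, v). x + s *\<^sub>R displacement s x v) = P"
    using distr_moves_target by (subst distr_cong[OF refl sets_P refl]) auto
  finally show ?thesis unfolding target_def prod.case .
qed

lemma measurable_source [measurable]: "fst \<in> joint I \<rightarrow>\<^sub>M PiM I (\<lambda>_. P)"
  unfolding measurable_cong_sets[OF sets_joint[OF finite_I] refl] by (rule measurable_fst)

lemma measurable_target [measurable]: "target \<in> joint I \<rightarrow>\<^sub>M PiM I (\<lambda>_. P)"
proof -
  have "(\<lambda>(x, v). \<lambda>i\<in>I. (\<lambda>(x, v). x + s *\<^sub>R displacement s x v) (x i, v i)) \<in> joint I \<rightarrow>\<^sub>M PiM I (\<lambda>_. P)"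
    by (rule measurable_joint[OF finite_I]) (unfold case_prod_unfold, measurable)
  thus ?thesis by (simp add: target_def)
qed

text \<open>The exceptional null set, regrouped by coordinates, is null for the product of the laws
  of \<open>(x, s *\<^sub>R displacement s x v)\<close> by absolute continuity, and
  \<open>distr_joint\<close> brings the bound back to \<open>joint\<close>.\<close>

lemma AE_joint_taylor:
  assumes "taylor_bound I S \<psi> L H R R'"
  shows "AE (x, v) in joint I. \<forall>\<omega>\<in>mspace S. \<psi> (target (x, v)) \<omega> - \<psi> x \<omega>
    \<le> (\<Sum>i\<in>I. (s *\<^sub>R displacement s (x i) (v i)) \<bullet> H i x \<omega>) +
      (\<Sum>l=1..L. R l x (\<lambda>i\<in>I. s *\<^sub>R displacement s (x i) (v i)) \<omega> * R' l (target (x, v)))"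
proof -
  let ?T = "\<lambda>(x, v). (x, s *\<^sub>R displacement s x v)"
  let ?Q = "distr moves (borel \<Otimes>\<^sub>M borel) ?T"
  let ?\<phi> = "\<lambda>x c. \<forall>\<omega>\<in>mspace S. \<psi> (\<lambda>i\<in>I. x i + c i) \<omega> - \<psi> x \<omega>
          \<le> (\<Sum>i\<in>I. c i \<bullet> H i x \<omega>) + (\<Sum>l=1..L. R l x c \<omega> * R' l (\<lambda>i\<in>I. x i + c i))"
  have Tm: "?T \<in> P \<Otimes>\<^sub>M aux \<rightarrow>\<^sub>M borel \<Otimes>\<^sub>M borel" "?T \<in> moves \<rightarrow>\<^sub>M borel \<Otimes>\<^sub>M borel"
    unfolding case_prod_unfold by measurable
  have sf: "sigma_finite_measure (lborel :: (real ^ 'd) measure)" ..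
  have "AE z in PiM I (\<lambda>_. lborel \<Otimes>\<^sub>M lborel). ?\<phi> (\<lambda>i\<in>I. fst (z i)) (\<lambda>i\<in>I. snd (z i))"
    using assms unfolding taylor_bound_def
    by (intro AE_split_pair_PiM finite_I product_sigma_finite_const sf)
  hence "AE z in PiM I (\<lambda>_. ?Q). ?\<phi> (\<lambda>i\<in>I. fst (z i)) (\<lambda>i\<in>I. snd (z i))"
  proof (rule AE_PiM_absolutely_continuous[OF finite_I _ _ moves_absolutely_continuous, rotated -1])
    show "sigma_finite_measure ?Q"
      by (intro prob_space_imp_sigma_finite prob_space.prob_space_distr prob_space_moves Tm)
  qed (auto intro!: sigma_finite_pair_measure sf sets_pair_measure_cong)
  hence "AE z in distr (joint I) (PiM I (\<lambda>_. borel \<Otimes>\<^sub>M borel)) (\<lambda>(x, v). \<lambda>i\<in>I. ?T (x i, v i)).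
      ?\<phi> (\<lambda>i\<in>I. fst (z i)) (\<lambda>i\<in>I. snd (z i))"
    by (subst distr_joint[OF finite_I Tm(1)])
  hence "AE z in joint I. ?\<phi> (\<lambda>i\<in>I. fst ((\<lambda>(x, v). \<lambda>i\<in>I. ?T (x i, v i)) z i))
      (\<lambda>i\<in>I. snd ((\<lambda>(x, v). \<lambda>i\<in>I. ?T (x i, v i)) z i))"
    by (rule AE_distrD[rotated]) (rule measurable_joint[OF finite_I Tm(1)])
  thus ?thesis
    using AE_space
  proof eventually_elim
    case (elim z)
    obtain x v where z: "z = (x, v)" by (cases z)
    have "(\<lambda>i\<in>I. fst ((\<lambda>(x, v). \<lambda>i\<in>I. ?T (x i, v i)) z i)) = x"
      using elim(2) by (auto simp: z space_joint[OF finite_I] space_PiM PiE_def extensional_def fun_eq_iff)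
    moreover have "(\<lambda>i\<in>I. snd ((\<lambda>(x, v). \<lambda>i\<in>I. ?T (x i, v i)) z i)) = (\<lambda>i\<in>I. s *\<^sub>R displacement s (x i) (v i))"
      by (auto simp: z fun_eq_iff)
    moreover have "(\<lambda>i\<in>I. x i + (\<lambda>i\<in>I. s *\<^sub>R displacement s (x i) (v i)) i) = target (x, v)"
      by (auto simp: target_def fun_eq_iff)
    moreover have "(\<Sum>i\<in>I. (\<lambda>i\<in>I. s *\<^sub>R displacement s (x i) (v i)) i \<bullet> H i x \<omega>) =
        (\<Sum>i\<in>I. (s *\<^sub>R displacement s (x i) (v i)) \<bullet> H i x \<omega>)" for \<omega>
      by (intro sum.cong) auto
    ultimately show ?case using elim(1) by (simp only: z prod.case)
  qed
qed

lemma nn_integral_joint_component: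
  assumes [measurable]: "h \<in> borel_measurable (P \<Otimes>\<^sub>M aux)" and "i \<in> I"
  shows "(\<integral>\<^sup>+ (x, v). h (x i, v i) \<partial>joint I) = (\<integral>\<^sup>+ z. h z \<partial>moves)"
proof -
  have *: "distr (joint I) (PiM I (\<lambda>_. moves)) (\<lambda>(x, v). \<lambda>i\<in>I. (\<lambda>z. z) (x i, v i)) = PiM I (\<lambda>_. distr moves moves (\<lambda>z. z))"
    by (rule distr_joint[OF finite_I]) measurable
  have m: "(\<lambda>(x, v). \<lambda>i\<in>I. (\<lambda>z. z) (x i, v i)) \<in> joint I \<rightarrow>\<^sub>M PiM I (\<lambda>_. moves)"
    by (rule measurable_joint[OF finite_I]) measurable
  have hm [measurable]: "h \<in> borel_measurable moves" by simp
  have "(\<integral>\<^sup>+ z. h z \<partial>moves) = (\<integral>\<^sup>+ z. h z \<partial>distr (PiM I (\<lambda>_. moves)) moves (\<lambda>z. z i))"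
    by (subst distr_PiM_component) (use assms prob_space_moves in auto)
  also have "\<dots> = (\<integral>\<^sup>+ z. h (z i) \<partial>PiM I (\<lambda>_. moves))"
    using assms(2) by (subst nn_integral_distr) auto
  also have "\<dots> = (\<integral>\<^sup>+ z. h (z i) \<partial>distr (joint I) (PiM I (\<lambda>_. moves)) (\<lambda>(x, v). \<lambda>i\<in>I. (\<lambda>z. z) (x i, v i)))"
    unfolding * by simp
  also have "\<dots> = (\<integral>\<^sup>+ z. h ((\<lambda>(x, v). \<lambda>i\<in>I. (\<lambda>z. z) (x i, v i)) z i) \<partial>joint I)"
    using assms(2) by (subst nn_integral_distr[OF m]) auto
  also have "\<dots> = (\<integral>\<^sup>+ (x, v). h (x i, v i) \<partial>joint I)"
    using assms(2) by (intro nn_integral_cong) (auto simp: case_prod_unfold)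
  finally show ?thesis ..
qed

end
end

text \<open>The optimal value is measurable for the completion only. A version measurable for the
  product itself can be composed with the moves.\<close>

lemma completion_ex_integrable:
  fixes f :: "'a \<Rightarrow> real"
  assumes "integrable (completion M) f"
  obtains f' where "integrable M f'" "AE x in M. f x = f' x"
proof -
  have "f \<in> borel_measurable (completion M)" using assms by auto
  from completion_ex_borel_measurable_real[OF this]
  obtain f' where f': "f' \<in> borel_measurable M" "AE x in M. f x = f' x" by blast
  have "integrable (completion M) f'"
    using assms by (rule Bochner_Integration.integrable_cong_AE_imp)
      (use f' in \<open>auto intro: measurable_completion AE_completion elim: eventually_mono\<close>)
  thus ?thesis using f' by (intro that[of f']) (auto simp: integrable_completion)
qed

section \<open>The tail bound for a single problem\<close>

context proposal
begin

text \<open>The common consequence of the two homogeneity conditions. \<open>T\<close> chooses the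
  direction whose moment is controlled: the displacement itself, or the Gaussian proposal dominating
  it.\<close>

definition remainder_scaling where
  "remainder_scaling I S L \<upsilon> R T \<longleftrightarrow> (AE (x, v) in joint I. \<forall>j\<in>{1..L :: nat}. \<forall>\<omega>\<in>mspace S.
     R j x (\<lambda>i\<in>I. s *\<^sub>R displacement s (x i) (v i)) \<omega> \<le>
       s powr (1 + \<upsilon> j) * R j x (\<lambda>i\<in>I. snd (T (x i, v i))) \<omega>)"

text \<open>The original and the moved inputs have the same law, so the optimal values cancel in the
  mean of the majorant \<open>g\<close>. What is left is \<open>\<theta> / s\<close> and the mean
  error divided by \<open>s\<close>, each at most a constant times \<open>\<tau>\<close>; then
  \<open>outer_measure_packing_le\<close> applies with \<open>a = \<tau> * \<kappa>\<close>.\<close>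

lemma outer_measure_packing_tail:
  fixes I :: "'i set" and S :: "'s metric" and \<psi> :: "('i \<Rightarrow> real ^ 'd) \<Rightarrow> 's \<Rightarrow> real"
    and H :: "'i \<Rightarrow> ('i \<Rightarrow> real ^ 'd) \<Rightarrow> 's \<Rightarrow> real ^ 'd" and l :: real
  assumes I: "finite I"
    and uniqueness: "uniqueness_condition P I S \<psi>"
    and regularity: "regularity_condition P I S \<psi>"
    and meas: "taylor_measurable P I S L H R R'"
    and taylor: "taylor_bound I S \<psi> L H R R'"
    and pos: "0 < \<theta>" "0 < \<sigma>" "0 < \<tau>" "\<And>j. j \<in> {1..L} \<Longrightarrow> 0 < \<nu> j" "\<And>j. j \<in> {1..L} \<Longrightarrow> 0 < \<nu>' j"
    and nonneg: "0 \<le> l" "0 \<le> C" "0 \<le> C\<^sub>r"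
    and C1: "gradient_moment P I (near_opt S \<psi> \<theta>) H l \<le> ennreal (C * \<sigma>)"
    and T: "T \<in> P \<Otimes>\<^sub>M aux \<rightarrow>\<^sub>M E" and fst_T: "\<And>x v. fst (T (x, v)) = x"
    and scaling: "remainder_scaling I S L \<upsilon> R T"
    and C2: "\<And>j. j \<in> {1..L} \<Longrightarrow>
      remainder_moment (distr moves E T) I (near_opt S \<psi> \<theta>) (R j) (\<gamma> j) \<le> ennreal (C * \<nu> j)"
    and C2': "\<And>j. j \<in> {1..L} \<Longrightarrow>
      Lp_norm (PiM I (\<lambda>_. P)) (1 + \<gamma> j) (\<lambda>x. ennreal (R' j x)) \<le> ennreal (C * \<nu>' j)"
    and rejection: "(\<integral>\<^sup>+ x. \<integral>\<^sup>+ w. ennreal (norm w powr (1 + l) * (1 - acc x w)) \<partial>std_gaussian \<partial>P) \<le> ennreal (C\<^sub>r * s)"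
    and s1: "real (card I) * s * \<sigma> powr (1 + l) \<le> \<tau> powr (1 + l)"
    and s2: "\<And>j. j \<in> {1..L} \<Longrightarrow> s powr \<upsilon> j * (\<nu> j * \<nu>' j) \<le> \<tau>"
    and \<theta>_le: "\<theta> \<le> C * (s * \<tau>)"
    and B: "0 < B" and \<kappa>: "0 < \<kappa>" and M: "4 * exp ((512 * B\<^sup>2)\<^sup>2) \<le> real M"
  defines "K\<^sub>g \<equiv> C + 1 + (C + 1) powr ((1 + l) / l)"
  defines "K \<equiv> C + (K\<^sub>g * (1 + 2 powr (1 + l) * C\<^sub>r) + (\<Sum>j=1..L. 2 * moment_const C (\<gamma> j)))"
  shows "outer_measure_of (PiM I (\<lambda>_. P))
      (separated_event (PiM I (\<lambda>_. P)) (near_opt S \<psi> \<theta>) (gradient_dist I H) (\<tau> * \<kappa>) M) \<le> ennreal (K / (B * \<kappa>))"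
proof -
  let ?A = "PiM I (\<lambda>_. P)" and ?J = "joint I" and ?Q = "distr moves E T" and ?N = "near_opt S \<psi> \<theta>"
  let ?q = "1 + l"
  let ?TT = "\<lambda>(x, v). \<lambda>i\<in>I. T (x i, v i)"
  let ?X = "target I"
  define err where "err = (\<lambda>(x :: real ^ 'd, v). displacement s x v - fst v)"
  note [measurable] = measurable_source[OF I] measurable_target[OF I]
  have TT [measurable]: "?TT \<in> ?J \<rightarrow>\<^sub>M PiM I (\<lambda>_. E)" by (rule measurable_joint[OF I T])
  have dTT: "distr ?J (PiM I (\<lambda>_. E)) ?TT = PiM I (\<lambda>_. ?Q)" by (rule distr_joint[OF I T])
  have nn_source: "(\<integral>\<^sup>+ z. h (fst z) \<partial>?J) = (\<integral>\<^sup>+ x. h x \<partial>?A)" if [measurable]: "h \<in> borel_measurable ?A" for h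
  proof -
    have "(\<integral>\<^sup>+ x. h x \<partial>?A) = (\<integral>\<^sup>+ x. h x \<partial>distr ?J ?A fst)" by (simp only: distr_joint_source[OF I])
    also have "\<dots> = (\<integral>\<^sup>+ z. h (fst z) \<partial>?J)" by (rule nn_integral_distr) measurable
    finally show ?thesis ..
  qed
  have nn_target: "(\<integral>\<^sup>+ z. h (?X z) \<partial>?J) = (\<integral>\<^sup>+ x. h x \<partial>?A)" if [measurable]: "h \<in> borel_measurable ?A" for h
  proof -
    have "(\<integral>\<^sup>+ x. h x \<partial>?A) = (\<integral>\<^sup>+ x. h x \<partial>distr ?J ?A ?X)" by (simp only: distr_joint_target[OF I])
    also have "\<dots> = (\<integral>\<^sup>+ z. h (?X z) \<partial>?J)" by (rule nn_integral_distr) measurable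
    finally show ?thesis ..
  qed
  have Kg: "0 \<le> K\<^sub>g" using nonneg by (simp add: K\<^sub>g_def)
  have R_nonneg: "0 \<le> R j x c \<omega>" "0 \<le> R' j x"
    if "j \<in> {1..L}" "x \<in> I \<rightarrow>\<^sub>E UNIV" "c \<in> I \<rightarrow>\<^sub>E UNIV" "\<omega> \<in> mspace S" for j x c \<omega>
    using meas that unfolding taylor_measurable_def by auto

  obtain u\<^sub>H where uH [measurable]: "u\<^sub>H \<in> borel_measurable ?A"
    and uH_int: "(\<integral>\<^sup>+ x. u\<^sub>H x \<partial>?A) \<le> ennreal K\<^sub>g"
    and uH_ge: "\<And>x \<omega> (c :: 'i \<Rightarrow> real) t. x \<in> space ?A \<Longrightarrow> \<omega> \<in> ?N x \<Longrightarrow> (\<And>i. i \<in> I \<Longrightarrow> 0 \<le> c i) \<Longrightarrow> 0 < t \<Longrightarrow>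
      ennreal (\<Sum>i\<in>I. c i * norm (H i x \<omega>)) \<le>
        ennreal t * (u\<^sub>H x + ennreal (K\<^sub>g * (\<Sum>i\<in>I. (c i * \<sigma> / t) powr ?q)))"
    unfolding K\<^sub>g_def
    by (rule gradient_moment_majorant[OF C1 I nonneg(1,2) pos(2)]) blast

  define PR where "PR = (\<lambda>j u v. u \<in> borel_measurable (PiM I (\<lambda>_. ?Q)) \<and> v \<in> borel_measurable ?A \<and>
      (\<integral>\<^sup>+ x. u x \<partial>PiM I (\<lambda>_. ?Q)) \<le> ennreal (moment_const C (\<gamma> j)) \<and>
      (\<integral>\<^sup>+ x. v x \<partial>?A) \<le> ennreal (moment_const C (\<gamma> j)) \<and>
      (\<forall>z\<in>space (PiM I (\<lambda>_. ?Q)). \<forall>y\<in>space ?A. \<forall>\<omega>\<in>?N (\<lambda>i\<in>I. fst (z i)).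
        ennreal (R j (\<lambda>i\<in>I. fst (z i)) (\<lambda>i\<in>I. snd (z i)) \<omega>) * ennreal (R' j y) \<le>
          ennreal (\<nu> j * \<nu>' j) * (u z + v y)))"
  have "\<exists>uv. PR j (fst uv) (snd uv)" if j: "j \<in> {1..L}" for j
  proof -
    obtain u v where uv: "u \<in> borel_measurable (PiM I (\<lambda>_. ?Q))" "v \<in> borel_measurable ?A"
      "(\<integral>\<^sup>+ x. u x \<partial>PiM I (\<lambda>_. ?Q)) \<le> ennreal (moment_const C (\<gamma> j))"
      "(\<integral>\<^sup>+ x. v x \<partial>?A) \<le> ennreal (moment_const C (\<gamma> j))"
      "\<And>z y. z \<in> space (PiM I (\<lambda>_. ?Q)) \<Longrightarrow> y \<in> space ?A \<Longrightarrow>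
        (let x = (\<lambda>i\<in>I. fst (z i)); w = (\<lambda>i\<in>I. snd (z i)) in SUP \<omega>\<in>?N x. ennreal (R j x w \<omega>)) *
          ennreal (R' j y) \<le> ennreal (\<nu> j * \<nu>' j) * (u z + v y)"
      by (rule Lp_norm_product_majorant[OF C2[OF j, unfolded remainder_moment_def] C2'[OF j] nonneg(2) pos(4,5)[OF j]]) blast
    have "PR j u v"
      unfolding PR_def
    proof (intro conjI ballI)
      fix z y \<omega> assume zy: "z \<in> space (PiM I (\<lambda>_. ?Q))" "y \<in> space ?A" "\<omega> \<in> ?N (\<lambda>i\<in>I. fst (z i))"
      show "ennreal (R j (\<lambda>i\<in>I. fst (z i)) (\<lambda>i\<in>I. snd (z i)) \<omega>) * ennreal (R' j y) \<le>
          ennreal (\<nu> j * \<nu>' j) * (u z + v y)"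
        by (rule order.trans[OF mult_right_mono uv(5)[OF zy(1,2), unfolded Let_def]])
          (auto intro: SUP_upper zy(3))
    qed (rule uv)+
    thus ?thesis by (intro exI[of _ "(u, v)"]) simp
  qed
  hence "\<forall>j\<in>{1..L}. \<exists>uv. PR j (fst uv) (snd uv)" by blast
  from bchoice[OF this] obtain uv0 where uv0: "\<forall>j\<in>{1..L}. PR j (fst (uv0 j)) (snd (uv0 j))" ..
  define u v where "u = (\<lambda>j. fst (uv0 j))" and "v = (\<lambda>j. snd (uv0 j))"
  have "PR j (u j) (v j)" if "j \<in> {1..L}" for j using uv0 that by (simp add: u_def v_def)
  note PRD = this[unfolded PR_def]
  note uv = PRD[THEN conjunct1] PRD[THEN conjunct2, THEN conjunct1]
    PRD[THEN conjunct2, THEN conjunct2, THEN conjunct1]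
    PRD[THEN conjunct2, THEN conjunct2, THEN conjunct2, THEN conjunct1]
    PRD[THEN conjunct2, THEN conjunct2, THEN conjunct2, THEN conjunct2, rule_format]

  have [measurable]: "err \<in> borel_measurable (P \<Otimes>\<^sub>M aux)"
  proof -
    have "(\<lambda>z. fst (snd z)) \<in> borel_measurable (P \<Otimes>\<^sub>M aux)"
      by (rule measurable_aux_components(1)[OF measurable_snd])
    thus ?thesis unfolding err_def case_prod_unfold by measurable
  qed
  have err_m: "(\<lambda>z. ennreal ((norm (err (fst z i, snd z i)) * \<sigma> / \<tau>) powr ?q)) \<in> borel_measurable ?J"
    if "i \<in> I" for i
  proof -
    have "(\<lambda>z. (fst z i, snd z i)) \<in> ?J \<rightarrow>\<^sub>M P \<Otimes>\<^sub>M aux"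
      unfolding measurable_cong_sets[OF sets_joint[OF I] refl] using that by measurable
    hence "(\<lambda>z. err (fst z i, snd z i)) \<in> borel_measurable ?J" by measurable
    thus ?thesis by measurable
  qed
  \<comment> \<open>The weights are \<open>s\<close> times the error norms and the scale is
    \<open>s * \<tau>\<close>, so \<open>s\<close> cancels inside the power.\<close>
  define E1 where "E1 = (\<lambda>z. \<Sum>i\<in>I. ennreal ((norm (err (fst z i, snd z i)) * \<sigma> / \<tau>) powr ?q))"
  have [measurable]: "E1 \<in> borel_measurable ?J"
    unfolding E1_def by (intro borel_measurable_sum err_m)
  have E1_int: "(\<integral>\<^sup>+ z. E1 z \<partial>?J) \<le> ennreal (2 powr ?q * C\<^sub>r)"
  proof -
    let ?c = "(\<sigma> / \<tau>) powr ?q"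
    have one: "(\<integral>\<^sup>+ z. ennreal ((norm (err (fst z i, snd z i)) * \<sigma> / \<tau>) powr ?q) \<partial>?J) \<le>
        ennreal (?c * (2 powr ?q * (C\<^sub>r * s)))" if i: "i \<in> I" for i
    proof -
      have "(\<integral>\<^sup>+ z. ennreal ((norm (err (fst z i, snd z i)) * \<sigma> / \<tau>) powr ?q) \<partial>?J) =
          (\<integral>\<^sup>+ z. ennreal ((norm (err z) * \<sigma> / \<tau>) powr ?q) \<partial>moves)"
        using nn_integral_joint_component[OF I _ i, of "\<lambda>z. ennreal ((norm (err z) * \<sigma> / \<tau>) powr ?q)"]
        by (simp add: case_prod_unfold)
      also have "\<dots> = (\<integral>\<^sup>+ z. ennreal ?c * ennreal (norm (err z) powr ?q) \<partial>moves)"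
        using pos by (intro nn_integral_cong) (simp add: ennreal_mult[symmetric] powr_mult[symmetric] mult.commute)
      also have "\<dots> = ennreal ?c * (\<integral>\<^sup>+ z. ennreal (norm (err z) powr ?q) \<partial>moves)"
        by (rule nn_integral_cmult) measurable
      also have "\<dots> \<le> ennreal ?c * (ennreal (2 powr ?q) * ennreal (C\<^sub>r * s))"
      proof (rule mult_left_mono)
        have "(\<integral>\<^sup>+ z. ennreal (norm (err z) powr ?q) \<partial>moves) \<le> ennreal (2 powr ?q) *
            (\<integral>\<^sup>+ x. \<integral>\<^sup>+ w. ennreal (norm w powr ?q * (1 - acc x w)) \<partial>std_gaussian \<partial>P)"
          using nn_integral_displacement_error[of ?q] nonneg by (simp add: err_def case_prod_unfold)
        also have "\<dots> \<le> ennreal (2 powr ?q) * ennreal (C\<^sub>r * s)"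
          by (intro mult_left_mono rejection) auto
        finally show "(\<integral>\<^sup>+ z. ennreal (norm (err z) powr ?q) \<partial>moves) \<le> ennreal (2 powr ?q) * ennreal (C\<^sub>r * s)" .
      qed simp
      also have "\<dots> = ennreal (?c * (2 powr ?q * (C\<^sub>r * s)))"
        using nonneg s_pos by (simp add: ennreal_mult)
      finally show ?thesis .
    qed
    have "(\<integral>\<^sup>+ z. E1 z \<partial>?J) = (\<Sum>i\<in>I. \<integral>\<^sup>+ z. ennreal ((norm (err (fst z i, snd z i)) * \<sigma> / \<tau>) powr ?q) \<partial>?J)"
      unfolding E1_def by (intro nn_integral_sum err_m)
    also have "\<dots> \<le> (\<Sum>i\<in>I. ennreal (?c * (2 powr ?q * (C\<^sub>r * s))))"
      by (intro sum_mono one)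
    also have "\<dots> = ennreal (real (card I) * (?c * (2 powr ?q * (C\<^sub>r * s))))"
      using nonneg s_pos by (simp add: ennreal_of_nat_eq_real_of_nat ennreal_mult)
    also have "\<dots> \<le> ennreal (2 powr ?q * C\<^sub>r)"
    proof (rule ennreal_leI)
      \<comment> \<open>The rejection bound supplies a factor \<open>s\<close> for each input, and
        \<open>s1\<close> plays it against the number of inputs.\<close>
      have "real (card I) * (?c * (2 powr ?q * (C\<^sub>r * s))) =
          (real (card I) * s * \<sigma> powr ?q) / \<tau> powr ?q * (2 powr ?q * C\<^sub>r)"
        using pos by (simp add: powr_divide)
      also have "\<dots> \<le> 1 * (2 powr ?q * C\<^sub>r)"
        using s1 pos nonneg by (intro mult_right_mono) (auto simp: divide_le_eq_1)
      finally show "real (card I) * (?c * (2 powr ?q * (C\<^sub>r * s))) \<le> 2 powr ?q * C\<^sub>r" by simp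
    qed
    finally show ?thesis .
  qed

  \<comment> \<open>\<open>u\<close> is evaluated at the chosen pair and \<open>v\<close> at the
    moved input. Their dependence is harmless, since only the separate integrals are used.\<close>
  define E2 where "E2 = (\<lambda>j z. ennreal (s powr (1 + \<upsilon> j) * (\<nu> j * \<nu>' j)) * (u j (?TT z) + v j (?X z)))"
  have E2 [measurable]: "E2 j \<in> borel_measurable ?J"
    and E2_int: "(\<integral>\<^sup>+ z. E2 j z \<partial>?J) \<le> ennreal (s * \<tau> * (2 * moment_const C (\<gamma> j)))" if j: "j \<in> {1..L}" for j
  proof -
    have "sets (PiM I (\<lambda>_. ?Q)) = sets (PiM I (\<lambda>_. E))" by (intro sets_PiM_cong) auto
    hence um: "u j \<in> borel_measurable (PiM I (\<lambda>_. E))"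
      using uv(1)[OF j] measurable_cong_sets by blast
    note [measurable] = um uv(2)[OF j]
    have u': "(\<lambda>z. u j (?TT z)) \<in> borel_measurable ?J" by (rule measurable_compose[OF TT um])
    have v': "(\<lambda>z. v j (?X z)) \<in> borel_measurable ?J" by measurable
    show "E2 j \<in> borel_measurable ?J"
      unfolding E2_def using u' v' by measurable
    have iu: "(\<integral>\<^sup>+ z. u j (?TT z) \<partial>?J) \<le> ennreal (moment_const C (\<gamma> j))"
      using uv(3)[OF j] um unfolding dTT[symmetric] by (subst (asm) nn_integral_distr[OF TT]) auto
    have iv: "(\<integral>\<^sup>+ z. v j (?X z) \<partial>?J) \<le> ennreal (moment_const C (\<gamma> j))"
      using uv(4)[OF j] nn_target[OF uv(2)[OF j]] by simp
    have "s powr (1 + \<upsilon> j) * (\<nu> j * \<nu>' j) = s * (s powr \<upsilon> j * (\<nu> j * \<nu>' j))"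
      using s_pos by (simp add: powr_add)
    also have "\<dots> \<le> s * \<tau>" using s2[OF j] s_pos by (intro mult_left_mono) auto
    finally have le: "ennreal (s powr (1 + \<upsilon> j) * (\<nu> j * \<nu>' j)) \<le> ennreal (s * \<tau>)" by (rule ennreal_leI)
    have "(\<integral>\<^sup>+ z. E2 j z \<partial>?J) = ennreal (s powr (1 + \<upsilon> j) * (\<nu> j * \<nu>' j)) *
        ((\<integral>\<^sup>+ z. u j (?TT z) \<partial>?J) + (\<integral>\<^sup>+ z. v j (?X z) \<partial>?J))"
      unfolding E2_def using u' v' by (simp add: nn_integral_cmult nn_integral_add)
    also have "\<dots> \<le> ennreal (s * \<tau>) * (ennreal (moment_const C (\<gamma> j)) + ennreal (moment_const C (\<gamma> j)))"
      by (rule mult_mono[OF le add_mono[OF iu iv]]) auto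
    also have "\<dots> = ennreal (s * \<tau> * (2 * moment_const C (\<gamma> j)))"
      using moment_const_nonneg[of C "\<gamma> j"] s_pos pos
      by (simp add: ennreal_mult[symmetric] ennreal_plus[symmetric] del: ennreal_plus)
    finally show "(\<integral>\<^sup>+ z. E2 j z \<partial>?J) \<le> ennreal (s * \<tau> * (2 * moment_const C (\<gamma> j)))" .
  qed

  define E0 where "E0 = (\<lambda>z. ennreal (s * \<tau>) * (u\<^sub>H (fst z) + ennreal K\<^sub>g * E1 z))"
  have uf: "(\<lambda>z. u\<^sub>H (fst z)) \<in> borel_measurable ?J" by (rule measurable_compose[OF measurable_source[OF I] uH])
  have [measurable]: "E0 \<in> borel_measurable ?J" unfolding E0_def using uf by measurable
  have E0_int: "(\<integral>\<^sup>+ z. E0 z \<partial>?J) \<le> ennreal (s * \<tau> * (K\<^sub>g * (1 + 2 powr ?q * C\<^sub>r)))"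
  proof -
    have iu: "(\<integral>\<^sup>+ z. u\<^sub>H (fst z) \<partial>?J) \<le> ennreal K\<^sub>g"
      using uH_int nn_source[OF uH] by simp
    have "(\<integral>\<^sup>+ z. E0 z \<partial>?J) = ennreal (s * \<tau>) * ((\<integral>\<^sup>+ z. u\<^sub>H (fst z) \<partial>?J) + ennreal K\<^sub>g * (\<integral>\<^sup>+ z. E1 z \<partial>?J))"
      unfolding E0_def using uf by (simp add: nn_integral_cmult nn_integral_add)
    also have "\<dots> \<le> ennreal (s * \<tau>) * (ennreal K\<^sub>g + ennreal K\<^sub>g * ennreal (2 powr ?q * C\<^sub>r))"
      by (intro mult_left_mono add_mono iu E1_int) auto
    also have "\<dots> = ennreal (s * \<tau> * (K\<^sub>g * (1 + 2 powr ?q * C\<^sub>r)))"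
      using Kg s_pos pos nonneg
      by (simp add: ennreal_mult[symmetric] ennreal_plus[symmetric] algebra_simps del: ennreal_plus)
    finally show ?thesis .
  qed

  define Err where "Err = (\<lambda>z. E0 z + (\<Sum>j=1..L. E2 j z))"
  define K0 where "K0 = K\<^sub>g * (1 + 2 powr ?q * C\<^sub>r) + (\<Sum>j=1..L. 2 * moment_const C (\<gamma> j))"
  have K0: "0 \<le> K0"
    unfolding K0_def using Kg nonneg
    by (intro add_nonneg_nonneg sum_nonneg mult_nonneg_nonneg moment_const_nonneg) auto
  have [measurable]: "Err \<in> borel_measurable ?J" unfolding Err_def by measurable
  have Err_int: "(\<integral>\<^sup>+ z. Err z \<partial>?J) \<le> ennreal (s * \<tau> * K0)"
  proof -
    have "(\<integral>\<^sup>+ z. Err z \<partial>?J) = (\<integral>\<^sup>+ z. E0 z \<partial>?J) + (\<Sum>j=1..L. \<integral>\<^sup>+ z. E2 j z \<partial>?J)"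
    proof -
      have "(\<integral>\<^sup>+ z. (\<Sum>j=1..L. E2 j z) \<partial>?J) = (\<Sum>j=1..L. \<integral>\<^sup>+ z. E2 j z \<partial>?J)"
        by (rule nn_integral_sum) (rule E2)
      moreover have "(\<lambda>z. \<Sum>j=1..L. E2 j z) \<in> borel_measurable ?J"
        by (intro borel_measurable_sum E2)
      ultimately show ?thesis unfolding Err_def by (subst nn_integral_add) simp_all
    qed
    also have "\<dots> \<le> ennreal (s * \<tau> * (K\<^sub>g * (1 + 2 powr ?q * C\<^sub>r))) + (\<Sum>j=1..L. ennreal (s * \<tau> * (2 * moment_const C (\<gamma> j))))"
      by (intro add_mono sum_mono E0_int E2_int)
    also have "\<dots> = ennreal (s * \<tau> * (K\<^sub>g * (1 + 2 powr ?q * C\<^sub>r)) + (\<Sum>j=1..L. s * \<tau> * (2 * moment_const C (\<gamma> j))))"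
    proof -
      have n: "0 \<le> s * \<tau> * (2 * moment_const C (\<gamma> j))" for j
        using s_pos pos moment_const_nonneg[of C "\<gamma> j"] by (intro mult_nonneg_nonneg) auto
      have "0 \<le> s * \<tau> * (K\<^sub>g * (1 + 2 powr ?q * C\<^sub>r))"
        using s_pos pos Kg nonneg by (intro mult_nonneg_nonneg add_nonneg_nonneg) auto
      moreover have "0 \<le> (\<Sum>j=1..L. s * \<tau> * (2 * moment_const C (\<gamma> j)))"
        by (intro sum_nonneg n)
      ultimately show ?thesis
        unfolding sum_ennreal[OF n] by (rule ennreal_plus[symmetric])
    qed
    also have "s * \<tau> * (K\<^sub>g * (1 + 2 powr ?q * C\<^sub>r)) + (\<Sum>j=1..L. s * \<tau> * (2 * moment_const C (\<gamma> j))) = s * \<tau> * K0"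
      unfolding K0_def by (simp add: distrib_left sum_distrib_left)
    finally show ?thesis .
  qed
  \<comment> \<open>The majorants may be infinite, but only on a null set, so the error can be
    replaced by a real-valued function.\<close>
  have Err_fin: "AE z in ?J. Err z \<noteq> \<infinity>"
    by (rule nn_integral_PInf_AE) (use Err_int in \<open>auto simp: top_unique\<close>)
  define e where "e = (\<lambda>z. enn2real (Err z))"
  have Err_e: "AE z in ?J. Err z = ennreal (e z)"
    using Err_fin by eventually_elim (auto simp: e_def less_top)
  have [measurable]: "e \<in> borel_measurable ?J" unfolding e_def by measurable
  have e_nn: "(\<integral>\<^sup>+ z. ennreal (e z) \<partial>?J) \<le> ennreal (s * \<tau> * K0)"
    using Err_int Err_e by (subst nn_integral_cong_AE[of _ Err]) (auto elim: eventually_mono)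
  have e: "integrable ?J e"
    by (rule integrableI_nonneg) (use e_nn in \<open>auto simp: e_def intro: order.strict_trans1\<close>)
  have e_int: "(\<integral>z. e z \<partial>?J) \<le> s * \<tau> * K0"
  proof -
    have "ennreal (\<integral>z. e z \<partial>?J) \<le> ennreal (s * \<tau> * K0)"
      using e_nn e by (subst nn_integral_eq_integral[symmetric]) (auto simp: e_def)
    thus ?thesis using s_pos pos K0 by (subst (asm) ennreal_le_iff) auto
  qed

  obtain opt where opt: "integrable ?A opt" "AE x in ?A. opt_value S \<psi> x = opt x"
    using regularity unfolding regularity_condition_def by (auto elim: completion_ex_integrable)
  have [measurable]: "opt \<in> borel_measurable ?A" using opt by auto
  have opt1: "integrable ?J (\<lambda>z. opt (fst z))" "(\<integral>z. opt (fst z) \<partial>?J) = (\<integral>x. opt x \<partial>?A)"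
  proof -
    have "integrable (distr ?J ?A fst) opt" using opt(1) by (simp add: distr_joint_source[OF I])
    thus "integrable ?J (\<lambda>z. opt (fst z))" by (subst (asm) integrable_distr_eq) auto
    have "(\<integral>x. opt x \<partial>?A) = (\<integral>x. opt x \<partial>distr ?J ?A fst)" by (simp only: distr_joint_source[OF I])
    also have "\<dots> = (\<integral>z. opt (fst z) \<partial>?J)" by (rule integral_distr) measurable
    finally show "(\<integral>z. opt (fst z) \<partial>?J) = (\<integral>x. opt x \<partial>?A)" ..
  qed
  have opt2: "integrable ?J (\<lambda>z. opt (?X z))" "(\<integral>z. opt (?X z) \<partial>?J) = (\<integral>x. opt x \<partial>?A)"
  proof -
    have "integrable (distr ?J ?A ?X) opt" using opt(1) by (simp add: distr_joint_target[OF I])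
    thus "integrable ?J (\<lambda>z. opt (?X z))" by (subst (asm) integrable_distr_eq) auto
    have "(\<integral>x. opt x \<partial>?A) = (\<integral>x. opt x \<partial>distr ?J ?A ?X)" by (simp only: distr_joint_target[OF I])
    also have "\<dots> = (\<integral>z. opt (?X z) \<partial>?J)" by (rule integral_distr) measurable
    finally show "(\<integral>z. opt (?X z) \<partial>?J) = (\<integral>x. opt x \<partial>?A)" ..
  qed
  have good: "AE x in ?A. opt_value S \<psi> x = opt x \<and> (\<exists>\<omega>. is_minimizer S \<psi> x \<omega>)"
    using opt(2) AE_ex_minimizer[OF uniqueness] by eventually_elim auto
  have good1: "AE z in ?J. opt_value S \<psi> (fst z) = opt (fst z) \<and> (\<exists>\<omega>. is_minimizer S \<psi> (fst z) \<omega>)"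
    by (rule AE_distrD[of _ _ ?A]) (measurable, simp only: distr_joint_source[OF I] good)
  have good2: "AE z in ?J. opt_value S \<psi> (?X z) = opt (?X z) \<and> (\<exists>\<omega>. is_minimizer S \<psi> (?X z) \<omega>)"
    by (rule AE_distrD[of _ _ ?A]) (measurable, simp only: distr_joint_target[OF I] good)

  have "prob_space (distr ?J ?A fst)"
    unfolding distr_joint_source[OF I] by (intro prob_space_PiM prob_P)
  hence psJ: "prob_space ?J" by (rule prob_space_distrD[rotated]) measurable
  interpret J: prob_space ?J by (rule psJ)
  \<comment> \<open>The Taylor bound solved for the linear term in the proposals and divided by
    \<open>s\<close>.\<close>
  define g where "g = (\<lambda>z. (opt (fst z) - opt (?X z) + \<theta> + e z) / s)"
  have g: "integrable ?J g"
    unfolding g_def using opt1 opt2 e by simp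
  have "(\<integral>z. g z \<partial>?J) = (\<theta> + (\<integral>z. e z \<partial>?J)) / s"
    unfolding g_def using opt1 opt2 e by (simp add: J.prob_space)
  also have "\<dots> \<le> (C * (s * \<tau>) + s * \<tau> * K0) / s"
    using \<theta>_le e_int s_pos by (intro divide_right_mono add_mono) auto
  also have "\<dots> = \<tau> * K" using s_pos by (simp add: K_def K0_def field_simps)
  finally have g_int: "(\<integral>z. g z \<partial>?J) \<le> \<tau> * K" .

  have "AE z in ?J. (\<lambda>(x, v). \<forall>\<omega>\<in>?N x. pairing I (\<lambda>i. - H i x \<omega>) (\<lambda>i. fst (v i)) \<le> g (x, v)) z"
    using AE_joint_taylor[OF I taylor] good1 good2 Err_e scaling[unfolded remainder_scaling_def] AE_space
  proof eventually_elim
    case (elim z)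
    obtain x w where z: "z = (x, w)" by (cases z)
    let ?y = "?X (x, w)" and ?d = "\<lambda>i. displacement s (x i) (w i)"
    let ?V = "\<lambda>i\<in>I. snd (T (x i, w i))"
    have xs: "x \<in> space ?A" and xI: "x \<in> I \<rightarrow>\<^sub>E UNIV"
      using elim(6) by (auto simp: z space_joint[OF I] space_PiM)
    have ys: "?y \<in> space ?A" and yI: "?y \<in> I \<rightarrow>\<^sub>E UNIV"
      by (auto simp: target_def[OF I] space_PiM)
    have VI: "?V \<in> I \<rightarrow>\<^sub>E UNIV" by auto
    have fstTT: "(\<lambda>i\<in>I. fst (?TT (x, w) i)) = x"
      using xI by (auto simp: fst_T fun_eq_iff PiE_def extensional_def)
    have sndTT: "(\<lambda>i\<in>I. snd (?TT (x, w) i)) = ?V"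
      by (auto simp: fun_eq_iff)
    have TTs: "?TT (x, w) \<in> space (PiM I (\<lambda>_. ?Q))"
      using measurable_space[OF TT, of "(x, w)"] elim(6) unfolding z by (simp only: space_PiM space_distr)
    show ?case unfolding z prod.case
    proof
      fix \<omega> assume \<omega>: "\<omega> \<in> ?N x"
      hence \<omega>S: "\<omega> \<in> mspace S" and \<omega>opt: "\<psi> x \<omega> \<le> opt x + \<theta>"
        using elim(2) by (auto simp: near_opt_def z)
      \<comment> \<open>The point \<open>\<omega>\<close> is near-optimal for \<open>x\<close> but
        merely a competitor at the moved input, where it bounds the optimum from above.\<close>
      obtain \<omega>0 where "is_minimizer S \<psi> ?y \<omega>0" using elim(3) by (auto simp: z)
      hence "opt_value S \<psi> ?y \<le> \<psi> ?y \<omega>" using \<omega>S by (rule opt_value_le)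
      hence 1: "opt ?y \<le> \<psi> ?y \<omega>" using elim(3) by (simp add: z)
      have 2: "\<psi> ?y \<omega> - \<psi> x \<omega> \<le> (\<Sum>i\<in>I. (s *\<^sub>R ?d i) \<bullet> H i x \<omega>) +
          (\<Sum>j=1..L. R j x (\<lambda>i\<in>I. s *\<^sub>R ?d i) \<omega> * R' j ?y)"
        using elim(1) \<omega>S by (simp add: z)
      \<comment> \<open>The displacement is exchanged for the Gaussian proposal; Cauchy-Schwarz
        bounds the cost by the error norms weighted with the gradients.\<close>
      have 3: "(\<Sum>i\<in>I. (s *\<^sub>R ?d i) \<bullet> H i x \<omega>) \<le> (\<Sum>i\<in>I. (s *\<^sub>R fst (w i)) \<bullet> H i x \<omega>) +
          (\<Sum>i\<in>I. s * norm (err (x i, w i)) * norm (H i x \<omega>))"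
        unfolding sum.distrib[symmetric]
      proof (rule sum_mono)
        fix i
        have "err (x i, w i) \<bullet> H i x \<omega> \<le> norm (err (x i, w i)) * norm (H i x \<omega>)"
          by (rule norm_cauchy_schwarz)
        hence "s * (err (x i, w i) \<bullet> H i x \<omega>) \<le> s * (norm (err (x i, w i)) * norm (H i x \<omega>))"
          using s_pos by (intro mult_left_mono) auto
        thus "(s *\<^sub>R ?d i) \<bullet> H i x \<omega> \<le> (s *\<^sub>R fst (w i)) \<bullet> H i x \<omega> + s * norm (err (x i, w i)) * norm (H i x \<omega>)"
          by (simp add: err_def inner_diff_left right_diff_distrib mult.assoc)
      qed
      have 4: "(\<Sum>j=1..L. R j x (\<lambda>i\<in>I. s *\<^sub>R ?d i) \<omega> * R' j ?y) \<le>
          (\<Sum>j=1..L. s powr (1 + \<upsilon> j) * R j x ?V \<omega> * R' j ?y)"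
        using elim(5) \<omega>S by (intro sum_mono mult_right_mono R_nonneg(2)[OF _ yI VI \<omega>S]) (auto simp: z)
      have "ennreal ((\<Sum>i\<in>I. s * norm (err (x i, w i)) * norm (H i x \<omega>)) +
          (\<Sum>j=1..L. s powr (1 + \<upsilon> j) * R j x ?V \<omega> * R' j ?y)) =
        ennreal (\<Sum>i\<in>I. s * norm (err (x i, w i)) * norm (H i x \<omega>)) +
          (\<Sum>j=1..L. ennreal (s powr (1 + \<upsilon> j) * R j x ?V \<omega> * R' j ?y))"
      proof -
        have n: "0 \<le> s powr (1 + \<upsilon> j) * R j x ?V \<omega> * R' j ?y" if "j \<in> {1..L}" for j
          using that by (intro mult_nonneg_nonneg R_nonneg[OF _ xI VI \<omega>S] R_nonneg(2)[OF _ yI VI \<omega>S]) auto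
        have "0 \<le> (\<Sum>i\<in>I. s * norm (err (x i, w i)) * norm (H i x \<omega>))"
          using s_pos by (intro sum_nonneg mult_nonneg_nonneg) auto
        moreover have "0 \<le> (\<Sum>j=1..L. s powr (1 + \<upsilon> j) * R j x ?V \<omega> * R' j ?y)"
          by (intro sum_nonneg n)
        moreover have "(\<Sum>j=1..L. ennreal (s powr (1 + \<upsilon> j) * R j x ?V \<omega> * R' j ?y)) =
            ennreal (\<Sum>j=1..L. s powr (1 + \<upsilon> j) * R j x ?V \<omega> * R' j ?y)"
          by (rule sum_ennreal) (rule n)
        ultimately show ?thesis by (simp only: ennreal_plus)
      qed
      also have "\<dots> \<le> Err z"
        unfolding Err_def
      proof (intro add_mono sum_mono)
        have "ennreal (\<Sum>i\<in>I. s * norm (err (x i, w i)) * norm (H i x \<omega>)) \<le>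
          ennreal (s * \<tau>) * (u\<^sub>H x + ennreal (K\<^sub>g * (\<Sum>i\<in>I. (s * norm (err (x i, w i)) * \<sigma> / (s * \<tau>)) powr ?q)))"
          using s_pos pos by (intro uH_ge[OF xs \<omega>]) auto
        also have "(\<Sum>i\<in>I. (s * norm (err (x i, w i)) * \<sigma> / (s * \<tau>)) powr ?q) =
            (\<Sum>i\<in>I. (norm (err (x i, w i)) * \<sigma> / \<tau>) powr ?q)"
          using s_pos by (simp add: mult.assoc)
        also have "ennreal (K\<^sub>g * (\<Sum>i\<in>I. (norm (err (x i, w i)) * \<sigma> / \<tau>) powr ?q)) = ennreal K\<^sub>g * E1 z"
          using Kg by (simp add: E1_def z ennreal_mult sum_nonneg)
        finally show "ennreal (\<Sum>i\<in>I. s * norm (err (x i, w i)) * norm (H i x \<omega>)) \<le> E0 z"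
          by (simp add: E0_def z)
      next
        fix j assume j: "j \<in> {1..L}"
        have "ennreal (s powr (1 + \<upsilon> j) * R j x ?V \<omega> * R' j ?y) =
            ennreal (s powr (1 + \<upsilon> j)) * (ennreal (R j x ?V \<omega>) * ennreal (R' j ?y))"
          using R_nonneg(1)[OF j xI VI \<omega>S] R_nonneg(2)[OF j yI VI \<omega>S]
          by (simp add: ennreal_mult mult.assoc)
        also have "ennreal (R j x ?V \<omega>) * ennreal (R' j ?y) \<le>
            ennreal (\<nu> j * \<nu>' j) * (u j (?TT (x, w)) + v j ?y)"
          using uv(5)[OF j TTs ys] \<omega> unfolding fstTT sndTT by blast
        finally show "ennreal (s powr (1 + \<upsilon> j) * R j x ?V \<omega> * R' j ?y) \<le> E2 j z"
          unfolding E2_def z using pos(4,5)[OF j] by (simp add: ennreal_mult mult.assoc mult_left_mono)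
      qed
      also have "Err z = ennreal (e z)" by (rule elim(4))
      finally have 5: "(\<Sum>i\<in>I. s * norm (err (x i, w i)) * norm (H i x \<omega>)) +
          (\<Sum>j=1..L. s powr (1 + \<upsilon> j) * R j x ?V \<omega> * R' j ?y) \<le> e z"
        by (subst (asm) ennreal_le_iff) (auto simp: e_def)
      have "(\<Sum>i\<in>I. (s *\<^sub>R fst (w i)) \<bullet> H i x \<omega>) = - s * pairing I (\<lambda>i. - H i x \<omega>) (\<lambda>i. fst (w i))"
        by (simp add: pairing_def sum_distrib_left inner_commute sum_negf)
      with 1 2 3 4 5 \<omega>opt
      have "s * pairing I (\<lambda>i. - H i x \<omega>) (\<lambda>i. fst (w i)) \<le> opt x - opt ?y + \<theta> + e z"
        by linarith
      thus "pairing I (\<lambda>i. - H i x \<omega>) (\<lambda>i. fst (w i)) \<le> g (x, w)"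
        using s_pos by (simp add: g_def z field_simps)
    qed
  qed
  hence bound: "AE (x, v) in ?J. \<forall>\<omega>\<in>?N x. pairing I (\<lambda>i. - H i x \<omega>) (\<lambda>i. fst (v i)) \<le> g (x, v)" .
  have nonempty: "AE x in ?A. ?N x \<noteq> {}"
    using AE_ex_minimizer[OF uniqueness]
  proof eventually_elim
    case (elim x)
    then obtain \<omega> where "is_minimizer S \<psi> x \<omega>" ..
    from minimizer_near_opt[OF this pos(1)] show ?case by blast
  qed
  have "outer_measure_of ?A (separated_event ?A ?N (gradient_dist I H) (\<tau> * \<kappa>) M) \<le> ennreal ((\<integral>z. g z \<partial>?J) / (B * (\<tau> * \<kappa>)))"
    using \<kappa> pos by (intro outer_measure_packing_le[OF I g bound nonempty B _ M]) auto
  also have "\<dots> \<le> ennreal (\<tau> * K / (B * (\<tau> * \<kappa>)))"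
    using g_int \<kappa> B pos by (intro ennreal_leI divide_right_mono) auto
  also have "\<tau> * K / (B * (\<tau> * \<kappa>)) = K / (B * \<kappa>)" using pos by simp
  finally show ?thesis .
qed

end

subsection \<open>Tightness of the packing numbers\<close>

lemma outer_measure_of_Un_le: "outer_measure_of M (A \<union> B) \<le> outer_measure_of M A + outer_measure_of M B"
proof (cases "A \<subseteq> space M \<and> B \<subseteq> space M")
  case True
  then obtain A' B' where A': "A' \<in> sets M" "A \<subseteq> A'" "outer_measure_of M A = emeasure M A'"
    and B': "B' \<in> sets M" "B \<subseteq> B'" "outer_measure_of M B = emeasure M B'"
    by (meson outer_measure_of_attain)
  have "outer_measure_of M (A \<union> B) \<le> outer_measure_of M (A' \<union> B')"
    using A' B' by (intro outer_measure_of_mono) auto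
  also have "\<dots> \<le> emeasure M A' + emeasure M B'"
    using A' B' by (simp add: emeasure_subadditive)
  finally show ?thesis using A' B' by simp
next
  case False
  have "outer_measure_of M C = \<top>" if "\<not> C \<subseteq> space M" for C
  proof -
    \<comment> \<open>Without a measurable superset the infimum runs over the empty set and is
      infinite, so the inequality is trivial.\<close>
    have empty: "{C' \<in> sets M. C \<subseteq> C'} = {}" using that sets.sets_into_space by blast
    show ?thesis unfolding outer_measure_of_def empty by simp
  qed
  with False show ?thesis by (auto simp: top_unique)
qed

text \<open>Stated for all larger constants, so that the constants of several assumptions can be
  merged into one.\<close>

lemma ennreal_bigoE:
  assumes "ennreal_bigo a b" "\<And>n. n \<ge> 1 \<Longrightarrow> 0 < b n"
  obtains C where "0 \<le> C" "\<forall>\<^sub>F n in sequentially. \<forall>C'\<ge>C. a n \<le> ennreal (C' * b n)"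
proof -
  obtain C where "\<forall>\<^sub>F n in sequentially. a n \<le> ennreal (C * b n)"
    using assms(1) unfolding ennreal_bigo_def by blast
  hence "\<forall>\<^sub>F n in sequentially. \<forall>C'\<ge>max C 0. a n \<le> ennreal (C' * b n)"
    using eventually_ge_at_top[of 1]
  proof eventually_elim
    case (elim n)
    have "C * b n \<le> C' * b n" if "C' \<ge> max C 0" for C'
      using that assms(2)[OF elim(2)] by (intro mult_right_mono) auto
    thus ?case using elim(1) by (meson ennreal_leI order.trans)
  qed
  thus ?thesis by (intro that[of "max C 0"]) auto
qed

lemma ennreal_bigo_uniformE:
  assumes "finite J" "\<And>j. j \<in> J \<Longrightarrow> ennreal_bigo (a j) (b j)" "\<And>j n. j \<in> J \<Longrightarrow> n \<ge> 1 \<Longrightarrow> 0 < b j n"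
  obtains C where "0 \<le> C" "\<forall>\<^sub>F n in sequentially. \<forall>j\<in>J. \<forall>C'\<ge>C. a j n \<le> ennreal (C' * b j n)"
proof -
  have "\<exists>C. 0 \<le> C \<and> (\<forall>\<^sub>F n in sequentially. \<forall>C'\<ge>C. a j n \<le> ennreal (C' * b j n))" if j: "j \<in> J" for j
  proof -
    from ennreal_bigoE[OF assms(2)[OF j] assms(3)[OF j]] show ?thesis by blast
  qed
  hence "\<forall>j\<in>J. \<exists>C. 0 \<le> C \<and> (\<forall>\<^sub>F n in sequentially. \<forall>C'\<ge>C. a j n \<le> ennreal (C' * b j n))" by blast
  from bchoice[OF this] obtain c where
    "\<forall>j\<in>J. 0 \<le> c j \<and> (\<forall>\<^sub>F n in sequentially. \<forall>C'\<ge>c j. a j n \<le> ennreal (C' * b j n))" ..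
  hence c: "\<And>j. j \<in> J \<Longrightarrow> 0 \<le> c j"
    "\<And>j. j \<in> J \<Longrightarrow> \<forall>\<^sub>F n in sequentially. \<forall>C'\<ge>c j. a j n \<le> ennreal (C' * b j n)"
    by simp_all
  have le: "c j \<le> (\<Sum>j\<in>J. c j)" if "j \<in> J" for j
    using that assms(1) c(1) by (intro member_le_sum) auto
  have "\<forall>\<^sub>F n in sequentially. \<forall>j\<in>J. \<forall>C'\<ge>c j. a j n \<le> ennreal (C' * b j n)"
    using assms(1) c(2) by (intro eventually_ball_finite) auto
  hence "\<forall>\<^sub>F n in sequentially. \<forall>j\<in>J. \<forall>C'\<ge>(\<Sum>j\<in>J. c j). a j n \<le> ennreal (C' * b j n)"
    by eventually_elim (use le order.trans in blast)
  thus ?thesis by (intro that[of "\<Sum>j\<in>J. c j"]) (auto intro: sum_nonneg c)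
qed

context proposal
begin

lemma AE_joint_component:
  assumes "finite I" "AE z in moves. Q z"
  shows "AE (x, v) in joint I. \<forall>i\<in>I. Q (x i, v i)"
proof -
  let ?\<Phi> = "\<lambda>(x, v). \<lambda>i\<in>I. (\<lambda>z. z) (x i, v i)"
  have "AE z in PiM I (\<lambda>_. moves). \<forall>i\<in>I. Q (z i)"
    using assms prob_space_moves by (intro AE_finite_allI AE_PiM_component) auto
  hence ae: "AE z in PiM I (\<lambda>_. distr moves moves (\<lambda>z. z)). \<forall>i\<in>I. Q (z i)"
    by (simp only: distr_id)
  have eq: "distr (joint I) (PiM I (\<lambda>_. moves)) ?\<Phi> = PiM I (\<lambda>_. distr moves moves (\<lambda>z. z))"
    by (rule distr_joint[OF assms(1)]) measurable
  have m: "?\<Phi> \<in> joint I \<rightarrow>\<^sub>M PiM I (\<lambda>_. moves)"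
    by (rule measurable_joint[OF assms(1)]) measurable
  have "AE z in distr (joint I) (PiM I (\<lambda>_. moves)) ?\<Phi>. \<forall>i\<in>I. Q (z i)"
    unfolding eq by (rule ae)
  with m have "AE z in joint I. \<forall>i\<in>I. Q (?\<Phi> z i)" by (rule AE_distrD)
  thus ?thesis by eventually_elim (auto simp: case_prod_unfold)
qed

lemma remainder_scaling_homogeneous:
  assumes "finite I" "\<forall>j\<in>{1..L}. remainder_homogeneous I S (\<upsilon> j) (R j)"
  shows "remainder_scaling I S L \<upsilon> R (\<lambda>(x, v). (x, displacement s x v))"
  unfolding remainder_scaling_def using AE_space
proof eventually_elim
  case (elim z)
  obtain x v where z: "z = (x, v)" by (cases z)
  have x: "x \<in> I \<rightarrow>\<^sub>E UNIV" using elim by (auto simp: z space_joint[OF assms(1)] space_PiM)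
  have eq: "(\<lambda>i\<in>I. s *\<^sub>R displacement s (x i) (v i)) = (\<lambda>i\<in>I. s *\<^sub>R (\<lambda>i\<in>I. displacement s (x i) (v i)) i)"
    by auto
  have "R j x (\<lambda>i\<in>I. s *\<^sub>R displacement s (x i) (v i)) \<omega> = s powr (1 + \<upsilon> j) * R j x (\<lambda>i\<in>I. displacement s (x i) (v i)) \<omega>"
    if "j \<in> {1..L}" "\<omega> \<in> mspace S" for j \<omega>
  proof -
    have "remainder_homogeneous I S (\<upsilon> j) (R j)" using assms(2) that(1) by blast
    moreover have "(\<lambda>i\<in>I. displacement s (x i) (v i)) \<in> I \<rightarrow>\<^sub>E UNIV" by auto
    ultimately show ?thesis
      unfolding eq remainder_homogeneous_def using x s_pos that(2) by blast
  qed
  thus ?case by (simp add: z)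
qed

text \<open>Coordinatewise domination of the displacement by the proposal gives the domination of
  norms that the monotone condition asks for.\<close>

lemma remainder_scaling_monotone:
  assumes "finite I" "\<forall>j\<in>{1..L}. remainder_monotone I S (\<upsilon> j) (R j)"
  shows "remainder_scaling I S L \<upsilon> R (\<lambda>(x, v). (x, fst v))"
  unfolding remainder_scaling_def using AE_space AE_joint_component[OF assms(1) AE_displacement_le]
proof eventually_elim
  case (elim z)
  obtain x v where z: "z = (x, v)" by (cases z)
  have x: "x \<in> I \<rightarrow>\<^sub>E UNIV" using elim by (auto simp: z space_joint[OF assms(1)] space_PiM)
  have eq: "(\<lambda>i\<in>I. s *\<^sub>R displacement s (x i) (v i)) = (\<lambda>i\<in>I. s *\<^sub>R (\<lambda>i\<in>I. displacement s (x i) (v i)) i)"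
    by auto
  have "norm (displacement s (x i) (v i)) \<le> norm (fst (v i))" if "i \<in> I" for i
    using elim(2) that by (intro norm_le_componentwise_cart) (auto simp: z)
  hence le: "\<forall>i\<in>I. norm ((\<lambda>i\<in>I. displacement s (x i) (v i)) i) \<le> norm ((\<lambda>i\<in>I. fst (v i)) i)" by simp
  have "R j x (\<lambda>i\<in>I. s *\<^sub>R displacement s (x i) (v i)) \<omega> \<le> s powr (1 + \<upsilon> j) * R j x (\<lambda>i\<in>I. fst (v i)) \<omega>"
    if "j \<in> {1..L}" "\<omega> \<in> mspace S" for j \<omega>
  proof -
    have "remainder_monotone I S (\<upsilon> j) (R j)" using assms(2) that(1) by blast
    moreover have "(\<lambda>i\<in>I. displacement s (x i) (v i)) \<in> I \<rightarrow>\<^sub>E UNIV" "(\<lambda>i\<in>I. fst (v i)) \<in> I \<rightarrow>\<^sub>E UNIV" by auto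
    ultimately show ?thesis
      unfolding eq remainder_monotone_def using x s_pos that(2) le by blast
  qed
  thus ?case by (simp add: z)
qed

end

theorem theorem2p1p6:
  fixes P :: "(real ^ 'd) measure"
    and I :: "nat \<Rightarrow> 'i set"
    and S :: "nat \<Rightarrow> 's metric"
    and \<psi> :: "nat \<Rightarrow> ('i \<Rightarrow> real ^ 'd) \<Rightarrow> 's \<Rightarrow> real"
    and L :: nat
    and H :: "nat \<Rightarrow> 'i \<Rightarrow> ('i \<Rightarrow> real ^ 'd) \<Rightarrow> 's \<Rightarrow> real ^ 'd"
    and R :: "nat \<Rightarrow> nat \<Rightarrow> ('i \<Rightarrow> real ^ 'd) \<Rightarrow> ('i \<Rightarrow> real ^ 'd) \<Rightarrow> 's \<Rightarrow> real"
    and R' :: "nat \<Rightarrow> nat \<Rightarrow> ('i \<Rightarrow> real ^ 'd) \<Rightarrow> real"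
    and \<upsilon> :: "nat \<Rightarrow> real"
    and \<theta> \<sigma> \<tau> :: "nat \<Rightarrow> real"
    and lam \<epsilon>0 :: real
    and \<gamma> :: "nat \<Rightarrow> ennreal"
    and \<nu> \<nu>' :: "nat \<Rightarrow> nat \<Rightarrow> real"
  assumes problems: "\<And>n. n \<ge> 1 \<Longrightarrow> random_min_problem P (I n) (S n) (\<psi> n)"
    and diam: "\<exists>D. \<forall>n\<ge>1. \<forall>\<omega>1\<in>mspace (S n). \<forall>\<omega>2\<in>mspace (S n). mdist (S n) \<omega>1 \<omega>2 \<le> D"
    and uniqueness: "\<And>n. n \<ge> 1 \<Longrightarrow> uniqueness_condition P (I n) (S n) (\<psi> n)"
    and regularity: "\<And>n. n \<ge> 1 \<Longrightarrow> regularity_condition P (I n) (S n) (\<psi> n)"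
    and L: "L \<ge> 1"
    and taylor_measurable: "\<And>n. n \<ge> 1 \<Longrightarrow> taylor_measurable P (I n) (S n) L (H n) (R n) (R' n)"
    and B1: "\<And>n. n \<ge> 1 \<Longrightarrow> taylor_bound (I n) (S n) (\<psi> n) L (H n) (R n) (R' n)"
    and \<upsilon>_pos: "\<And>j. j \<in> {1..L} \<Longrightarrow> 0 < \<upsilon> j"
    and rejection: "rejection_condition P"
    and \<theta>_pos: "\<And>n. n \<ge> 1 \<Longrightarrow> 0 < \<theta> n"
    and lam_nonneg: "0 \<le> lam"
    and \<sigma>_pos: "\<And>n. n \<ge> 1 \<Longrightarrow> 0 < \<sigma> n"
    and C1: "ennreal_bigo (\<lambda>n. gradient_moment P (I n) (near_opt (S n) (\<psi> n) (\<theta> n)) (H n) lam) \<sigma>"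
    and \<nu>_pos: "\<And>j n. j \<in> {1..L} \<Longrightarrow> n \<ge> 1 \<Longrightarrow> 0 < \<nu> n j \<and> 0 < \<nu>' n j"
    and B2_C2:
      "((\<forall>n\<ge>1. \<forall>j\<in>{1..L}. remainder_homogeneous (I n) (S n) (\<upsilon> j) (R n j)) \<and>
        (\<forall>j\<in>{1..L}. \<forall>Q. (\<forall>n\<ge>1. sub_gaussian_coupling P (Q n)) \<longrightarrow>
           ennreal_bigo (\<lambda>n. remainder_moment (Q n) (I n) (near_opt (S n) (\<psi> n) (\<theta> n)) (R n j) (\<gamma> j)) (\<lambda>n. \<nu> n j)))
       \<or>
       ((\<forall>n\<ge>1. \<forall>j\<in>{1..L}. remainder_monotone (I n) (S n) (\<upsilon> j) (R n j)) \<and>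
        (\<forall>j\<in>{1..L}.
           ennreal_bigo (\<lambda>n. remainder_moment (P \<Otimes>\<^sub>M std_gaussian) (I n) (near_opt (S n) (\<psi> n) (\<theta> n)) (R n j) (\<gamma> j))
             (\<lambda>n. \<nu> n j)))"
    and C2': "\<And>j. j \<in> {1..L} \<Longrightarrow>
      ennreal_bigo (\<lambda>n. Lp_norm (PiM (I n) (\<lambda>_. P)) (1 + \<gamma> j) (\<lambda>x. ennreal (R' n j x))) (\<lambda>n. \<nu>' n j)"
    and \<epsilon>0_pos: "0 < \<epsilon>0"
    and \<tau>_pos: "\<And>n. n \<ge> 1 \<Longrightarrow> 0 < \<tau> n"
    and C3: "\<And>\<epsilon> \<delta>. 0 < \<epsilon> \<Longrightarrow> \<epsilon> < \<epsilon>0 \<Longrightarrow> 0 < \<delta> \<Longrightarrow>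
      \<exists>\<kappa>>0. \<exists>K::nat.
        limsup (\<lambda>n. outer_measure_of (PiM (I n) (\<lambda>_. P))
          {x \<in> space (PiM (I n) (\<lambda>_. P)).
             packing_number (near_opt (S n) (\<psi> n) (\<theta> n) x) (mdist (S n)) \<epsilon>
               > enat K * packing_number (near_opt (S n) (\<psi> n) (\<theta> n) x) (gradient_dist (I n) (H n) x) (\<tau> n * \<kappa>)})
        \<le> ennreal \<delta>"
    and \<theta>_bound: "\<theta> \<in> O(\<lambda>n. \<tau> n *
      min (\<tau> n powr (1 + lam) / (real (card (I n)) * \<sigma> n powr (1 + lam)))
          (MIN j\<in>{1..L}. (\<tau> n / (\<nu> n j * \<nu>' n j)) powr (1 / \<upsilon> j)))"
  shows "\<forall>\<epsilon>>0. tight_family {1..} (\<lambda>n. PiM (I n) (\<lambda>_. P))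
           (\<lambda>n x. packing_number (near_opt (S n) (\<psi> n) (\<theta> n) x) (mdist (S n)) \<epsilon>)"
proof -
  let ?N = "\<lambda>n. near_opt (S n) (\<psi> n) (\<theta> n)" and ?A = "\<lambda>n. PiM (I n) (\<lambda>_. P)"
  define q where "q = 1 + lam"
  define s where "s = (\<lambda>n. min (\<tau> n powr q / (real (card (I n)) * \<sigma> n powr q))
          (MIN j\<in>{1..L}. (\<tau> n / (\<nu> n j * \<nu>' n j)) powr (1 / \<upsilon> j)))"
  have prob_P: "prob_space P" using problems[of 1] by (simp add: random_min_problem_def)
  have finI: "finite (I n)" and cardI: "0 < card (I n)" if "n \<ge> 1" for n
    using problems[OF that] by (auto simp: random_min_problem_def card_gt_0_iff)
  obtain f where f: "f \<in> borel_measurable borel" "\<And>x. 0 \<le> f x" "P = density lborel (\<lambda>x. ennreal (f x))"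
    and rej: "\<forall>p\<ge>0. \<exists>C>0. \<forall>s\<ge>0.
      (\<integral>\<^sup>+ (x, w). ennreal (norm w powr p * max 0 (1 - f (x + s *\<^sub>R w) / f x)) \<partial>(P \<Otimes>\<^sub>M std_gaussian)) \<le> ennreal (C * s)"
    using rejection unfolding rejection_condition_def by blast
  obtain Cr where Cr: "0 < Cr" "\<And>s. 0 \<le> s \<Longrightarrow>
      (\<integral>\<^sup>+ (x, w). ennreal (norm w powr q * max 0 (1 - f (x + s *\<^sub>R w) / f x)) \<partial>(P \<Otimes>\<^sub>M std_gaussian)) \<le> ennreal (Cr * s)"
    using rej[rule_format, of q] lam_nonneg by (auto simp: q_def)
  have proposal: "proposal P f t" if "0 < t" for t
    by (rule proposal.intro[OF f prob_P that])
  have s_pos: "0 < s n" if n: "n \<ge> 1" for n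
  proof -
    have "0 < (\<tau> n / (\<nu> n j * \<nu>' n j)) powr (1 / \<upsilon> j)" if "j \<in> {1..L}" for j
      using \<nu>_pos[OF that n] \<tau>_pos[OF n] by auto
    hence "0 < (MIN j\<in>{1..L}. (\<tau> n / (\<nu> n j * \<nu>' n j)) powr (1 / \<upsilon> j))"
      using L by (subst Min_gr_iff) auto
    thus ?thesis using \<tau>_pos[OF n] \<sigma>_pos[OF n] cardI[OF n] by (simp add: s_def)
  qed
  have s1: "real (card (I n)) * s n * \<sigma> n powr q \<le> \<tau> n powr q" if n: "n \<ge> 1" for n
  proof -
    have "s n \<le> \<tau> n powr q / (real (card (I n)) * \<sigma> n powr q)" by (simp add: s_def)
    thus ?thesis using \<sigma>_pos[OF n] cardI[OF n] by (simp add: field_simps)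
  qed
  have s2: "s n powr \<upsilon> j * (\<nu> n j * \<nu>' n j) \<le> \<tau> n" if n: "n \<ge> 1" and j: "j \<in> {1..L}" for n j
  proof -
    have "s n \<le> (MIN j\<in>{1..L}. (\<tau> n / (\<nu> n j * \<nu>' n j)) powr (1 / \<upsilon> j))" by (simp add: s_def)
    also have "\<dots> \<le> (\<tau> n / (\<nu> n j * \<nu>' n j)) powr (1 / \<upsilon> j)" using j by (intro Min_le) auto
    finally have "s n powr \<upsilon> j \<le> ((\<tau> n / (\<nu> n j * \<nu>' n j)) powr (1 / \<upsilon> j)) powr \<upsilon> j"
      using s_pos[OF n] \<upsilon>_pos[OF j] by (intro powr_mono2) auto
    also have "\<dots> = \<tau> n / (\<nu> n j * \<nu>' n j)"
      using \<nu>_pos[OF j n] \<tau>_pos[OF n] \<upsilon>_pos[OF j] by (simp add: powr_powr)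
    finally show ?thesis using \<nu>_pos[OF j n] by (simp add: field_simps)
  qed

  \<comment> \<open>The coupling changes with \<open>n\<close> through \<open>s n\<close>, so the
    moment assumption is applied to a whole sequence of couplings.\<close>
  define Q where "Q = (\<lambda>n. distr (proposal.moves P f (s n)) (borel \<Otimes>\<^sub>M borel) (\<lambda>(x, v). (x, displacement (s n) x v)))"
  have Q: "\<forall>n\<ge>1. sub_gaussian_coupling P (Q n)"
    unfolding Q_def using proposal.sub_gaussian_coupling_moves[OF proposal] s_pos by blast

  text \<open>In both cases \<open>T n\<close> maps a move to the pair to which the remainder moments refer.\<close>

  obtain E :: "nat \<Rightarrow> ((real ^ 'd) \<times> (real ^ 'd)) measure" and T
    where T: "\<And>n. n \<ge> 1 \<Longrightarrow> T n \<in> P \<Otimes>\<^sub>M (std_gaussian \<Otimes>\<^sub>M (P \<Otimes>\<^sub>M count_space UNIV)) \<rightarrow>\<^sub>M E n"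
      "\<And>n x v. fst (T n (x, v)) = x"
      and scaling: "\<And>n. n \<ge> 1 \<Longrightarrow> proposal.remainder_scaling P f (s n) (I n) (S n) L \<upsilon> (R n) (T n)"
      and C2: "\<And>j. j \<in> {1..L} \<Longrightarrow> ennreal_bigo (\<lambda>n. remainder_moment
        (distr (proposal.moves P f (s n)) (E n) (T n)) (I n) (?N n) (R n j) (\<gamma> j)) (\<lambda>n. \<nu> n j)"
    using B2_C2
  proof (elim disjE conjE)
    assume hom: "\<forall>n\<ge>1. \<forall>j\<in>{1..L}. remainder_homogeneous (I n) (S n) (\<upsilon> j) (R n j)"
      and C: "\<forall>j\<in>{1..L}. \<forall>Q. (\<forall>n\<ge>1. sub_gaussian_coupling P (Q n)) \<longrightarrow>
           ennreal_bigo (\<lambda>n. remainder_moment (Q n) (I n) (?N n) (R n j) (\<gamma> j)) (\<lambda>n. \<nu> n j)"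
    show ?thesis
    proof (rule that[of "\<lambda>n. (\<lambda>(x, v). (x, displacement (s n) x v))" "\<lambda>_. borel \<Otimes>\<^sub>M borel"])
      fix n :: nat assume n: "n \<ge> 1"
      interpret proposal P f "s n" by (rule proposal[OF s_pos[OF n]])
      show "(\<lambda>(x, v). (x, displacement (s n) x v)) \<in> P \<Otimes>\<^sub>M aux \<rightarrow>\<^sub>M borel \<Otimes>\<^sub>M borel"
        unfolding case_prod_unfold by measurable
      show "remainder_scaling (I n) (S n) L \<upsilon> (R n) (\<lambda>(x, v). (x, displacement (s n) x v))"
        using hom n by (intro remainder_scaling_homogeneous finI) auto
    next
      fix j assume "j \<in> {1..L}"
      with C Q have "ennreal_bigo (\<lambda>n. remainder_moment (Q n) (I n) (?N n) (R n j) (\<gamma> j)) (\<lambda>n. \<nu> n j)" by blast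
      thus "ennreal_bigo (\<lambda>n. remainder_moment (distr (proposal.moves P f (s n)) (borel \<Otimes>\<^sub>M borel)
          (\<lambda>(x, v). (x, displacement (s n) x v))) (I n) (?N n) (R n j) (\<gamma> j)) (\<lambda>n. \<nu> n j)"
        by (simp only: Q_def)
    qed simp
  next
    assume mono: "\<forall>n\<ge>1. \<forall>j\<in>{1..L}. remainder_monotone (I n) (S n) (\<upsilon> j) (R n j)"
      and C: "\<forall>j\<in>{1..L}. ennreal_bigo (\<lambda>n. remainder_moment (P \<Otimes>\<^sub>M std_gaussian) (I n) (?N n) (R n j) (\<gamma> j)) (\<lambda>n. \<nu> n j)"
    show ?thesis
    proof (rule that[of "\<lambda>_. (\<lambda>(x, v). (x, fst v))" "\<lambda>_. P \<Otimes>\<^sub>M std_gaussian"])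
      fix n :: nat assume n: "n \<ge> 1"
      interpret proposal P f "s n" by (rule proposal[OF s_pos[OF n]])
      show "(\<lambda>(x, v). (x, fst v)) \<in> P \<Otimes>\<^sub>M aux \<rightarrow>\<^sub>M P \<Otimes>\<^sub>M std_gaussian"
        unfolding case_prod_unfold by measurable
      show "remainder_scaling (I n) (S n) L \<upsilon> (R n) (\<lambda>(x, v). (x, fst v))"
        using mono n by (intro remainder_scaling_monotone finI) auto
    next
      fix j assume j: "j \<in> {1..L}"
      have "\<forall>\<^sub>F n in sequentially. remainder_moment (distr (proposal.moves P f (s n)) (P \<Otimes>\<^sub>M std_gaussian)
          (\<lambda>(x, v). (x, fst v))) (I n) (?N n) (R n j) (\<gamma> j) =
          remainder_moment (P \<Otimes>\<^sub>M std_gaussian) (I n) (?N n) (R n j) (\<gamma> j)"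
        using eventually_ge_at_top[of 1]
        by eventually_elim (simp only: proposal.distr_moves_fst[OF proposal[OF s_pos]])
      moreover obtain C0 where "\<forall>\<^sub>F n in sequentially.
          remainder_moment (P \<Otimes>\<^sub>M std_gaussian) (I n) (?N n) (R n j) (\<gamma> j) \<le> ennreal (C0 * \<nu> n j)"
        using C j unfolding ennreal_bigo_def by blast
      ultimately have "\<forall>\<^sub>F n in sequentially. remainder_moment (distr (proposal.moves P f (s n)) (P \<Otimes>\<^sub>M std_gaussian)
          (\<lambda>(x, v). (x, fst v))) (I n) (?N n) (R n j) (\<gamma> j) \<le> ennreal (C0 * \<nu> n j)"
        by eventually_elim simp
      thus "ennreal_bigo (\<lambda>n. remainder_moment (distr (proposal.moves P f (s n)) (P \<Otimes>\<^sub>M std_gaussian)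
          (\<lambda>(x, v). (x, fst v))) (I n) (?N n) (R n j) (\<gamma> j)) (\<lambda>n. \<nu> n j)"
        unfolding ennreal_bigo_def by blast
    qed simp
  qed

  obtain c1 where c1: "0 \<le> c1" "\<forall>\<^sub>F n in sequentially. \<forall>C\<ge>c1.
      gradient_moment P (I n) (?N n) (H n) lam \<le> ennreal (C * \<sigma> n)"
    using ennreal_bigoE[OF C1 \<sigma>_pos] by blast
  obtain c2 where c2: "0 \<le> c2" "\<forall>\<^sub>F n in sequentially. \<forall>j\<in>{1..L}. \<forall>C\<ge>c2. remainder_moment
        (distr (proposal.moves P f (s n)) (E n) (T n)) (I n) (?N n) (R n j) (\<gamma> j) \<le> ennreal (C * \<nu> n j)"
    by (rule ennreal_bigo_uniformE[of "{1..L}"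
      "\<lambda>j n. remainder_moment (distr (proposal.moves P f (s n)) (E n) (T n)) (I n) (?N n) (R n j) (\<gamma> j)"
      "\<lambda>j n. \<nu> n j"]) (use C2 \<nu>_pos in auto)
  obtain c3 where c3: "0 \<le> c3" "\<forall>\<^sub>F n in sequentially. \<forall>j\<in>{1..L}. \<forall>C\<ge>c3.
      Lp_norm (?A n) (1 + \<gamma> j) (\<lambda>x. ennreal (R' n j x)) \<le> ennreal (C * \<nu>' n j)"
    by (rule ennreal_bigo_uniformE[of "{1..L}"
      "\<lambda>j n. Lp_norm (?A n) (1 + \<gamma> j) (\<lambda>x. ennreal (R' n j x))" "\<lambda>j n. \<nu>' n j"]) (use C2' \<nu>_pos in auto)
  obtain c4 where c4: "0 < c4" "\<forall>\<^sub>F n in sequentially. norm (\<theta> n) \<le> c4 * norm (\<tau> n * s n)"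
    using \<theta>_bound unfolding s_def q_def by (elim landau_o.bigE) blast
  define C where "C = c1 + c2 + c3 + c4"
  have C: "0 \<le> C" "c1 \<le> C" "c2 \<le> C" "c3 \<le> C" "c4 \<le> C"
    using c1(1) c2(1) c3(1) c4(1) by (auto simp: C_def)
  define Kg where "Kg = C + 1 + (C + 1) powr ((1 + lam) / lam)"
  define K where "K = C + (Kg * (1 + 2 powr (1 + lam) * Cr) + (\<Sum>j=1..L. 2 * moment_const C (\<gamma> j)))"
  have K: "0 \<le> K"
    unfolding K_def Kg_def using C Cr(1)
    by (intro add_nonneg_nonneg mult_nonneg_nonneg sum_nonneg moment_const_nonneg) auto

  \<comment> \<open>\<open>K\<close> and the threshold for \<open>n\<close> do not depend on
    \<open>B\<close>, \<open>\<kappa>\<close> and \<open>M\<close>, so these may be chosen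
    afterwards.\<close>
  have tail: "\<forall>\<^sub>F n in sequentially. \<forall>B \<kappa> M. 0 < B \<longrightarrow> 0 < \<kappa> \<longrightarrow> 4 * exp ((512 * B\<^sup>2)\<^sup>2) \<le> real M \<longrightarrow>
      outer_measure_of (?A n) (separated_event (?A n) (?N n) (gradient_dist (I n) (H n)) (\<tau> n * \<kappa>) M)
        \<le> ennreal (K / (B * \<kappa>))"
    using c1(2) c2(2) c3(2) c4(2) eventually_ge_at_top[of 1]
  proof eventually_elim
    case (elim n)
    note n = elim(5)
    interpret proposal P f "s n" by (rule proposal[OF s_pos[OF n]])
    have rejn: "(\<integral>\<^sup>+ x. \<integral>\<^sup>+ w. ennreal (norm w powr (1 + lam) * (1 - acc x w)) \<partial>std_gaussian \<partial>P) \<le> ennreal (Cr * s n)"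
    proof -
      have "1 - acc x w = max 0 (1 - f (x + s n *\<^sub>R w) / f x)" for x w
        by (auto simp: accept_prob_def min_def max_def)
      moreover have "(\<lambda>(x, w). ennreal (norm w powr q * max 0 (1 - f (x + s n *\<^sub>R w) / f x))) \<in>
          borel_measurable (P \<Otimes>\<^sub>M std_gaussian)"
        by measurable
      ultimately show ?thesis
        using Cr(2)[of "s n"] s_pos by (simp add: G.nn_integral_fst[symmetric] q_def)
    qed
    have "\<theta> n \<le> C * (s n * \<tau> n)"
    proof -
      have "\<theta> n \<le> c4 * (s n * \<tau> n)" using elim(4) \<tau>_pos[OF n] s_pos by (simp add: mult.commute)
      also have "\<dots> \<le> C * (s n * \<tau> n)" using C \<tau>_pos[OF n] s_pos by (intro mult_right_mono) auto
      finally show ?thesis .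
    qed
    moreover have "\<And>j. j \<in> {1..L} \<Longrightarrow> 0 < \<nu> n j" "\<And>j. j \<in> {1..L} \<Longrightarrow> 0 < \<nu>' n j"
      using \<nu>_pos n by blast+
    moreover have "gradient_moment P (I n) (?N n) (H n) lam \<le> ennreal (C * \<sigma> n)"
      using elim(1) C(2) by blast
    moreover have "remainder_moment (distr moves (E n) (T n)) (I n) (?N n) (R n j) (\<gamma> j) \<le> ennreal (C * \<nu> n j)"
      if "j \<in> {1..L}" for j
      using elim(2) C(3) that by blast
    moreover have "Lp_norm (?A n) (1 + \<gamma> j) (\<lambda>x. ennreal (R' n j x)) \<le> ennreal (C * \<nu>' n j)"
      if "j \<in> {1..L}" for j
      using elim(3) C(4) that by blast
    ultimately show ?case
      unfolding K_def Kg_def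
      by (intro allI impI outer_measure_packing_tail[where \<nu> = "\<nu> n" and \<nu>' = "\<nu>' n",
        OF finI[OF n] uniqueness[OF n] regularity[OF n]
        taylor_measurable[OF n] B1[OF n] \<theta>_pos[OF n] \<sigma>_pos[OF n] \<tau>_pos[OF n] _ _ lam_nonneg C(1) less_imp_le[OF Cr(1)] _
        T(1)[OF n] T(2) scaling[OF n] _ _ rejn s1[OF n, unfolded q_def] s2[OF n]])
  qed

  show ?thesis
  proof (intro allI impI)
    fix \<epsilon> :: real assume "0 < \<epsilon>"
    show "tight_family {1..} ?A (\<lambda>n x. packing_number (?N n x) (mdist (S n)) \<epsilon>)"
      unfolding tight_family_def
    proof (intro allI impI)
      fix \<delta> :: real assume \<delta>: "0 < \<delta>"
      \<comment> \<open>Assumption (C3) covers radii below \<open>\<epsilon>0\<close> only;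
        shrinking the radius can only increase the packing number.\<close>
      define \<epsilon>' where "\<epsilon>' = min \<epsilon> (\<epsilon>0 / 2)"
      have \<epsilon>': "0 < \<epsilon>'" "\<epsilon>' < \<epsilon>0" "\<epsilon>' \<le> \<epsilon>" using \<open>0 < \<epsilon>\<close> \<epsilon>0_pos by (auto simp: \<epsilon>'_def)
      let ?p = "\<lambda>n x. packing_number (?N n x) (mdist (S n)) \<epsilon>"
      let ?p' = "\<lambda>n x. packing_number (?N n x) (mdist (S n)) \<epsilon>'"
      obtain \<kappa> K0 where \<kappa>: "0 < \<kappa>" and lim: "limsup (\<lambda>n. outer_measure_of (?A n) {x \<in> space (?A n).
          ?p' n x > enat K0 * packing_number (?N n x) (gradient_dist (I n) (H n) x) (\<tau> n * \<kappa>)}) \<le> ennreal (\<delta> / 4)"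
        using C3[OF \<epsilon>'(1,2), of "\<delta> / 4"] \<delta> by auto
      \<comment> \<open>The gap between \<open>\<delta> / 4\<close> and \<open>\<delta> / 2\<close>
        turns the bound on the limit superior into one that holds eventually.\<close>
      have "ennreal (\<delta> / 4) < ennreal (\<delta> / 2)" using \<delta> by (intro ennreal_lessI) auto
      with lim have ev1: "\<forall>\<^sub>F n in sequentially. outer_measure_of (?A n) {x \<in> space (?A n).
          ?p' n x > enat K0 * packing_number (?N n x) (gradient_dist (I n) (H n) x) (\<tau> n * \<kappa>)} < ennreal (\<delta> / 2)"
        by (intro Limsup_lessD) (rule order.strict_trans1)
      \<comment> \<open>Chosen so that \<open>K / (B * \<kappa>) \<le> \<delta> / 2\<close>; the
        added 1 keeps \<open>B\<close> positive when \<open>K = 0\<close>.\<close>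
      define B where "B = K / \<kappa> / (\<delta> / 2) + 1"
      have B: "0 < B" using K \<kappa> \<delta> by (auto simp: B_def intro!: add_nonneg_pos)
      have KB: "K / (B * \<kappa>) \<le> \<delta> / 2"
      proof -
        have "K / \<kappa> \<le> B * (\<delta> / 2)" using \<delta> by (simp add: B_def distrib_right)
        thus ?thesis using B \<kappa> by (simp add: field_simps)
      qed
      define M where "M = nat \<lceil>4 * exp ((512 * B\<^sup>2)\<^sup>2)\<rceil>"
      have M: "4 * exp ((512 * B\<^sup>2)\<^sup>2) \<le> real M" unfolding M_def by (rule real_nat_ceiling_ge)
      have "\<forall>\<^sub>F n in sequentially. outer_measure_of (?A n) {x \<in> space (?A n). ?p n x > enat (K0 * M)} \<le> ennreal \<delta>"
        using ev1 tail
      proof eventually_elim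
        case (elim n)
        let ?U = "{x \<in> space (?A n). ?p' n x > enat K0 * packing_number (?N n x) (gradient_dist (I n) (H n) x) (\<tau> n * \<kappa>)}"
        let ?V = "separated_event (?A n) (?N n) (gradient_dist (I n) (H n)) (\<tau> n * \<kappa>) M"
        \<comment> \<open>Outside \<open>?U\<close> the packing number for the original metric is at
          most \<open>K0\<close> times that for the gradients, and more than \<open>M\<close>
          separated points for the gradients put \<open>x\<close> into \<open>?V\<close>.\<close>
        have "{x \<in> space (?A n). ?p n x > enat (K0 * M)} \<subseteq> ?U \<union> ?V"
        proof
          fix x assume x: "x \<in> {x \<in> space (?A n). ?p n x > enat (K0 * M)}"
          let ?d = "packing_number (?N n x) (gradient_dist (I n) (H n) x) (\<tau> n * \<kappa>)"
          have "enat (K0 * M) < ?p' n x"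
            using x packing_number_antimono[OF \<epsilon>'(3), of "?N n x" "mdist (S n)"] by auto
          show "x \<in> ?U \<union> ?V"
          proof (cases "?d \<le> enat M")
            case True
            have "enat K0 * ?d \<le> enat K0 * enat M" by (intro mult_left_mono True) auto
            also have "\<dots> < ?p' n x" using \<open>enat (K0 * M) < ?p' n x\<close> by simp
            finally show ?thesis using x by simp
          next
            case False
            hence "enat M < ?d" by simp
            then obtain A where "A \<subseteq> ?N n x" "finite A" "card A = Suc M"
              "\<forall>\<omega>\<in>A. \<forall>\<omega>'\<in>A. \<omega> \<noteq> \<omega>' \<longrightarrow> \<tau> n * \<kappa> < gradient_dist (I n) (H n) x \<omega> \<omega>'"
              by (rule packing_number_gtD)
            hence "x \<in> ?V" using x by (auto simp: separated_event_def intro!: exI[of _ A])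
            thus ?thesis ..
          qed
        qed
        hence "outer_measure_of (?A n) {x \<in> space (?A n). ?p n x > enat (K0 * M)} \<le> outer_measure_of (?A n) (?U \<union> ?V)"
          by (rule outer_measure_of_mono)
        also have "\<dots> \<le> outer_measure_of (?A n) ?U + outer_measure_of (?A n) ?V"
          by (rule outer_measure_of_Un_le)
        also have "\<dots> \<le> ennreal (\<delta> / 2) + ennreal (K / (B * \<kappa>))"
          using elim(1) elim(2)[rule_format, OF B \<kappa> M] by (intro add_mono) auto
        also have "\<dots> \<le> ennreal (\<delta> / 2) + ennreal (\<delta> / 2)"
          by (intro add_left_mono ennreal_leI KB)
        also have "\<dots> = ennreal \<delta>" using \<delta> by (simp add: ennreal_plus[symmetric] del: ennreal_plus)
        finally show ?case .
      qed
      then obtain n0 where n0: "\<And>n. n \<ge> n0 \<Longrightarrow>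
          outer_measure_of (?A n) {x \<in> space (?A n). ?p n x > enat (K0 * M)} \<le> ennreal \<delta>"
        by (auto simp: eventually_at_top_linorder)
      have "\<exists>k. packing_number (mspace (S n)) (mdist (S n)) \<epsilon> \<le> enat k" if "n \<ge> 1" for n
      proof -
        have "compact_space (mtopology_of (S n))" using problems[OF that] by (simp add: random_min_problem_def)
        from packing_number_mspace_bounded[OF this \<open>0 < \<epsilon>\<close>] show ?thesis by blast
      qed
      then obtain k where k: "\<And>n. n \<ge> 1 \<Longrightarrow> packing_number (mspace (S n)) (mdist (S n)) \<epsilon> \<le> enat (k n)" by metis
      \<comment> \<open>The sum absorbs the finitely many problems below \<open>n0\<close>, each of
        which has a deterministic bound by compactness.\<close>
      define K1 where "K1 = K0 * M + (\<Sum>n<n0. k n)"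
      show "\<exists>K. \<forall>n\<in>{1..}. outer_measure_of (?A n) {x \<in> space (?A n). ?p n x > enat K} \<le> ennreal \<delta>"
      proof (intro exI ballI)
        fix n :: nat assume n: "n \<in> {1..}"
        show "outer_measure_of (?A n) {x \<in> space (?A n). ?p n x > enat K1} \<le> ennreal \<delta>"
        proof (cases "n \<ge> n0")
          case True
          have "{x \<in> space (?A n). ?p n x > enat K1} \<subseteq> {x \<in> space (?A n). ?p n x > enat (K0 * M)}"
            by (auto simp: K1_def intro: order.strict_trans1[rotated])
          thus ?thesis using n0[OF True] outer_measure_of_mono order.trans by blast
        next
          case False
          have "?p n x \<le> enat K1" for x
          proof -
            have "?p n x \<le> packing_number (mspace (S n)) (mdist (S n)) \<epsilon>"
              by (intro packing_number_mono) (auto simp: near_opt_def)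
            also have "\<dots> \<le> enat (k n)" using k n by simp
            also have "\<dots> \<le> enat K1" using False member_le_sum[of n "{..<n0}" k] by (simp add: K1_def)
            finally show ?thesis .
          qed
          hence empty: "{x \<in> space (?A n). ?p n x > enat K1} = {}" by (auto simp: not_less)
          show ?thesis unfolding empty by simp
        qed
      qed
    qed
  qed
qed

end
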